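(* Let $D \subset \mathbb{C}$ be a Greenian domain. Assume that $0 \in D$, and let $f_D \colon \mathbb{D} \to D$ be a universal covering map with $f_D(0) = 0$. Let $\psi_D(r) = \int_0^{2\pi}g_D(re^{i\theta},0)\,d\theta$, $0<r<+\infty$. Then, \begin{equation*} \mathrm{h}(D) = \mathrm{h}(f_D) = \liminf_{r \to +\infty}\left(-\dfrac{\log \psi_D(r)}{\log r}\right). \end{equation*}
   Context: $H^p$ ($0<p<\infty$) is the Hardy space of holomorphic $f$ on the unit disk $\mathbb{D}$ with $\sup_{0<r<1}\int_0^{2\pi}|f(re^{i\theta})|^p d\theta<\infty$. The Hardy number of a holomorphic $f$ on $\mathbb{D}$ is $\mathrm{h}(f)=\sup(\{0\}\cup\{p>0: f\in H^p\})\in[0,+\infty]$, and for a domain $D\subset\mathbb{C}$, $\mathrm{h}(D)=\inf\{\mathrm{h}(f): f\in \mathrm{Hol}(\mathbb{D},D)\}$, where $\mathrm{Hol}(\mathbb{D},D)$ is the set of holomorphic maps $\mathbb{D}\to D$. A domain is Greenian if its complement in $\mathbb{C}$ is non-polar; then it has a Green function $g_D$. The function $z\mapsto g_D(z,0)$ is extended to $\mathbb{C}\setminus\{0\}$ by setting it equal to $0$ for $z\notin D$. *)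

theory Defs
  imports "HOL-Analysis.Analysis" "HOL-Probability.Probability"
begin

definition hardy_space :: "real \<Rightarrow> (complex \<Rightarrow> complex) set" where
  "hardy_space p = {f. f holomorphic_on ball 0 1 \<and>
     bdd_above ((\<lambda>r. integral {0..2*pi} (\<lambda>\<theta>. norm (f (of_real r * cis \<theta>)) powr p)) ` {0<..<1})}"

definition hardy_number :: "(complex \<Rightarrow> complex) \<Rightarrow> ereal" where
  "hardy_number f = Sup (ereal ` ({0} \<union> {p. p > 0 \<and> f \<in> hardy_space p}))"

definition hardy_number_dom :: "complex set \<Rightarrow> ereal" where
  "hardy_number_dom D =
     Inf (hardy_number ` {f. f holomorphic_on ball 0 1 \<and> f ` ball 0 1 \<subseteq> D})"

definition log_kernel_neg :: "complex \<Rightarrow> complex \<Rightarrow> ennreal" where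
  "log_kernel_neg z w = (if z = w then \<infinity> else ennreal (- ln (cmod (z - w))))"

text \<open>E is polar iff the energy \<open>\<integral>\<integral> log|z-w| d\<mu> d\<mu>\<close> equals -\<infinity> for every nonzero
  finite Borel measure with compact support contained in E. Since the positive part of the
  kernel is integrable for such measures, energy -\<infinity> means that the integral of the
  negative part is infinite.\<close>
definition polar :: "complex set \<Rightarrow> bool" where
  "polar E \<longleftrightarrow> (\<forall>\<mu> :: complex measure.
      sets \<mu> = sets borel \<and> finite_measure \<mu> \<and> emeasure \<mu> (space \<mu>) \<noteq> 0 \<and>
      (\<exists>K. compact K \<and> K \<subseteq> E \<and> emeasure \<mu> (space \<mu> - K) = 0)
      \<longrightarrow> (\<integral>\<^sup>+ z. (\<integral>\<^sup>+ w. log_kernel_neg z w \<partial>\<mu>) \<partial>\<mu>) = \<infinity>)"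

definition greenian :: "complex set \<Rightarrow> bool" where
  "greenian D \<longleftrightarrow> open D \<and> connected D \<and> D \<noteq> {} \<and> \<not> polar (- D)"

definition harmonic_on :: "(complex \<Rightarrow> real) \<Rightarrow> complex set \<Rightarrow> bool" where
  "harmonic_on u S \<longleftrightarrow> open S \<and> (\<forall>z\<in>S. \<exists>r>0. ball z r \<subseteq> S \<and>
      (\<exists>f. f holomorphic_on ball z r \<and> (\<forall>w\<in>ball z r. u w = Re (f w))))"

text \<open>Green function of D with pole at 0 (Ransford, Def. 4.4.1), extended by 0 off D - {0}.\<close>
definition is_green0 :: "complex set \<Rightarrow> (complex \<Rightarrow> real) \<Rightarrow> bool" where
  "is_green0 D g \<longleftrightarrow>
     harmonic_on g (D - {0}) \<and>
     (\<forall>r>0. bounded (g ` (D - ball 0 r))) \<and>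
     (\<exists>r>0. bounded ((\<lambda>z. g z + ln (cmod z)) ` (ball 0 r - {0}))) \<and>
     polar {\<zeta> \<in> frontier D. \<not> (g \<longlongrightarrow> 0) (at \<zeta> within D)} \<and>
     (\<forall>z. z \<notin> D - {0} \<longrightarrow> g z = 0)"

definition green0 :: "complex set \<Rightarrow> complex \<Rightarrow> real" where
  "green0 D = (THE g. is_green0 D g)"

definition psi_green :: "complex set \<Rightarrow> real \<Rightarrow> real" where
  "psi_green D r = integral {0..2*pi} (\<lambda>\<theta>. green0 D (of_real r * cis \<theta>))"

text \<open>The quantity \<open>-log \<psi>(r) / log r\<close>, with the convention \<open>log 0 = -\<infinity>\<close>.\<close>
definition green_growth :: "complex set \<Rightarrow> real \<Rightarrow> ereal" where
  "green_growth D r = (if psi_green D r = 0 then \<infinity>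
                       else ereal (- ln (psi_green D r) / ln r))"

end

theory Submission
  imports Defs "HOL-Complex_Analysis.Complex_Analysis" "HOL-Real_Asymp.Real_Asymp"
begin

text \<open>For the covering map \<open>f = f_D\<close> let \<open>N(w) = \<Sum> log (1/|z|)\<close>, summed over the preimages of
  \<open>w\<close>. Jensen's formula says that \<open>log |w| + N(w)\<close> is the increasing limit, as \<open>r\<close> tends to 1, of
  the circular means of \<open>log |f - w|\<close>. Averaging it over \<open>|w| = R\<close> (Cartan) gives \<open>\<integral> N(R e^{it})
  dt = lim \<integral> log^+ (|f(r e^{it})| / R) dt\<close>, so once \<open>N\<close> is known to be the Green function, the
  decay rate of \<open>\<psi>_D\<close> is the growth rate of the means of \<open>f\<close>, that is, \<open>h(f)\<close>. Every holomorphic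
  map into \<open>D\<close> lifts through \<open>f\<close>, and Littlewood subordination (with a Poisson kernel, as the lift
  need not fix 0) gives \<open>h(D) = h(f)\<close>.

  That \<open>N\<close> is the Green function rests on measures of finite energy. Such a measure off \<open>D\<close> yields
  a harmonic majorant of \<open>log^+ |f|\<close>, so \<open>N\<close> is finite; it is harmonic as a sum of positive
  harmonic functions. Integrating the truncated kernel \<open>log^+ (e / |f - w|)\<close> against a measure of
  finite energy on the set where \<open>N\<close> fails to tend to 0 shows that this set is polar. For
  uniqueness, \<open>f\<close> is a quotient of bounded functions and so has boundary values, which lie on the
  frontier of \<open>D\<close>; by Jensen's formula their law has finite energy, hence does not charge polar
  sets, and a bounded harmonic function vanishing at nearly every frontier point vanishes
  identically.\<close>

section \<open>Means over the unit circle\<close>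

text \<open>All potential theory has to be drawn from the definition of \<open>polar\<close>, which
  speaks only of energies: a non-polar complement offers one measure of finite energy, whose
  potential need not be bounded. The remedy is to pass to a part of the measure with uniformly small
  truncated potentials; this is done once to get a potential bounded below on D and once to test
  boundary regularity. As \<open>green0\<close> is given by \<open>THE\<close>, existence and
  uniqueness must both be settled before anything can be said about \<open>psi_green\<close>. The
  covering map supplies both: its counting function is explicit, and a bounded harmonic function on
  D, pulled back to the disc, is governed by radial limits. These are taken along one sequence of
  radii, thinned so that squared increments decay geometrically. The link between decay and Hardy
  class is that x^p is at most a constant plus a multiple of the sum over k of e^(pk) log^+ (x /
  e^k): decay R^(-q) of the means of log^+ (|f| / R) gives a geometric series with ratio e^(p - q)
  for p < q. The converse is log^+ y <= y^p / p.\<close>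

definition unit_cis :: "real \<Rightarrow> complex" where
  "unit_cis t = cis (2 * pi * t)"

abbreviation circ :: "real \<Rightarrow> real \<Rightarrow> complex" where
  "circ r t \<equiv> of_real r * unit_cis t"

lemma norm_unit_cis [simp]: "norm (unit_cis t) = 1"
  by (simp add: unit_cis_def)

lemma unit_cis_nonzero [simp]: "unit_cis t \<noteq> 0"
  by (metis norm_unit_cis norm_zero zero_neq_one)

lemma continuous_on_unit_cis [continuous_intros]:
  "continuous_on S g \<Longrightarrow> continuous_on S (\<lambda>x. unit_cis (g x))"
  unfolding unit_cis_def by (intro continuous_intros)

lemma unit_cis_measurable [measurable]: "unit_cis \<in> borel_measurable borel"
  by (intro borel_measurable_continuous_onI continuous_intros)

text \<open>Pushing Lebesgue measure forward to the Borel sets makes every measurability goal a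
  Borel one, so that continuity settles it and product measures apply directly. Total mass one turns
  circle integrals into means.\<close>

definition unif01 :: "real measure" where
  "unif01 = distr (lebesgue_on {0..1}) borel (\<lambda>t. t)"

lemma measurable_id_lebesgue_on: "(\<lambda>t::real. t) \<in> lebesgue_on {0..1} \<rightarrow>\<^sub>M borel"
  by (intro continuous_imp_measurable_on_sets_lebesgue continuous_intros) auto

lemma sets_unif01 [measurable_cong, simp]: "sets unif01 = sets borel"
  by (simp add: unif01_def)

lemma space_unif01 [simp]: "space unif01 = UNIV"
  by (simp add: unif01_def)

lemma borel_measurable_unif01: "borel_measurable unif01 = borel_measurable borel"
  by (rule measurable_cong_sets) auto

lemma prob_space_unif01: "prob_space unif01"
  unfolding unif01_def
proof (rule prob_space.prob_space_distr)
  show "prob_space (lebesgue_on {0..1::real})"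
    by (intro prob_spaceI) (simp add: emeasure_restrict_space)
qed (rule measurable_id_lebesgue_on)

interpretation unif01: prob_space unif01
  by (rule prob_space_unif01)

lemma prob_unif01_UNIV [simp]: "measure unif01 UNIV = 1"
  using unif01.prob_space by simp

lemma integrable_unif01_HK:
  fixes F :: "real \<Rightarrow> 'b :: euclidean_space"
  assumes "integrable unif01 F"
  shows "(F has_integral (LINT t|unif01. F t)) {0..1}"
proof -
  have m: "F \<in> borel_measurable borel"
    using borel_measurable_integrable[OF assms] by simp
  have "integrable (lebesgue_on {0..1}) F"
    using assms m unfolding unif01_def
      by (subst (asm) integrable_distr_eq) (auto intro: measurable_id_lebesgue_on)
  moreover have "(LINT t|unif01. F t) = (LINT t|lebesgue_on {0..1}. F t)"
    using m unfolding unif01_def by (subst integral_distr) (auto intro: measurable_id_lebesgue_on)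
  ultimately show ?thesis
    by (metis has_integral_integral_lebesgue_on atLeastAtMost_borel sets_completionI_sets sets_lborel)
qed

text \<open>The Hardy means and \<open>psi_green\<close> are defined with the gauge integral over an
  interval of length 2 pi; this is the passage to means with respect to
  \<open>unif01\<close>.\<close>

lemma integral_2pi_eq:
  fixes F :: "complex \<Rightarrow> real"
  assumes "integrable unif01 (\<lambda>t. F (unit_cis t))"
  shows "integral {0..2*pi} (\<lambda>\<theta>. F (cis \<theta>)) = 2 * pi * (LINT t|unif01. F (unit_cis t))"
proof -
  have "((\<lambda>t. F (unit_cis t)) has_integral (LINT t|unif01. F (unit_cis t))) {0..1}"
    using integrable_unif01_HK[OF assms] by simp
  from has_integral_stretch_real[OF this, of "1 / (2*pi)"]
  have "((\<lambda>\<theta>. F (cis \<theta>)) has_integral 2 * pi * (LINT t|unif01. F (unit_cis t))) ((\<lambda>x. x * (2*pi)) ` {0..1})"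
    by (simp add: unit_cis_def)
  also have "(\<lambda>x. x * (2*pi)) ` {0..1} = {0..2*pi}"
    using image_mult_atLeastAtMost[of "2 * pi" 0 1] by (simp add: mult.commute)
  finally show ?thesis
    by blast
qed

lemma bounded_unif01_integrable:
  fixes F :: "real \<Rightarrow> 'b :: {second_countable_topology, banach}"
  assumes "continuous_on UNIV F" "\<And>t. norm (F t) \<le> B"
  shows "integrable unif01 F"
  using assms by (intro unif01.integrable_const_bound[where B=B])
    (auto simp: borel_measurable_unif01 intro: borel_measurable_continuous_onI)

lemma continuous_circle:
  fixes g :: "complex \<Rightarrow> 'b :: metric_space"
  assumes "continuous_on (sphere a r) g" "r \<ge> 0"
  shows "continuous_on UNIV (\<lambda>t. g (a + circ r t))"
  using assms by (intro continuous_on_compose2[OF assms(1)] continuous_intros) (auto simp: norm_mult dist_norm)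

lemma integrable_circle:
  fixes g :: "complex \<Rightarrow> 'b :: {second_countable_topology, banach}"
  assumes "continuous_on (sphere a r) g" "r \<ge> 0"
  shows "integrable unif01 (\<lambda>t. g (a + circ r t))"
proof -
  have "compact (g ` sphere a r)"
    by (intro compact_continuous_image assms) auto
  then obtain B where "\<And>u. u \<in> sphere a r \<Longrightarrow> norm (g u) \<le> B"
    by (metis bounded_iff compact_imp_bounded imageI)
  then have "norm (g (a + circ r t)) \<le> B" for t
    using assms(2) by (simp add: norm_mult dist_norm)
  with continuous_circle[OF assms] show ?thesis
    by (rule bounded_unif01_integrable)
qed

text \<open>At most two parameters in [0,1] hit a given direction. This discards the points where a
  logarithm of \<open>f - w\<close> is singular on a circle.\<close>

lemma AE_unit_cis_neq: "AE t in unif01. unit_cis t \<noteq> a"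
proof -
  have "finite {t \<in> {0..1}. unit_cis t = a}"
  proof -
    have inj: "s = t" if "s \<in> {0..<1}" "t \<in> {0..<1}" "unit_cis s = unit_cis t" for s t
    proof -
      have "sin (2 * pi * s) = sin (2 * pi * t)" "cos (2 * pi * s) = cos (2 * pi * t)"
        using that(3) by (auto simp: unit_cis_def complex_eq_iff)
      then obtain n :: int where "2 * pi * s = 2 * pi * t + 2 * pi * n"
        using sin_cos_eq_iff by metis
      then have "2 * pi * s = 2 * pi * (t + n)"
        by (simp add: algebra_simps)
      then have "s = t + n"
        by simp
      with that have "n = 0"
        by auto
      with \<open>s = t + n\<close> show ?thesis
        by simp
    qed
    have "\<exists>x. {t \<in> {0..<1}. unit_cis t = a} \<subseteq> {x}"
    proof (cases "\<exists>s\<in>{0..<1}. unit_cis s = a")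
      case True
      then obtain s where "s \<in> {0..<1}" "unit_cis s = a" by auto
      with inj have "{t \<in> {0..<1}. unit_cis t = a} \<subseteq> {s}" by blast
      then show ?thesis ..
    next
      case False
      then have "{t \<in> {0..<1}. unit_cis t = a} = {}" by blast
      then show ?thesis by (metis empty_subsetI)
    qed
    then have "finite {t \<in> {0..<1}. unit_cis t = a}"
      using finite_subset by blast
    moreover have "{t \<in> {0..1}. unit_cis t = a} \<subseteq> insert 1 {t \<in> {0..<1}. unit_cis t = a}"
      by auto
    ultimately show ?thesis
      using finite_subset by blast
  qed
  then have "negligible {t \<in> {0..1}. unit_cis t = a}"
    by (rule negligible_finite)
  then have "AE t in lebesgue. t \<notin> {t \<in> {0..1}. unit_cis t = a}"
    by (intro AE_not_in) (simp add: negligible_iff_null_sets)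
  then have "AE t in lebesgue_on {0..1}. unit_cis t \<noteq> a"
    by (subst AE_restrict_space_iff) (auto elim!: eventually_mono)
  then show ?thesis
    unfolding unif01_def by (subst AE_distr_iff) (auto intro: measurable_id_lebesgue_on)
qed

text \<open>On the circle dz = 2 pi i (z - a) dt, so a contour integral becomes the mean of F times
  \<open>circ r t\<close>. Cauchy's formulas for values and for Taylor coefficients are both read
  off from it.\<close>

lemma circle_mean_contour:
  assumes r: "0 < r" and F: "continuous_on (sphere a r) F"
    and I: "(F has_contour_integral 2 * of_real pi * \<i> * c) (circlepath a r)"
  shows "(LINT t|unif01. F (a + circ r t) * circ r t) = c"
    and "integrable unif01 (\<lambda>t. F (a + circ r t) * circ r t)"
proof -
  have "continuous_on (sphere a r) (\<lambda>z. F z * (z - a))" by (intro continuous_intros F)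
  from integrable_circle[OF this] r
  show i: "integrable unif01 (\<lambda>t. F (a + circ r t) * circ r t)" by simp
  from I have "((\<lambda>x. F (circlepath a r x) * vector_derivative (circlepath a r) (at x within {0..1}))
      has_integral 2 * of_real pi * \<i> * c) {0..1}"
    by (simp add: has_contour_integral_def)
  then have "((\<lambda>x. 2 * of_real pi * \<i> * (F (a + circ r x) * circ r x)) has_integral 2 * of_real pi * \<i> *
    c) {0..1}"
    by (rule has_integral_eq[rotated])
      (auto simp: vector_derivative_circlepath01, auto simp: circlepath cis_conv_exp unit_cis_def mult_ac)
  then have "((\<lambda>x. F (a + circ r x) * circ r x) has_integral c) {0..1}"
    by (subst (asm) has_integral_mult_right_iff) auto
  then show "(LINT t|unif01. F (a + circ r t) * circ r t) = c"
    using integrable_unif01_HK[OF i] has_integral_unique by blast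
qed

section \<open>Mean value formulas on circles\<close>

lemma holomorphic_continuous_sphere:
  "g holomorphic_on ball a R \<Longrightarrow> r < R \<Longrightarrow> continuous_on (sphere a r) g"
  by (rule holomorphic_on_imp_continuous_on) (auto elim!: holomorphic_on_subset)

lemma holomorphic_continuous_cball:
  "g holomorphic_on ball a R \<Longrightarrow> r < R \<Longrightarrow> continuous_on (cball a r) g"
  by (rule holomorphic_on_imp_continuous_on) (auto elim!: holomorphic_on_subset)

lemma continuous_holomorphic_circle:
  "g holomorphic_on ball 0 1 \<Longrightarrow> 0 \<le> r \<Longrightarrow> r < 1 \<Longrightarrow> continuous_on UNIV (\<lambda>t. g (circ r t))"
  using continuous_circle[of 0 r g] holomorphic_continuous_sphere[of g 0 1 r] by simp

lemma measurable_holomorphic_circle: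
  "g holomorphic_on ball 0 1 \<Longrightarrow> 0 \<le> r \<Longrightarrow> r < 1 \<Longrightarrow> (\<lambda>t. g (circ r t)) \<in> borel_measurable unif01"
  unfolding borel_measurable_unif01
  by (intro borel_measurable_continuous_onI continuous_holomorphic_circle)

lemma bounded_holomorphic_circle:
  assumes "g holomorphic_on ball 0 1" "0 \<le> r" "r < 1"
  obtains B where "B > 0" "\<And>t. norm (g (circ r t)) \<le> B"
proof -
  have "compact (g ` cball 0 r)"
    using assms by (intro compact_continuous_image holomorphic_continuous_cball[of _ _ 1]) auto
  then obtain B where "B > 0" "\<And>z. z \<in> cball 0 r \<Longrightarrow> norm (g z) \<le> B"
    by (metis bounded_pos compact_imp_bounded imageI)
  with that assms show thesis by (auto simp: norm_mult)
qed

lemma circle_mean_holomorphic: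
  assumes "g holomorphic_on ball a R" "0 \<le> r" "r < R"
  shows "(LINT t|unif01. g (a + circ r t)) = g a"
    and "integrable unif01 (\<lambda>t. g (a + circ r t))"
proof -
  show "integrable unif01 (\<lambda>t. g (a + circ r t))"
    using assms by (intro integrable_circle holomorphic_continuous_sphere)
  show "(LINT t|unif01. g (a + circ r t)) = g a"
  proof (cases "r = 0")
    case False
    with assms have r: "r > 0" by simp
    have "((\<lambda>u. g u / (u - a)) has_contour_integral (2 * of_real pi * \<i> * g a)) (circlepath a r)"
      using r assms by (intro Cauchy_integral_circlepath holomorphic_continuous_cball[of _ _ R])
        (auto elim!: holomorphic_on_subset)
    moreover have "continuous_on (sphere a r) (\<lambda>u. g u / (u - a))"
      using r assms by (intro continuous_intros holomorphic_continuous_sphere[of _ _ R]) auto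
    ultimately show ?thesis using circle_mean_contour(1)[OF r] r by fastforce
  qed simp
qed

lemma circle_mean_Re:
  assumes "g holomorphic_on ball a R" "0 \<le> r" "r < R"
  shows "(LINT t|unif01. Re (g (a + circ r t))) = Re (g a)"
    and "integrable unif01 (\<lambda>t. Re (g (a + circ r t)))"
  using circle_mean_holomorphic[OF assms] by auto

text \<open>\<open>Ln (1 - c * u)\<close> is holomorphic on a disc of radius R > 1 with R |c| < 1,
  since 1 - c u has positive real part there; its value at the centre is 0.\<close>

lemma circle_mean_ln_one_minus:
  assumes "norm c < 1"
  shows "(LINT t|unif01. ln (norm (1 - c * unit_cis t))) = 0"
proof -
  define g where "g u = Ln (1 - c * u)" for u
  obtain R where R: "R > 1" "R * norm c < 1"
  proof (cases "c = 0")
    case False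
    with assms obtain R where "1 < R" "R < 1 / norm c"
      using dense[of 1 "1 / norm c"] by auto
    with False that show ?thesis by (simp add: field_simps)
  qed (use that[of 2] in auto)
  have small: "norm (c * u) < 1" if "u \<in> ball 0 R" for u
  proof -
    have "norm c * norm u \<le> norm c * R"
      using that by (intro mult_left_mono) auto
    with R show ?thesis
      by (simp add: norm_mult mult.commute)
  qed
  have pos: "Re (1 - c * u) > 0" if "u \<in> ball 0 R" for u
    using small[OF that] complex_Re_le_cmod[of "c * u"] by simp
  have "g holomorphic_on ball 0 R"
    unfolding g_def
  proof (intro holomorphic_intros)
    show "1 - c * u \<notin> \<real>\<^sub>\<le>\<^sub>0" if "u \<in> ball 0 R" for u
      using pos[OF that] by (metis complex_nonpos_Reals_iff not_less)
  qed
  from circle_mean_Re[OF this, of 1] R have "(LINT t|unif01. Re (g (unit_cis t))) = 0"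
    by (simp add: g_def)
  moreover have "Re (g (unit_cis t)) = ln (norm (1 - c * unit_cis t))" for t
  proof -
    have "1 - c * unit_cis t \<noteq> 0"
      using pos[of "unit_cis t"] R by force
    then show ?thesis by (simp add: g_def)
  qed
  ultimately show ?thesis by simp
qed

text \<open>Conjugation and a unimodular factor bring the distance to a moving point of the circle
  into the form to which \<open>circle_mean_ln_one_minus\<close> applies.\<close>

lemma norm_minus_circle:
  assumes "R > 0" 
  shows "norm (z - circ R t) = R * norm (1 - cnj z / R * unit_cis t)"
proof -
  define v where "v = unit_cis t"
  define q where "q = 1 - cnj z / R * v"
  have v: "v * cnj v = 1" "norm v = 1"
    unfolding v_def by (metis complex_norm_square norm_unit_cis of_real_1 one_power2, simp)
  have "- v * of_real R * cnj q = z * (v * cnj v) - of_real R * v"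
    using assms by (simp add: q_def field_simps) 
  then have "norm (z - of_real R * v) = norm (- v * of_real R * cnj q)"
    by (simp add: v)
  also have "\<dots> = R * norm q"
    using assms v by (simp add: norm_mult)
  finally show ?thesis by (simp add: q_def v_def)
qed

lemma circle_mean_ln_off:
  assumes "R > 0" "norm z \<noteq> R"
  shows "(LINT t|unif01. ln (norm (z - circ R t))) = ln (max (norm z) R)"
proof (cases "norm z < R")
  case True
  define c where "c = cnj z / R"
  have c: "norm c < 1" using True assms by (simp add: c_def norm_divide)
  have nz: "1 - c * unit_cis t \<noteq> 0" for t
    using c by (metis eq_iff_diff_eq_0 less_irrefl mult.right_neutral norm_mult norm_one norm_unit_cis)
  have "ln (norm (z - circ R t)) = ln R + ln (norm (1 - c * unit_cis t))" for t
    using nz[of t] assms unfolding norm_minus_circle[OF assms(1)] c_def by (simp add: ln_mult)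
  moreover have "integrable unif01 (\<lambda>t. ln (norm (1 - c * unit_cis t)))"
  proof -
    have "1 - c * u \<noteq> 0" if "norm u = 1" for u
      using c that by (metis eq_iff_diff_eq_0 less_irrefl mult.right_neutral norm_mult norm_one)
    then have "continuous_on (sphere 0 1) (\<lambda>u. ln (norm (1 - c * u)))"
      by (intro continuous_intros) auto
    from integrable_circle[OF this] show ?thesis by simp
  qed
  ultimately show ?thesis
    using True circle_mean_ln_one_minus[OF c] by (simp add: max_def)
next
  case False
  define c where "c = of_real R / z"
  from False assms have z: "z \<noteq> 0" "norm z > R" by auto
  with assms have c: "norm c < 1" by (simp add: c_def norm_divide)
  have nz: "1 - c * unit_cis t \<noteq> 0" for t
    using c by (metis eq_iff_diff_eq_0 less_irrefl mult.right_neutral norm_mult norm_one norm_unit_cis)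
  have "z - circ R t = z * (1 - c * unit_cis t)" for t
    using z by (simp add: c_def field_simps)
  then have "ln (norm (z - circ R t)) = ln (norm z) + ln (norm (1 - c * unit_cis t))" for t
    using nz[of t] z by (simp add: ln_mult norm_mult)
  moreover have "integrable unif01 (\<lambda>t. ln (norm (1 - c * unit_cis t)))"
  proof -
    have "1 - c * u \<noteq> 0" if "norm u = 1" for u
      using c that by (metis eq_iff_diff_eq_0 less_irrefl mult.right_neutral norm_mult norm_one)
    then have "continuous_on (sphere 0 1) (\<lambda>u. ln (norm (1 - c * u)))"
      by (intro continuous_intros) auto
    from integrable_circle[OF this] show ?thesis by simp
  qed
  ultimately show ?thesis
    using z circle_mean_ln_one_minus[OF c] by (simp add: max_def)
qed

text \<open>For \<open>norm z = R\<close> the kernel is singular; the value is obtained by dominated convergence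
  from the centres \<open>s *\<^sub>R z\<close>, \<open>s < 1\<close>, since \<open>norm (z - R u) \<le> 2 * norm (s z - R u)\<close>.\<close>

lemma circle_mean_ln:
  assumes "R > 0"
  shows "integrable unif01 (\<lambda>t. ln (norm (z - circ R t)))"
    and "(LINT t|unif01. ln (norm (z - circ R t))) = ln (max (norm z) R)"
proof -
  let ?F = "\<lambda>w t. ln (norm (w - circ R t))"
  have *: "integrable unif01 (?F z) \<and> (LINT t|unif01. ?F z t) = ln (max (norm z) R)"
  proof (cases "norm z = R")
    case False
    have "continuous_on (sphere 0 R) (\<lambda>w. ln (norm (z - w)))"
      using False by (intro continuous_intros) auto
    from integrable_circle[OF this] assms have "integrable unif01 (?F z)" by simp
    then show ?thesis using circle_mean_ln_off[OF assms False] by simp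
  next
    case True
    define s where "s n = 1 - 1 / (real n + 2)" for n :: nat
    have s: "0 < s n" "s n < 1" for n by (auto simp: s_def field_simps)
    have s_lim: "s \<longlonglongrightarrow> 1" unfolding s_def by real_asymp
    have ns: "norm (of_real (s n) * z) < R" for n
      using s[of n] True assms by (simp add: norm_mult)
    have ne: "of_real (s n) * z \<noteq> circ R t" for n t
    proof
      assume "of_real (s n) * z = circ R t"
      then have "norm (of_real (s n) * z) = norm (circ R t)" by (rule arg_cong)
      with ns[of n] assms show False by (simp add: norm_mult)
    qed
    \<comment> \<open>The step from z to its contraction has length R minus the norm of the
      contraction. This is the distance of the contraction from the circle, hence at most the other
      term.\<close>
    have ge: "norm (of_real (s n) * z - circ R t) \<ge> norm (z - circ R t) / 2" for n t
    proof -
      have "norm (z - circ R t) \<le> norm (of_real (s n) * z - circ R t) + norm (of_real (1 - s n) * z)"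
        using norm_triangle_ineq[of "of_real (s n) * z - circ R t" "of_real (1 - s n) * z"]
        by (simp add: algebra_simps)
      also have "norm (of_real (1 - s n) * z) = norm (circ R t) - norm (of_real (s n) * z)"
        using s[of n] True assms by (simp only: norm_mult norm_of_real) (simp add: algebra_simps)
      also have "\<dots> \<le> norm (of_real (s n) * z - circ R t)"
        by (metis norm_minus_commute norm_triangle_ineq2)
      finally show ?thesis by simp
    qed
    have le: "norm (w - circ R t) \<le> 2 * R" if "norm w \<le> R" for w t
      using norm_triangle_ineq4[of w "circ R t"] that assms by (simp add: norm_mult)
    have ae: "AE t in unif01. z \<noteq> circ R t"
      using AE_unit_cis_neq[of "z / R"] assms by (auto elim!: eventually_mono simp: field_simps)
    have conv: "AE t in unif01. (\<lambda>n. ?F (of_real (s n) * z) t) \<longlonglongrightarrow> ?F z t"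
      using ae
    proof eventually_elim
      case (elim t)
      have "(\<lambda>n. of_real (s n) * z) \<longlonglongrightarrow> of_real 1 * z"
        by (intro tendsto_intros s_lim)
      with elim show ?case by (auto intro!: tendsto_intros)
    qed
    have meas [measurable]: "?F w \<in> borel_measurable unif01" for w
      by measurable
    have int_n: "integrable unif01 (?F (of_real (s n) * z))" for n
    proof -
      have "continuous_on (sphere 0 R) (\<lambda>w. ln (norm (of_real (s n) * z - w)))"
        using ns[of n] by (intro continuous_intros) auto
      from integrable_circle[OF this] assms show ?thesis by simp
    qed
    have val_n: "(LINT t|unif01. ?F (of_real (s n) * z) t) = ln R" for n
      using circle_mean_ln_off[of R "of_real (s n) * z"] ns[of n] assms by (simp add: max_def)
    \<comment> \<open>An upper bound for every kernel in play. Fatou for the nonnegative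
      \<open>L - ?F\<close>, with all approximating means equal to \<open>ln R\<close>, first shows
      the limit integrable; only then can it enter the dominating function below.\<close>
    define L where "L = ln (2 * R)"
    have nonneg: "L - ?F w t \<ge> 0" if "w \<noteq> circ R t" "norm w \<le> R" for w t
      using le[OF that(2), of t] that assms by (auto simp: L_def)
    have "(\<integral>\<^sup>+t. ennreal (L - ?F z t) \<partial>unif01) \<le>
      (\<integral>\<^sup>+t. liminf (\<lambda>n. ennreal (L - ?F (of_real (s n) * z) t)) \<partial>unif01)"
    proof (rule nn_integral_mono_AE)
      show "AE t in unif01. ennreal (L - ?F z t) \<le> liminf (\<lambda>n. ennreal (L - ?F (of_real (s n) * z) t))"
        using conv
      proof eventually_elim
        case (elim t)
        then have "(\<lambda>n. ennreal (L - ?F (of_real (s n) * z) t)) \<longlonglongrightarrow> ennreal (L - ?F z t)"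
          by (intro tendsto_ennrealI tendsto_diff tendsto_const)
        then have "liminf (\<lambda>n. ennreal (L - ?F (of_real (s n) * z) t)) = ennreal (L - ?F z t)"
          by (rule lim_imp_Liminf[rotated]) simp
        then show ?case by simp
      qed
    qed
    also have "\<dots> \<le> liminf (\<lambda>n. \<integral>\<^sup>+t. ennreal (L - ?F (of_real (s n) * z) t) \<partial>unif01)"
      by (intro nn_integral_liminf measurable_compose[OF _ measurable_ennreal] borel_measurable_diff meas) simp
    also have "(\<lambda>n. \<integral>\<^sup>+t. ennreal (L - ?F (of_real (s n) * z) t) \<partial>unif01) = (\<lambda>n. ennreal (L - ln R))"
    proof
      fix n
      have "(\<integral>\<^sup>+t. ennreal (L - ?F (of_real (s n) * z) t) \<partial>unif01) =
        ennreal (LINT t|unif01. L - ?F (of_real (s n) * z) t)"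
      proof (rule nn_integral_eq_integral)
        show "AE t in unif01. 0 \<le> L - ?F (of_real (s n) * z) t"
          using ns[of n] by (intro always_eventually allI nonneg ne) simp
      qed (use int_n in auto)
      then show "(\<integral>\<^sup>+t. ennreal (L - ?F (of_real (s n) * z) t) \<partial>unif01) = ennreal (L - ln R)"
        using int_n[of n] val_n[of n] by simp
    qed
    also have "liminf (\<lambda>n. ennreal (L - ln R)) < \<infinity>"
      by (simp add: Liminf_const)
    finally have fin: "(\<integral>\<^sup>+t. ennreal (L - ?F z t) \<partial>unif01) < \<infinity>" .
    have "integrable unif01 (\<lambda>t. L - ?F z t)"
    proof (rule integrableI_nonneg)
      show "AE t in unif01. 0 \<le> L - ?F z t"
        using ae by eventually_elim (rule nonneg, use True in auto)
    qed (use fin in auto)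
    then have "integrable unif01 (\<lambda>t. L - (L - ?F z t))"
      by (rule Bochner_Integration.integrable_diff[rotated]) simp
    then have int: "integrable unif01 (?F z)" by simp
    have "(\<lambda>n. LINT t|unif01. ?F (of_real (s n) * z) t) \<longlonglongrightarrow> (LINT t|unif01. ?F z t)"
    proof (rule integral_dominated_convergence[where w="\<lambda>t. \<bar>L\<bar> + \<bar>?F z t\<bar> + ln 2"])
      show "AE t in unif01. norm (?F (of_real (s n) * z) t) \<le> \<bar>L\<bar> + \<bar>?F z t\<bar> + ln 2" for n
        using ae
      proof eventually_elim
        case (elim t)
        have "?F (of_real (s n) * z) t \<le> L"
          using nonneg[OF ne, of n t] ns[of n] by simp
        moreover have "ln (norm (z - circ R t) / 2) \<le> ?F (of_real (s n) * z) t"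
          using ge[of t n] elim ne by (subst ln_le_cancel_iff) auto
        then have "?F z t - ln 2 \<le> ?F (of_real (s n) * z) t"
          using elim by (simp add: ln_div)
        moreover have "ln 2 \<ge> (0::real)" by simp
        ultimately show ?case unfolding real_norm_def by linarith
      qed
    qed (use conv int in auto)
    then have "(LINT t|unif01. ?F z t) = ln R"
      unfolding val_n using LIMSEQ_unique tendsto_const by blast
    with int True show ?thesis by simp
  qed
  then show "integrable unif01 (?F z)" "(LINT t|unif01. ?F z t) = ln (max (norm z) R)"
    by auto
qed

section \<open>Jensen's and Cartan's formulas\<close>

text \<open>The zeros in a slightly larger closed disc form a compact set, so if there are any, one
  of them has least modulus, and that modulus exceeds r. On the open disc below it G has a
  holomorphic logarithm.\<close>

lemma zero_free_log:
  assumes G: "G holomorphic_on ball 0 R" and r: "0 \<le> r" "r < R" and nz: "\<And>z. z \<in> cball 0 r \<Longrightarrow> G z \<noteq> 0"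
  obtains r' g where "r < r'" "r' < R" "g holomorphic_on ball 0 r'" "\<And>z. z \<in> ball 0 r' \<Longrightarrow> exp (g z) = G z"
proof -
  define s where "s = (r + R) / 2"
  have s: "r < s" "s < R" using r by (auto simp: s_def)
  have "\<exists>r'>r. r' \<le> s \<and> (\<forall>z\<in>ball 0 r'. G z \<noteq> 0)"
  proof (cases "\<exists>z\<in>cball 0 s. G z = 0")
    case True
    have "continuous_on (cball 0 s) G"
      using G s(2) by (rule holomorphic_continuous_cball)
    then have "closed (cball 0 s \<inter> G -` {0})"
      by (intro continuous_closed_preimage) auto
    then have "compact (cball 0 s \<inter> (cball 0 s \<inter> G -` {0}))"
      by (intro compact_Int_closed) auto
    then have "compact (cball 0 s \<inter> G -` {0})" by simp
    moreover have "cball 0 s \<inter> G -` {0} \<noteq> {}" using True by auto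
    ultimately have "\<exists>z\<in>cball 0 s \<inter> G -` {0}. \<forall>y\<in>cball 0 s \<inter> G -` {0}. norm z \<le> norm y"
      by (intro continuous_attains_inf continuous_intros)
    then obtain z where z: "z \<in> cball 0 s" "G z = 0" "\<And>y. y \<in> cball 0 s \<Longrightarrow> G y = 0 \<Longrightarrow> norm z \<le> norm y"
      by auto
    have "norm z > r" using nz[of z] z by force
    moreover have "G y \<noteq> 0" if "y \<in> ball 0 (norm z)" for y
      using z(1) z(3)[of y] that by auto
    ultimately show ?thesis using z(1) by (intro exI[of _ "norm z"]) auto
  next
    case False
    then show ?thesis using s by (intro exI[of _ s]) auto
  qed
  then obtain r' where r': "r' > r" "r' \<le> s" "\<And>z. z \<in> ball 0 r' \<Longrightarrow> G z \<noteq> 0" by blast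
  have "G holomorphic_on ball 0 r'" using r' s by (auto intro: holomorphic_on_subset[OF G])
  then obtain g where "g holomorphic_on ball 0 r'" "\<And>x. x \<in> ball 0 r' \<Longrightarrow> exp (g x) = G x"
    using holomorphic_logarithm_exists[of "ball 0 r'" G 0] r' r by auto
  then show thesis using that r' s by (meson le_less_trans)
qed

lemma jensen_zero_free:
  assumes G: "G holomorphic_on ball 0 R" and r: "0 \<le> r" "r < R" and nz: "\<And>z. z \<in> cball 0 r \<Longrightarrow> G z \<noteq> 0"
  shows "integrable unif01 (\<lambda>t. ln (norm (G (circ r t))))"
    and "(LINT t|unif01. ln (norm (G (circ r t)))) = ln (norm (G 0))"
proof -
  obtain r' g where g: "r < r'" "g holomorphic_on ball 0 r'" "\<And>z. z \<in> ball 0 r' \<Longrightarrow> exp (g z) = G z"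
    using zero_free_log[OF G r nz] by blast
  have eq: "ln (norm (G x)) = Re (g x)" if "x \<in> ball 0 r'" for x
    using g(3)[OF that] by (metis norm_exp_eq_Re ln_exp)
  have u: "circ r t \<in> ball 0 r'" for t
    using r g(1) by (simp add: norm_mult)
  show "integrable unif01 (\<lambda>t. ln (norm (G (circ r t))))"
    "(LINT t|unif01. ln (norm (G (circ r t)))) = ln (norm (G 0))"
    using circle_mean_Re[OF g(2), of r] r g(1) eq[OF u] eq[of 0] by simp_all
qed

text \<open>Each listed zero is divided out once, whatever its order, the quotient being completed
  by the derivative. That the cofactor no longer vanishes there is left to
  \<open>simple_zero_cofactor_nonzero\<close>.\<close>

lemma simple_zero_factorization:
  assumes "finite Z" "open S" "F holomorphic_on S" "\<And>a. a \<in> Z \<Longrightarrow> F a = 0" "Z \<subseteq> S"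
  shows "\<exists>G. G holomorphic_on S \<and> (\<forall>z\<in>S. F z = G z * (\<Prod>a\<in>Z. z - a))"
  using assms(1,4,5)
proof (induction Z rule: finite_induct)
  case empty
  then show ?case using assms by auto
next
  case (insert a Z)
  then obtain G where G: "G holomorphic_on S" "\<And>z. z \<in> S \<Longrightarrow> F z = G z * (\<Prod>b\<in>Z. z - b)"
    by auto
  have "(\<Prod>b\<in>Z. a - b) \<noteq> 0" using insert by auto
  with G(2)[of a] insert have "G a = 0" by auto
  define G1 where "G1 z = (if z = a then deriv G a else (G z - G a) / (z - a))" for z
  have "G1 holomorphic_on S"
    unfolding G1_def by (rule pole_lemma_open[OF G(1) assms(2)])
  moreover have "F z = G1 z * (\<Prod>b\<in>insert a Z. z - b)" if "z \<in> S" for z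
    using insert G(2)[OF that] \<open>G a = 0\<close> by (auto simp: G1_def)
  ultimately show ?case by blast
qed

text \<open>Otherwise F = P (z - a) with P a = 0, and the product rule gives F a derivative 0 at
  a.\<close>

lemma simple_zero_cofactor_nonzero:
  assumes "finite Z" "open S" "G holomorphic_on S" "\<And>z. z \<in> S \<Longrightarrow> F z = G z * (\<Prod>a\<in>Z. z - a)"
    "a \<in> Z" "a \<in> S" "deriv F a \<noteq> 0"
  shows "G a \<noteq> 0"
proof
  assume "G a = 0"
  define Q where "Q z = (\<Prod>b\<in>Z - {a}. z - b)" for z
  have F: "F z = G z * Q z * (z - a)" if "z \<in> S" for z
    using assms(1,5) assms(4)[OF that] by (simp add: Q_def prod.remove[of Z a] mult_ac)
  define P where "P z = G z * Q z" for z
  have "P holomorphic_on S"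
    unfolding P_def Q_def by (intro holomorphic_intros assms)
  then have "(P has_field_derivative deriv P a) (at a)"
    using assms holomorphic_derivI by blast
  then have "((\<lambda>z. P z * (z - a)) has_field_derivative deriv P a * (a - a) + P a) (at a)"
    by (auto intro!: derivative_eq_intros)
  then have "((\<lambda>z. P z * (z - a)) has_field_derivative 0) (at a)"
    using \<open>G a = 0\<close> by (simp add: P_def)
  then have "(F has_field_derivative 0) (at a)"
    by (rule has_field_derivative_transform_within_open[OF _ assms(2,6)]) (simp add: P_def F)
  then show False using DERIV_imp_deriv assms(7) by blast
qed

text \<open>A covering map has no critical points, so multiplicities never arise. Zeros on the
  circle itself are allowed: the logarithm stays integrable by \<open>circle_mean_ln\<close>, and
  they contribute \<open>ln 1\<close>.\<close>

lemma jensen_simple_zeros: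
  fixes F :: "complex \<Rightarrow> complex"
  assumes F: "F holomorphic_on ball 0 R" and r: "0 < r" "r < R" and F0: "F 0 \<noteq> 0"
    and simple: "\<And>z. z \<in> cball 0 r \<Longrightarrow> F z = 0 \<Longrightarrow> deriv F z \<noteq> 0"
  defines "Z \<equiv> {z \<in> cball 0 r. F z = 0}"
  shows "finite Z" and "integrable unif01 (\<lambda>t. ln (norm (F (circ r t))))"
    and "(LINT t|unif01. ln (norm (F (circ r t)))) = ln (norm (F 0)) + (\<Sum>z\<in>Z. ln (r / norm z))"
proof -
  show fin: "finite Z"
  proof (cases "F constant_on ball 0 R")
    case True
    then have "Z = {}" using F0 r by (fastforce simp: Z_def constant_on_def)
    then show ?thesis by simp
  next
    case False
    moreover have "cball 0 r \<subseteq> ball 0 R" using r by auto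
    ultimately show ?thesis unfolding Z_def
      using holomorphic_compact_finite_zeros[OF F _ _ compact_cball, of 0 r] by auto
  qed
  obtain G where G: "G holomorphic_on ball 0 R" "\<And>z. z \<in> ball 0 R \<Longrightarrow> F z = G z * (\<Prod>a\<in>Z. z - a)"
  proof -
    have "Z \<subseteq> ball 0 R" "\<And>a. a \<in> Z \<Longrightarrow> F a = 0" using r by (auto simp: Z_def)
    with simple_zero_factorization[OF fin open_ball F] that show thesis by blast
  qed
  have Gnz: "G z \<noteq> 0" if "z \<in> cball 0 r" for z
  proof (cases "z \<in> Z")
    case True
    then show ?thesis
      using simple_zero_cofactor_nonzero[OF fin open_ball G True] that r simple by (auto simp: Z_def)
  next
    case False
    with that G(2)[of z] r show ?thesis by (auto simp: Z_def)
  qed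
  let ?L = "\<lambda>t. ln (norm (G (circ r t))) + (\<Sum>a\<in>Z. ln (norm (a - circ r t)))"
  have ae: "AE t in unif01. ln (norm (F (circ r t))) = ?L t"
  proof -
    have "AE t in unif01. \<forall>a\<in>Z. unit_cis t \<noteq> a / r"
      using fin AE_unit_cis_neq by (intro AE_finite_allI) auto
    then show ?thesis
    proof eventually_elim
      case (elim t)
      have u: "circ r t \<in> cball 0 r" using r by (simp add: norm_mult)
      have ne: "norm (circ r t - a) \<noteq> 0" if "a \<in> Z" for a
        using elim that r by (auto simp: field_simps)
      have "norm (F (circ r t)) = norm (G (circ r t)) * (\<Prod>a\<in>Z. norm (circ r t - a))"
        using G(2)[of "circ r t"] u r by (simp add: norm_mult prod_norm)
      also have "ln \<dots> = ln (norm (G (circ r t))) + ln (\<Prod>a\<in>Z. norm (circ r t - a))"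
        using Gnz[OF u] ne fin by (intro ln_mult_pos) (auto intro!: prod_pos)
      also have "ln (\<Prod>a\<in>Z. norm (circ r t - a)) = (\<Sum>a\<in>Z. ln (norm (circ r t - a)))"
        using ne fin by (intro ln_prod) auto
      finally show ?case by (simp add: norm_minus_commute)
    qed
  qed
  have "continuous_on (sphere 0 r) F" "continuous_on (sphere 0 r) G"
    using F G(1) r by (auto intro!: holomorphic_on_imp_continuous_on elim!: holomorphic_on_subset)
  from this[THEN continuous_circle] r
  have [measurable]: "(\<lambda>t. F (circ r t)) \<in> borel_measurable borel"
    "(\<lambda>t. G (circ r t)) \<in> borel_measurable borel"
    by (auto intro: borel_measurable_continuous_onI)
  have intL: "integrable unif01 ?L"
    using circle_mean_ln(1)[OF r(1)] jensen_zero_free(1)[OF G(1) _ _ Gnz] r by auto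
  then show "integrable unif01 (\<lambda>t. ln (norm (F (circ r t))))"
    using ae by (subst integrable_cong_AE) (auto simp: borel_measurable_unif01)
  have "(LINT t|unif01. ln (norm (F (circ r t)))) = (LINT t|unif01. ?L t)"
    using ae by (intro integral_cong_AE) (auto simp: borel_measurable_unif01)
  also have "\<dots> = ln (norm (G 0)) + (\<Sum>a\<in>Z. ln (max (norm a) r))"
    using circle_mean_ln[OF r(1)] jensen_zero_free[OF G(1) _ _ Gnz, of r] r
    by (subst Bochner_Integration.integral_add) (auto intro!: Bochner_Integration.integrable_sum)
  also have "(\<Sum>a\<in>Z. ln (max (norm a) r)) = (\<Sum>a\<in>Z. ln (norm a) + ln (r / norm a))"
  proof (intro sum.cong refl)
    fix a assume "a \<in> Z"
    with F0 have "a \<noteq> 0" "norm a \<le> r" by (auto simp: Z_def)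
    then show "ln (max (norm a) r) = ln (norm a) + ln (r / norm a)"
      using r by (simp add: ln_div max_def)
  qed
  also have "\<dots> = (\<Sum>a\<in>Z. ln (norm a)) + (\<Sum>a\<in>Z. ln (r / norm a))"
    by (rule sum.distrib)
  also have "ln (norm (G 0)) + ((\<Sum>a\<in>Z. ln (norm a)) + (\<Sum>a\<in>Z. ln (r / norm a))) = 
      ln (norm (F 0)) + (\<Sum>z\<in>Z. ln (r / norm z))"
  proof -
    have nz: "0 \<notin> Z" using F0 by (auto simp: Z_def)
    have "norm (F 0) = norm (G 0) * (\<Prod>a\<in>Z. norm a)"
      using G(2)[of 0] r by (simp add: norm_mult flip: prod_norm)
    also have "ln \<dots> = ln (norm (G 0)) + ln (\<Prod>a\<in>Z. norm a)"
      using Gnz[of 0] nz fin r by (intro ln_mult_pos) (auto intro!: prod_pos)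
    also have "ln (\<Prod>a\<in>Z. norm a) = (\<Sum>a\<in>Z. ln (norm a))"
      using nz fin by (intro ln_prod) auto
    finally show ?thesis by simp
  qed
  finally show "(LINT t|unif01. ln (norm (F (circ r t)))) = ln (norm (F 0)) + (\<Sum>z\<in>Z. ln (r / norm z))" .
qed

section \<open>Jensen's and Cartan's formulas for the covering map\<close>

locale disc_covering =
  fixes f :: "complex \<Rightarrow> complex" and D :: "complex set"
  assumes openD: "open D" and connD: "connected D" and zero_in_D: "0 \<in> D"
    and hol: "f holomorphic_on ball 0 1" and cov: "covering_space (ball 0 1) f D" and f0: "f 0 = 0"
begin

lemma image_f: "f ` ball 0 1 = D"
  using cov by (simp add: covering_space_def)

lemma f_in_D: "norm z < 1 \<Longrightarrow> f z \<in> D"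
  using image_f by force

text \<open>The map is injective on each sheet, and an injective holomorphic function has no
  critical points.\<close>

lemma deriv_nonzero:
  assumes "norm z < 1"
  shows "deriv f z \<noteq> 0"
proof -
  have "f z \<in> D" using image_f assms by auto
  then obtain T \<V> where T: "f z \<in> T" "\<Union>\<V> = ball 0 1 \<inter> f -` T" 
      "\<And>W. W \<in> \<V> \<Longrightarrow> openin (top_of_set (ball 0 1)) W" "\<And>W. W \<in> \<V> \<Longrightarrow> \<exists>q. homeomorphism W T f q"
    using cov unfolding covering_space_def by meson
  then have "z \<in> \<Union>\<V>" using assms by auto
  then obtain W where W: "W \<in> \<V>" "z \<in> W" by blast
  then have "open W" "W \<subseteq> ball 0 1" using T(3)[OF W(1)] by (auto simp: openin_open)
  moreover have "inj_on f W"
    using T(4)[OF W(1)] by (metis homeomorphism_def inj_on_inverseI)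
  ultimately show ?thesis
    using holomorphic_injective_imp_regular[of f W z] W hol holomorphic_on_subset by blast
qed

text \<open>The integrated Nevanlinna counting function N(r, w). For w = 0 the solution z = 0
  contributes \<open>ln (r / 0) = 0\<close>, so w = 0 is excluded wherever the value
  matters.\<close>

definition cnt :: "real \<Rightarrow> complex \<Rightarrow> real" where
  "cnt r w = (\<Sum>z\<in>{z \<in> cball 0 r. f z = w}. ln (r / norm z))"

lemma measurable_f_circle: "0 \<le> r \<Longrightarrow> r < 1 \<Longrightarrow> (\<lambda>t. f (circ r t)) \<in> borel_measurable unif01"
  by (rule measurable_holomorphic_circle[OF hol])

lemma finite_preimage:
  assumes "r < 1"
  shows "finite {z \<in> cball 0 r. f z = w}"
proof -
  have h: "(\<lambda>z. f z - w) holomorphic_on ball 0 1" using hol by (intro holomorphic_intros)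
  have nc: "\<not> (\<lambda>z. f z - w) constant_on ball 0 1"
  proof
    assume "(\<lambda>z. f z - w) constant_on ball 0 1"
    then obtain c where "\<And>z. z \<in> ball 0 1 \<Longrightarrow> f z = c" unfolding constant_on_def by (metis diff_add_cancel)
    then have "(f has_field_derivative 0) (at 0)"
      by (intro has_field_derivative_transform_within_open[OF DERIV_const[of c] open_ball[of 0 1]]) auto
    then show False using deriv_nonzero[of 0] DERIV_imp_deriv by force
  qed
  have "cball 0 r \<subseteq> ball (0::complex) 1" using assms by auto
  then have "finite {y \<in> cball 0 r. f y - w = 0}"
    by (rule holomorphic_compact_finite_zeros[OF h open_ball connected_ball compact_cball _ nc])
  then show ?thesis by simp
qed

lemma AE_f_circle_neq:
  assumes r: "0 < r" "r < 1"
  shows "AE t in unif01. f (circ r t) \<noteq> w"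
proof -
  have "AE t in unif01. \<forall>y\<in>{y \<in> cball 0 r. f y = w}. unit_cis t \<noteq> y / of_real r"
    by (rule AE_finite_allI[OF finite_preimage[OF r(2)]]) (rule AE_unit_cis_neq)
  then show ?thesis
  proof eventually_elim
    case (elim t)
    show ?case
    proof
      assume "f (circ r t) = w"
      then have "circ r t \<in> {y \<in> cball 0 r. f y = w}"
        using r by (simp add: norm_mult)
      with elim have "unit_cis t \<noteq> circ r t / of_real r" by blast
      with r show False by simp
    qed
  qed
qed

lemma jensen:
  assumes r: "0 < r" "r < 1" and w: "w \<noteq> 0"
  shows "integrable unif01 (\<lambda>t. ln (norm (f (circ r t) - w)))"
    "(LINT t|unif01. ln (norm (f (circ r t) - w))) = ln (norm w) + cnt r w"
proof -
  have h: "(\<lambda>z. f z - w) holomorphic_on ball 0 1" using hol by (intro holomorphic_intros)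
  have d: "deriv (\<lambda>z. f z - w) z \<noteq> 0" if "z \<in> cball 0 r" for z
  proof -
    have "(f has_field_derivative deriv f z) (at z)"
      using that r hol holomorphic_derivI[OF hol] by simp
    then have "((\<lambda>z. f z - w) has_field_derivative deriv f z) (at z)"
      by (auto intro!: derivative_eq_intros)
    then show ?thesis using DERIV_imp_deriv deriv_nonzero[of z] that r by fastforce
  qed
  note J = jensen_simple_zeros[OF h r _ d]
  show "integrable unif01 (\<lambda>t. ln (norm (f (circ r t) - w)))"
    "(LINT t|unif01. ln (norm (f (circ r t) - w))) = ln (norm w) + cnt r w"
    using J w f0 by (simp_all add: cnt_def)
qed

lemma cnt_nonneg: "0 \<le> cnt r w" 
proof -
  have "0 \<le> ln (r / norm z)" if "z \<in> cball 0 r" for z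
  proof (cases "z = 0")
    case False
    with that show ?thesis by (auto intro!: ln_ge_zero simp: divide_simps)
  qed simp
  then show ?thesis unfolding cnt_def by (intro sum_nonneg) auto
qed

lemma cnt_mono:
  assumes "0 < r" "r \<le> s" "s < 1" "w \<noteq> 0"
  shows "cnt r w \<le> cnt s w"
proof -
  have "cnt r w \<le> (\<Sum>z\<in>{z \<in> cball 0 r. f z = w}. ln (s / norm z))"
    unfolding cnt_def
  proof (intro sum_mono)
    fix z assume "z \<in> {z \<in> cball 0 r. f z = w}"
    with assms f0 have "z \<noteq> 0" by auto
    then show "ln (r / norm z) \<le> ln (s / norm z)"
      using assms by (subst ln_le_cancel_iff) (auto simp: divide_right_mono)
  qed
  also have "\<dots> \<le> cnt s w"
    unfolding cnt_def
  proof (rule sum_mono2)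
    show "finite {z \<in> cball 0 s. f z = w}" by (rule finite_preimage[OF assms(3)])
    fix b assume "b \<in> {z \<in> cball 0 s. f z = w} - {z \<in> cball 0 r. f z = w}"
    then show "0 \<le> ln (s / norm b)"
      using assms by (cases "b = 0") (auto intro!: ln_ge_zero simp: divide_simps)
  qed (use assms in auto)
  finally show ?thesis .
qed

lemma cnt_outside: "w \<notin> D \<Longrightarrow> r < 1 \<Longrightarrow> cnt r w = 0"
proof -
  assume "w \<notin> D" "r < 1"
  then have "{z \<in> cball 0 r. f z = w} = {}" using f_in_D by force
  then show ?thesis unfolding cnt_def by (metis sum.empty)
qed

text \<open>Measurability in w is not visible on the sum over solutions; Jensen's formula rewrites
  the sum as a parameter integral, for which it is automatic.\<close>

lemma cnt_measurable [measurable]: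
  assumes "0 < r" "r < 1"
  shows "cnt r \<in> borel_measurable borel"
proof -
  have [measurable]: "(\<lambda>t. f (circ r t)) \<in> borel_measurable unif01"
    using assms by (intro measurable_f_circle) auto
  have "cnt r = (\<lambda>w. if w = 0 then cnt r 0 else (LINT t|unif01. ln (norm (f (circ r t) - w))) - ln (norm w))"
    using jensen(2)[OF assms] by auto
  also have "\<dots> \<in> borel_measurable borel"
    by measurable
  finally show ?thesis .
qed

text \<open>Jensen's formula, averaged over the centres \<open>w + e u\<close>.\<close>

lemma cartan:
  assumes r: "0 < r" "r < 1" and e: "0 < e"
  shows "integrable unif01 (\<lambda>t. ln (max (norm (f (circ r t) - w)) e))"
    "integrable unif01 (\<lambda>s. cnt r (w + circ e s))"
    "(LINT t|unif01. ln (max (norm (f (circ r t) - w)) e)) =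
      ln (max (norm w) e) + (LINT s|unif01. cnt r (w + circ e s))"
proof -
  interpret P: pair_sigma_finite unif01 unif01 ..
  have [measurable]: "(\<lambda>t. f (circ r t)) \<in> borel_measurable unif01"
    "cnt r \<in> borel_measurable borel"
    using r by (simp_all add: measurable_f_circle)
  obtain B where B: "B > 0" "\<And>t. norm (f (circ r t)) \<le> B"
    by (rule bounded_holomorphic_circle[OF hol, of r]) (use r that in auto)
  define M where "M = B + norm w + e"
  define h where "h t s = ln (norm (f (circ r t) - w - circ e s))" for t s
  have [measurable]: "case_prod h \<in> borel_measurable (unif01 \<Otimes>\<^sub>M unif01)"
    unfolding h_def by measurable
  define L where "L = \<bar>ln M\<bar>"
  have Mle: "norm (f (circ r t) - w - circ e s) \<le> M" for t s
  proof -
    have "norm (f (circ r t) - w - circ e s) \<le>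
       norm (f (circ r t)) + norm w + norm (circ e s)"
      by (metis (no_types, lifting) add_mono_thms_linordered_semiring(3) norm_triangle_ineq4 order_trans)
    then show ?thesis using B(2)[of t] e by (simp add: M_def norm_mult)
  qed
  have hL: "h t s \<le> L" for t s
  proof (cases "f (circ r t) - w - circ e s = 0")
    case False
    then have "0 < M" using B(1) e norm_ge_zero[of w] unfolding M_def by linarith
    then have "h t s \<le> ln M" unfolding h_def using Mle[of t s] False by (subst ln_le_cancel_iff) auto
    then show ?thesis by (simp add: L_def)
  qed (simp add: h_def L_def)
  have in_s: "integrable unif01 (h t)" "(LINT s|unif01. h t s) = ln (max (norm (f (circ r t) - w)) e)" for t
    unfolding h_def using circle_mean_ln[OF e] by auto
  \<comment> \<open>As L bounds the kernel from above, \<open>2 * L - h\<close> dominates its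
    absolute value, and the inner mean of that is known exactly. This gives joint integrability in
    spite of the singularities.\<close>
  have abs_le: "(LINT s|unif01. norm (h t s)) \<le> 2 * L - ln e" for t
  proof -
    have "(LINT s|unif01. norm (h t s)) \<le> (LINT s|unif01. 2 * L - h t s)"
    proof (rule integral_mono)
      show "norm (h t s) \<le> 2 * L - h t s" for s
        using hL[of t s] unfolding L_def real_norm_def by linarith
    qed (use in_s(1)[of t] in auto)
    also have "\<dots> = 2 * L - ln (max (norm (f (circ r t) - w)) e)"
      using in_s[of t] by simp
    also have "\<dots> \<le> 2 * L - ln e"
      using e by simp
    finally show ?thesis .
  qed
  have int: "integrable (unif01 \<Otimes>\<^sub>M unif01) (case_prod h)"
  proof (rule P.Fubini_integrable)
    show "integrable unif01 (\<lambda>t. LINT s|unif01. norm (case_prod h (t, s)))"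
    proof (rule unif01.integrable_const_bound[where B="2 * L - ln e"])
      show "AE t in unif01. norm (LINT s|unif01. norm (case_prod h (t, s))) \<le> 2 * L - ln e"
        using abs_le by (intro always_eventually) (simp add: integral_nonneg_AE)
    qed simp
  qed (use in_s in auto)
  have eq: "(LINT t|unif01. LINT s|unif01. h t s) = (LINT s|unif01. LINT t|unif01. h t s)"
    using P.Fubini_integral[OF int] by simp
  have int1: "integrable unif01 (\<lambda>t. LINT s|unif01. h t s)"
    using P.integrable_fst'[OF int] by simp
  have int2: "integrable unif01 (\<lambda>s. LINT t|unif01. h t s)"
    using P.integrable_snd[OF int] by simp
  show "integrable unif01 (\<lambda>t. ln (max (norm (f (circ r t) - w)) e))"
    using int1 in_s(2) by simp
  \<comment> \<open>The one direction in which the centre \<open>w + circ e s\<close> would be 0 is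
    discarded, since Jensen's formula fails there.\<close>
  have "AE s in unif01. unit_cis s \<noteq> - w / e"
    by (rule AE_unit_cis_neq)
  then have ae: "AE s in unif01. (LINT t|unif01. h t s) = ln (norm (- w - circ e s)) + cnt r (w + circ e s)"
  proof eventually_elim
    case (elim s)
    have "w + circ e s \<noteq> 0"
      using elim e by (auto simp: field_simps eq_neg_iff_add_eq_0)
    from jensen(2)[OF r this] show ?case
      by (simp add: h_def diff_diff_eq norm_minus_commute[of "-w"] add.commute)
  qed
  have [measurable]: "(\<lambda>s. LINT t|unif01. h t s) \<in> borel_measurable unif01"
    using int2 by simp
  have "integrable unif01 (\<lambda>s. (LINT t|unif01. h t s) - ln (norm (- w - circ e s)))"
    using int2 circle_mean_ln(1)[OF e, of "-w"] by (rule Bochner_Integration.integrable_diff)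
  then show int3: "integrable unif01 (\<lambda>s. cnt r (w + circ e s))"
    by (rule integrable_cong_AE_imp) (use ae in \<open>auto elim!: eventually_mono\<close>)
  have "(LINT s|unif01. LINT t|unif01. h t s) =
    (LINT s|unif01. ln (norm (- w - circ e s)) + cnt r (w + circ e s))"
    by (rule integral_cong_AE) (use ae in auto)
  also have "\<dots> = ln (max (norm w) e) + (LINT s|unif01. cnt r (w + circ e s))"
    using circle_mean_ln[OF e, of "-w"] int3 by simp
  finally show "(LINT t|unif01. ln (max (norm (f (circ r t) - w)) e)) =
      ln (max (norm w) e) + (LINT s|unif01. cnt r (w + circ e s))"
    using eq in_s(2) by simp
qed

text \<open>The means grow with the radius because the counting functions do. This stands in for the
  subharmonicity of the truncated logarithm.\<close>

lemma cartan_mono: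
  assumes r: "0 < r" "r \<le> s" "s < 1" and e: "0 < e"
  shows "(LINT t|unif01. ln (max (norm (f (circ r t) - w)) e)) \<le>
    (LINT t|unif01. ln (max (norm (f (circ s t) - w)) e))"
proof -
  have "AE s in unif01. unit_cis s \<noteq> - w / e"
    by (rule AE_unit_cis_neq)
  then have "AE t in unif01. cnt r (w + circ e t) \<le> cnt s (w + circ e t)"
  proof eventually_elim
    case (elim t)
    have "w + circ e t \<noteq> 0"
      using elim e by (auto simp: field_simps eq_neg_iff_add_eq_0)
    then show ?case using r by (intro cnt_mono)
  qed
  then have "(LINT t|unif01. cnt r (w + circ e t)) \<le> (LINT t|unif01. cnt s (w + circ e t))"
    using r e by (intro integral_mono_AE cartan) auto
  then show ?thesis
    using cartan(3)[of r e w] cartan(3)[of s e w] r e by simp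
qed

end

section \<open>Truncated logarithmic potentials\<close>

text \<open>The kernel log^+ (e / |z - w|): \<open>ennreal\<close> sends negative values to 0, so
  for e > 0 it lives on |z - w| < e and, off the diagonal, vanishes once e is small.\<close>

definition log_kernel :: "real \<Rightarrow> complex \<Rightarrow> complex \<Rightarrow> ennreal" where
  "log_kernel e z w = (if z = w then \<infinity> else ennreal (ln e - ln (norm (z - w))))"

lemma log_kernel_1: "log_kernel 1 = log_kernel_neg"
  by (auto simp: log_kernel_def log_kernel_neg_def fun_eq_iff)

lemma log_kernel_measurable [measurable]:
  assumes "f \<in> borel_measurable M" "g \<in> borel_measurable M"
  shows "(\<lambda>x. log_kernel e (f x) (g x)) \<in> borel_measurable M"
proof -
  have [measurable]: "(\<lambda>x. f x - g x) \<in> borel_measurable M"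
    using assms by measurable
  have "(\<lambda>x. log_kernel e (f x) (g x)) = (\<lambda>x.
    if f x - g x = 0 then \<infinity> else ennreal (ln e - ln (norm (f x - g x))))"
    by (auto simp: log_kernel_def fun_eq_iff)
  also have "\<dots> \<in> borel_measurable M" by measurable
  finally show ?thesis .
qed

lemma log_kernel_mono: "0 < a \<Longrightarrow> a \<le> b \<Longrightarrow> log_kernel a z w \<le> log_kernel b z w"
  by (auto simp: log_kernel_def intro!: ennreal_leI)

text \<open>If z' is a point of a set nearest to z, every w of the set satisfies the hypothesis. A
  bound for a potential on the support thus extends to the plane at the cost of a factor 2 in the
  truncation radius, a substitute for the maximum principle.\<close>

lemma log_kernel_nearest:
  assumes "0 < e" "norm (z' - w) \<le> 2 * norm (z - w)"
  shows "log_kernel e z w \<le> log_kernel (2 * e) z' w"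
proof (cases "z' = w")
  case False
  then have "0 < norm (z' - w)" by simp
  with assms(2) have "z \<noteq> w" by force
  have "ln (norm (z' - w)) \<le> ln (2 * norm (z - w))"
    using assms False \<open>z \<noteq> w\<close> by (subst ln_le_cancel_iff) auto
  then have "ln e - ln (norm (z - w)) \<le> ln (2 * e) - ln (norm (z' - w))"
    using assms \<open>z \<noteq> w\<close> by (simp add: ln_mult)
  then show ?thesis using False \<open>z \<noteq> w\<close> by (auto simp: log_kernel_def intro!: ennreal_leI)
qed (simp add: log_kernel_def)

lemma log_kernel_tendsto_0:
  assumes "z \<noteq> w"
  shows "(\<lambda>n. log_kernel (1 / real (n + 2)) z w) \<longlonglongrightarrow> 0"
proof (rule tendsto_eventually)
  have "(\<lambda>n. 1 / real (n + 2)) \<longlonglongrightarrow> 0" by real_asymp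
  then have "\<forall>\<^sub>F n in sequentially. 1 / real (n + 2) < norm (z - w)"
    using assms by (intro order_tendstoD) auto
  then show "\<forall>\<^sub>F n in sequentially. log_kernel (1 / real (n + 2)) z w = 0"
  proof eventually_elim
    case (elim n)
    then have "ln (1 / real (n + 2)) \<le> ln (norm (z - w))"
      by (subst ln_le_cancel_iff) (use assms in auto)
    with assms show ?case by (auto simp: log_kernel_def ennreal_eq_0_iff)
  qed
qed

lemma AE_mem_of_null_complement:
  fixes M :: "complex measure"
  assumes "sets M = sets borel" "compact K" "emeasure M (space M - K) = 0"
  shows "AE w in M. w \<in> K"
proof -
  have sp: "space M = UNIV" using sets_eq_imp_space_eq[OF assms(1)] by simp
  have "UNIV - K \<in> null_sets M"
    using assms sp by (auto simp: null_sets_def borel_compact)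
  then show ?thesis using AE_not_in by fastforce
qed

text \<open>Restricting by a density keeps the plane as space and the Borel sets as sigma-algebra,
  which is the format demanded in \<open>polar\<close>.\<close>

lemma restricted_measure:
  fixes M :: "complex measure"
  assumes M: "sets M = sets borel" "finite_measure M" and K: "compact K"
  defines "N \<equiv> density M (indicator K)"
  shows "sets N = sets borel" "finite_measure N" "emeasure N (space N) = emeasure M K"
    "emeasure N (space N - K) = 0"
    "g \<in> borel_measurable M \<Longrightarrow> (\<integral>\<^sup>+ w. g w \<partial>N) = (\<integral>\<^sup>+ w. indicator K w * g w \<partial>M)"
proof -
  have Km: "K \<in> sets M" using K M(1) by (simp add: borel_compact)
  have sp: "space M = UNIV" using sets_eq_imp_space_eq[OF M(1)] by simp
  have em: "emeasure N X = emeasure M (K \<inter> X)" if "X \<in> sets M" for X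
    using that Km unfolding N_def by (subst emeasure_density) (auto simp flip: indicator_inter_arith)
  have UN: "space N = UNIV" by (simp add: N_def sp)
  show "sets N = sets borel" by (simp add: N_def M)
  show 3: "emeasure N (space N) = emeasure M K" using em[of UNIV] M(1) UN by simp
  show "finite_measure N"
    using 3 finite_measure.emeasure_finite[OF M(2)] by (intro finite_measureI) simp
  show "emeasure N (space N - K) = 0"
    using em[of "UNIV - K"] sets.compl_sets[OF Km] UN sp by simp
  show "(\<integral>\<^sup>+ w. g w \<partial>N) = (\<integral>\<^sup>+ w. indicator K w * g w \<partial>M)" if "g \<in> borel_measurable M"
    unfolding N_def by (rule nn_integral_density) (use that Km in auto)
qed

text \<open>A finite-energy measure has, after restriction to a large compact set, uniformly small
  truncated potentials: Egorov's argument on the support, and the nearest-point comparison off it.\<close>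

lemma finite_energy_restriction:
  fixes \<mu> :: "complex measure"
  assumes sets\<mu>: "sets \<mu> = sets borel" and fin: "finite_measure \<mu>"
    and nz: "emeasure \<mu> (space \<mu>) \<noteq> 0"
    and K: "compact K" "emeasure \<mu> (space \<mu> - K) = 0"
    and en: "(\<integral>\<^sup>+ z. (\<integral>\<^sup>+ w. log_kernel_neg z w \<partial>\<mu>) \<partial>\<mu>) \<noteq> \<infinity>"
  obtains \<nu> K' where "sets \<nu> = sets borel" "finite_measure \<nu>" "emeasure \<nu> (space \<nu>) \<noteq> 0"
    "compact K'" "K' \<subseteq> K" "emeasure \<nu> (space \<nu> - K') = 0"
    "\<And>h. 0 < h \<Longrightarrow> \<exists>e>0. \<forall>z. (\<integral>\<^sup>+ w. log_kernel e z w \<partial>\<nu>) \<le> ennreal h"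
proof -
  interpret finite_measure \<mu> by fact
  note [measurable_cong] = sets\<mu>
  have space\<mu>: "space \<mu> = UNIV" using sets_eq_imp_space_eq[OF sets\<mu>] by simp
  define V where "V z = (\<integral>\<^sup>+ w. log_kernel_neg z w \<partial>\<mu>)" for z
  define W where "W n z = (\<integral>\<^sup>+ w. log_kernel (1 / real (n + 2)) z w \<partial>\<mu>)" for n z
  have [measurable]: "(\<lambda>z. log_kernel e (fst z) (snd z)) \<in> borel_measurable (\<mu> \<Otimes>\<^sub>M \<mu>)" for e
    by measurable
  have Wm [measurable]: "W n \<in> borel_measurable \<mu>" for n
    unfolding W_def by measurable
  have Vm [measurable]: "V \<in> borel_measurable \<mu>"
    unfolding V_def log_kernel_1[symmetric] by measurable
  have AEV: "AE z in \<mu>. V z \<noteq> \<infinity>"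
    using en by (intro nn_integral_noteq_infinite Vm) (simp add: V_def)
  have anti: "W n z \<le> W m z" if "m \<le> n" for m n z
    unfolding W_def using that by (intro nn_integral_mono log_kernel_mono) (auto simp: frac_le)
  \<comment> \<open>A finite potential at z excludes an atom at z, so the truncated kernels tend to
    0 almost everywhere, dominated by the kernel with e = 1.\<close>
  have Wlim: "(\<lambda>n. W n z) \<longlonglongrightarrow> 0" if Vz: "V z \<noteq> \<infinity>" for z
  proof -
    have "(\<lambda>n. W n z) \<longlonglongrightarrow> (\<integral>\<^sup>+ w. 0 \<partial>\<mu>)"
      unfolding W_def
    proof (rule nn_integral_dominated_convergence)
      show "AE w in \<mu>. log_kernel (1 / real (j + 2)) z w \<le> log_kernel 1 z w" for j
        by (intro always_eventually allI log_kernel_mono) auto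
      show "(\<integral>\<^sup>+ w. log_kernel 1 z w \<partial>\<mu>) < \<infinity>"
        using Vz by (simp add: V_def log_kernel_1 top.not_eq_extremum)
      have m: "(\<lambda>w. log_kernel 1 z w) \<in> borel_measurable \<mu>"
        by (rule log_kernel_measurable) auto
      have "AE w in \<mu>. log_kernel 1 z w \<noteq> \<infinity>"
        by (rule nn_integral_noteq_infinite[OF m]) (use Vz in \<open>simp add: V_def log_kernel_1\<close>)
      then show "AE w in \<mu>. (\<lambda>i. log_kernel (1 / real (i + 2)) z w) \<longlonglongrightarrow> 0"
      proof eventually_elim
        case (elim w)
        then have "z \<noteq> w" by (auto simp: log_kernel_def)
        then show ?case by (rule log_kernel_tendsto_0)
      qed
    qed auto
    then show ?thesis by simp
  qed
  define A where "A j n = {z. W n z > ennreal (1 / real (Suc j))}" for j n :: nat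
  have Am [measurable]: "A j n \<in> sets \<mu>" for j n
    using measurable_sets[OF Wm, of "{ennreal (1 / real (Suc j))<..}" n] space\<mu>
      by (simp add: A_def vimage_def greaterThan_def)
  have A0: "(\<lambda>n. measure \<mu> (A j n)) \<longlonglongrightarrow> 0" for j
  proof -
    have "(\<Inter>n. A j n) \<subseteq> {z. V z = \<infinity>}"
    proof
      fix z assume z: "z \<in> (\<Inter>n. A j n)"
      show "z \<in> {z. V z = \<infinity>}"
      proof (rule ccontr)
        assume "z \<notin> {z. V z = \<infinity>}"
        then have "(\<lambda>n. W n z) \<longlonglongrightarrow> 0" by (intro Wlim) simp
        then have "\<forall>\<^sub>F n in sequentially. W n z < ennreal (1 / real (Suc j))"
          by (rule order_tendstoD(2)) simp
        then obtain n where "W n z < ennreal (1 / real (Suc j))"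
          using eventually_happens'[OF sequentially_bot] by blast
        with z show False by (auto simp: A_def dest: less_asym)
      qed
    qed
    moreover have "{z. V z = \<infinity>} \<in> null_sets \<mu>"
      using AEV by (subst (asm) AE_iff_null) (auto simp: space\<mu>)
    ultimately have "(\<Inter>n. A j n) \<in> null_sets \<mu>"
      by (rule null_sets_subset[rotated 2]) auto
    then have "measure \<mu> (\<Inter>n. A j n) = 0"
      by (simp add: null_setsD1 measure_def)
    moreover have "decseq (A j)"
      using anti by (fastforce simp: decseq_def A_def intro: less_le_trans)
    ultimately show ?thesis
      using finite_Lim_measure_decseq[of "A j"] Am by (simp add: image_subset_iff)
  qed
  define c where "c = measure \<mu> UNIV"
  have c: "c > 0" using nz by (simp add: c_def space\<mu> emeasure_eq_measure zero_less_measure_iff)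
  \<comment> \<open>These bounds sum to c / 2, so at least half of the mass lies outside all
    exceptional sets.\<close>
  have "\<exists>n. measure \<mu> (A j n) < c * (1/2) ^ Suc (Suc j)" for j
  proof -
    have "\<forall>\<^sub>F n in sequentially. measure \<mu> (A j n) < c * (1/2) ^ Suc (Suc j)"
      using A0[of j] c by (intro order_tendstoD) auto
    then show ?thesis using eventually_happens'[OF sequentially_bot] by blast
  qed
  then obtain N where N: "\<And>j. measure \<mu> (A j (N j)) < c * (1/2) ^ Suc (Suc j)" by metis
  define U where "U = (\<Union>j. A j (N j))"
  have sumg: "(\<lambda>j. c * (1/2::real) ^ Suc (Suc j)) sums (c / 2)"
    using sums_mult[OF power_half_series, of "c/2"] by (simp add: algebra_simps)
  have U: "measure \<mu> U \<le> c / 2"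
  proof -
    have "summable (\<lambda>j. measure \<mu> (A j (N j)))"
      by (rule summable_comparison_test'[OF sums_summable[OF sumg]]) (use N in \<open>simp add: less_imp_le\<close>)
    moreover from this have "measure \<mu> U \<le> (\<Sum>j. measure \<mu> (A j (N j)))"
      unfolding U_def by (intro finite_measure_subadditive_countably) auto
    moreover have "(\<Sum>j. measure \<mu> (A j (N j))) \<le> (\<Sum>j. c * (1/2::real) ^ Suc (Suc j))"
      using calculation(1) sums_summable[OF sumg] N by (intro suminf_le) (auto intro: less_imp_le)
    ultimately show ?thesis using sums_unique[OF sumg] by simp
  qed
  define B where "B = K - U"
  have Um [measurable]: "U \<in> sets \<mu>" unfolding U_def by measurable
  have Km [measurable]: "K \<in> sets \<mu>" using K(1) sets\<mu> by (simp add: borel_compact)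
  have Bm: "B \<in> sets \<mu>" unfolding B_def by measurable
  have "measure \<mu> K = c"
  proof -
    have "measure \<mu> (space \<mu> - K) = 0" using K(2) by (simp add: measure_def)
    then show ?thesis using finite_measure_compl[OF Km] by (simp add: c_def space\<mu>)
  qed
  moreover have "measure \<mu> K \<le> measure \<mu> B + measure \<mu> U"
  proof -
    have "measure \<mu> K \<le> measure \<mu> (B \<union> U)"
      by (intro finite_measure_mono) (auto simp: B_def)
    also have "\<dots> \<le> measure \<mu> B + measure \<mu> U"
      by (intro measure_Un_le Bm Um)
    finally show ?thesis .
  qed
  ultimately have "emeasure \<mu> B > 0"
    using U c by (simp add: emeasure_eq_measure)
  moreover have "emeasure \<mu> B = (SUP K\<in>{K. K \<subseteq> B \<and> compact K}. emeasure \<mu> K)"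
    using Bm sets\<mu> emeasure_finite by (intro inner_regular) auto
  ultimately obtain K' where K': "compact K'" "K' \<subseteq> B" "emeasure \<mu> K' > 0"
    by (auto simp: less_SUP_iff)
  then have K'm [measurable]: "K' \<in> sets \<mu>" using sets\<mu> by (simp add: borel_compact)
  have "K' \<noteq> {}" using K' by auto
  define \<nu> where "\<nu> = density \<mu> (indicator K')"
  note \<nu> = restricted_measure[OF sets\<mu> fin K'(1), folded \<nu>_def]
  show thesis
  proof (rule that[of \<nu> K'])
    show "sets \<nu> = sets borel" "finite_measure \<nu>" "emeasure \<nu> (space \<nu> - K') = 0" "compact K'"
      using \<nu> K' by auto
    show "emeasure \<nu> (space \<nu>) \<noteq> 0" "K' \<subseteq> K" using \<nu>(3) K' by (auto simp: B_def)
    show "\<exists>e>0. \<forall>z. (\<integral>\<^sup>+ w. log_kernel e z w \<partial>\<nu>) \<le> ennreal h" if h: "0 < h" for h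
    proof -
      obtain j where j: "1 / real (Suc j) < h"
        using nat_approx_posE[OF h] by (auto simp: field_simps)
      \<comment> \<open>Half the truncation radius that is under control on K', because the
        comparison with a nearest point doubles it.\<close>
      define e where "e = 1 / real (N j + 2) / 2"
      have "(\<integral>\<^sup>+ w. log_kernel e z w \<partial>\<nu>) \<le> ennreal h" for z
      proof -
        obtain z' where z': "z' \<in> K'" "\<And>w. w \<in> K' \<Longrightarrow> dist z z' \<le> dist z w"
          using distance_attains_inf[of K' z] K'(1) \<open>K' \<noteq> {}\<close> compact_imp_closed by blast
        have near: "norm (z' - w) \<le> 2 * norm (z - w)" if "w \<in> K'" for w
          using z'(2)[OF that] dist_triangle[of z' w z] by (simp add: dist_norm norm_minus_commute)
        have "(\<integral>\<^sup>+ w. log_kernel e z w \<partial>\<nu>) = (\<integral>\<^sup>+ w. indicator K' w * log_kernel e z w \<partial>\<mu>)"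
          by (rule \<nu>(5)) measurable
        also have "\<dots> \<le> (\<integral>\<^sup>+ w. log_kernel (1 / real (N j + 2)) z' w \<partial>\<mu>)"
        proof (rule nn_integral_mono)
          fix w
          show "indicator K' w * log_kernel e z w \<le> log_kernel (1 / real (N j + 2)) z' w"
          proof (cases "w \<in> K'")
            case True
            have "log_kernel e z w \<le> log_kernel (2 * e) z' w"
              by (rule log_kernel_nearest) (use near[OF True] in \<open>auto simp: e_def\<close>)
            also have "2 * e = 1 / real (N j + 2)" unfolding e_def by (simp only: field_simps) simp
            finally show ?thesis using True by simp
          qed simp
        qed
        also have "\<dots> = W (N j) z'" by (simp add: W_def)
        also have "\<dots> \<le> ennreal (1 / real (Suc j))"
          using z'(1) K'(2) by (auto simp: B_def U_def A_def not_less)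
        also have "\<dots> \<le> ennreal h" using j by (intro ennreal_leI) simp
        finally show ?thesis .
      qed
      then show ?thesis by (intro exI[of _ e]) (auto simp: e_def)
    qed
  qed
qed

section \<open>Harmonic functions\<close>

lemma harmonic_onI:
  assumes "open S" "\<And>z. z \<in> S \<Longrightarrow>
    \<exists>r>0. ball z r \<subseteq> S \<and> (\<exists>f. f holomorphic_on ball z r \<and> (\<forall>w\<in>ball z r. u w = Re (f w)))"
  shows "harmonic_on u S"
  using assms by (auto simp: harmonic_on_def)

lemma harmonic_onE:
  assumes "harmonic_on u S" "z \<in> S"
  obtains r f where "r > 0" "ball z r \<subseteq> S" "f holomorphic_on ball z r" "\<And>w. w \<in> ball z r \<Longrightarrow> u w = Re (f w)"
  using assms by (auto simp: harmonic_on_def)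

lemma harmonic_on_imp_open: "harmonic_on u S \<Longrightarrow> open S"
  by (simp add: harmonic_on_def)

lemma harmonic_on_local:
  assumes "open S" "\<And>z. z \<in> S \<Longrightarrow> \<exists>T. z \<in> T \<and> T \<subseteq> S \<and> harmonic_on u T"
  shows "harmonic_on u S"
proof (rule harmonic_onI)
  fix z assume "z \<in> S"
  then obtain T where "z \<in> T" "T \<subseteq> S" "harmonic_on u T" using assms by blast
  then show "\<exists>r>0. ball z r \<subseteq> S \<and> (\<exists>f. f holomorphic_on ball z r \<and> (\<forall>w\<in>ball z r. u w = Re (f w)))"
    by (meson harmonic_on_def order_trans)
qed fact

lemma harmonic_on_Re:
  assumes "open S" "f holomorphic_on S" "\<And>z. z \<in> S \<Longrightarrow> u z = Re (f z)"
  shows "harmonic_on u S"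
proof (rule harmonic_onI)
  fix z assume "z \<in> S"
  then obtain r where "r > 0" "ball z r \<subseteq> S" using assms(1) open_contains_ball by blast
  then show "\<exists>r>0. ball z r \<subseteq> S \<and> (\<exists>f. f holomorphic_on ball z r \<and> (\<forall>w\<in>ball z r. u w = Re (f w)))"
    using assms holomorphic_on_subset by blast
qed fact

lemma harmonic_on_subset:
  assumes "harmonic_on u S" "open T" "T \<subseteq> S"
  shows "harmonic_on u T"
proof (rule harmonic_onI)
  fix z assume z: "z \<in> T"
  obtain r f where rf: "r > 0" "f holomorphic_on ball z r" "\<And>w. w \<in> ball z r \<Longrightarrow> u w = Re (f w)"
    using harmonic_onE[OF assms(1)] z assms(3) by (metis subsetD)
  obtain s where s: "s > 0" "ball z s \<subseteq> T" using assms(2) z open_contains_ball by blast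
  have "ball z (min r s) \<subseteq> ball z r" "ball z (min r s) \<subseteq> ball z s" by auto
  then show "\<exists>r>0. ball z r \<subseteq> T \<and> (\<exists>f. f holomorphic_on ball z r \<and> (\<forall>w\<in>ball z r. u w = Re (f w)))"
    using rf s by (intro exI[of _ "min r s"] conjI exI[of _ f]) (auto intro: holomorphic_on_subset[OF rf(2)])
qed fact

lemma harmonic_on_cong:
  assumes "harmonic_on u S" "\<And>z. z \<in> S \<Longrightarrow> v z = u z"
  shows "harmonic_on v S"
proof (rule harmonic_onI)
  show "open S" using assms harmonic_on_imp_open by blast
  fix z assume "z \<in> S"
  then obtain r f where rf: "r > 0" "ball z r \<subseteq> S" "f holomorphic_on ball z r"
    "\<And>w. w \<in> ball z r \<Longrightarrow> u w = Re (f w)"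
    using harmonic_onE[OF assms(1)] by metis
  then show "\<exists>r>0. ball z r \<subseteq> S \<and> (\<exists>f. f holomorphic_on ball z r \<and> (\<forall>w\<in>ball z r. v w = Re (f w)))"
    using assms(2) by (intro exI[of _ r] conjI exI[of _ f]) auto
qed

lemma harmonic_on_linear:
  assumes "harmonic_on u S" "harmonic_on v S"
  shows "harmonic_on (\<lambda>z. a * u z + b * v z + c) S"
proof (rule harmonic_onI)
  show "open S" using assms harmonic_on_imp_open by blast
  fix z assume z: "z \<in> S"
  obtain r f where rf: "r > 0" "ball z r \<subseteq> S" "f holomorphic_on ball z r" "\<And>w. w \<in> ball z r \<Longrightarrow> u w = Re (f w)"
    using harmonic_onE[OF assms(1) z] by metis
  obtain s g where sg: "s > 0" "ball z s \<subseteq> S" "g holomorphic_on ball z s" "\<And>w. w \<in> ball z s \<Longrightarrow> v w = Re (g w)"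
    using harmonic_onE[OF assms(2) z] by metis
  let ?h = "\<lambda>w. of_real a * f w + of_real b * g w + of_real c"
  have "ball z (min r s) \<subseteq> ball z r" "ball z (min r s) \<subseteq> ball z s" by auto
  then have "f holomorphic_on ball z (min r s)" "g holomorphic_on ball z (min r s)"
    using rf(3) sg(3) holomorphic_on_subset by blast+
  then have "?h holomorphic_on ball z (min r s)"
    by (intro holomorphic_intros)
  then show "\<exists>r>0. ball z r \<subseteq> S \<and> (\<exists>f. f holomorphic_on ball z r \<and> (\<forall>w\<in>ball z r. a * u w + b * v w + c =
    Re (f w)))"
    using rf sg by (intro exI[of _ "min r s"] conjI exI[of _ ?h]) auto
qed

lemma harmonic_on_compose:
  assumes u: "harmonic_on u S" and g: "g holomorphic_on T" "open T" "g ` T \<subseteq> S"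
  shows "harmonic_on (\<lambda>z. u (g z)) T"
proof (rule harmonic_onI)
  fix z assume z: "z \<in> T"
  obtain r f where rf: "r > 0" "ball (g z) r \<subseteq> S" "f holomorphic_on ball (g z) r"
    "\<And>w. w \<in> ball (g z) r \<Longrightarrow> u w = Re (f w)"
    using harmonic_onE[OF u, of "g z"] z g(3) by (metis image_subset_iff)
  have "continuous_on T g" using g(1) by (rule holomorphic_on_imp_continuous_on)
  then have "open (T \<inter> g -` ball (g z) r)"
    using g(2) by (intro continuous_open_preimage) auto
  moreover have "z \<in> T \<inter> g -` ball (g z) r" using z rf by simp
  ultimately obtain s where s: "s > 0" "ball z s \<subseteq> T \<inter> g -` ball (g z) r"
    using open_contains_ball by blast
  have "(f \<circ> g) holomorphic_on ball z s"
  proof (rule holomorphic_on_compose_gen)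
    show "g holomorphic_on ball z s" using s by (auto intro: holomorphic_on_subset[OF g(1)])
    show "g ` ball z s \<subseteq> ball (g z) r" using s by auto
  qed fact
  then show "\<exists>r>0. ball z r \<subseteq> T \<and> (\<exists>f. f holomorphic_on ball z r \<and> (\<forall>w\<in>ball z r. u (g w) = Re (f w)))"
    using s rf(4) by (intro exI[of _ s] conjI exI[of _ "f \<circ> g"]) auto
qed fact

text \<open>The derivative of any local holomorphic completion of \<open>u\<close>.\<close>

definition complex_grad :: "(complex \<Rightarrow> real) \<Rightarrow> complex \<Rightarrow> complex" where
  "complex_grad u z = (THE d. (u has_derivative (\<lambda>h. Re (d * h))) (at z))"

lemma complex_grad_eqI:
  assumes "(u has_derivative (\<lambda>h. Re (d * h))) (at z)"
  shows "complex_grad u z = d"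
  unfolding complex_grad_def
proof (rule the_equality)
  show "(u has_derivative (\<lambda>h. Re (d * h))) (at z)" by fact
  fix d' assume "(u has_derivative (\<lambda>h. Re (d' * h))) (at z)"
  then have eq: "(\<lambda>h. Re (d' * h)) = (\<lambda>h. Re (d * h))"
    using assms has_derivative_unique by blast
  show "d' = d"
    using fun_cong[OF eq, of 1] fun_cong[OF eq, of "\<i>"] by (simp add: complex_eq_iff)
qed

lemma has_derivative_Re_holomorphic:
  assumes "(f has_field_derivative d) (at z)"
  shows "((\<lambda>w. Re (f w)) has_derivative (\<lambda>h. Re (d * h))) (at z)"
  using has_derivative_compose[OF has_field_derivative_imp_has_derivative[OF assms] has_derivative_Re[OF
    has_derivative_ident]]
  by simp

lemma harmonic_local_derivative:
  assumes "r > 0" "f holomorphic_on ball z r" "\<And>w. w \<in> ball z r \<Longrightarrow> u w = Re (f w)" "y \<in> ball z r"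
  shows "(u has_derivative (\<lambda>h. Re (deriv f y * h))) (at y)"
proof -
  have "(f has_field_derivative deriv f y) (at y)"
    using assms holomorphic_derivI by blast
  from has_derivative_Re_holomorphic[OF this] show ?thesis
    by (rule has_derivative_transform_within_open[of _ _ _ _ "ball z r"]) (use assms in auto)
qed

lemma harmonic_has_derivative:
  assumes "harmonic_on u S" "z \<in> S"
  shows "(u has_derivative (\<lambda>h. Re (complex_grad u z * h))) (at z)"
proof -
  obtain r f where rf: "r > 0" "f holomorphic_on ball z r" "\<And>w. w \<in> ball z r \<Longrightarrow> u w = Re (f w)"
    using harmonic_onE[OF assms] by metis
  then have "(u has_derivative (\<lambda>h. Re (deriv f z * h))) (at z)"
    by (intro harmonic_local_derivative) auto
  with complex_grad_eqI[OF this] show ?thesis by metis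
qed

lemma complex_grad_holomorphic:
  assumes "harmonic_on u S"
  shows "complex_grad u holomorphic_on S"
proof -
  have "complex_grad u field_differentiable at z within S" if z: "z \<in> S" for z
  proof -
    obtain r f where rf: "r > 0" "f holomorphic_on ball z r" "\<And>w. w \<in> ball z r \<Longrightarrow> u w = Re (f w)"
      using harmonic_onE[OF assms z] by metis
    have "deriv f holomorphic_on ball z r" using rf(2) by (intro holomorphic_deriv) auto
    then have "(deriv f has_field_derivative deriv (deriv f) z) (at z)"
      using rf(1) holomorphic_derivI[of "deriv f" "ball z r" z] by auto
    then have "(complex_grad u has_field_derivative deriv (deriv f) z) (at z)"
      by (rule has_field_derivative_transform_within_open[of _ _ _ "ball z r"])
        (use rf(1) complex_grad_eqI[OF harmonic_local_derivative[OF rf]] in \<open>simp_all del: times_complex.sel\<close>)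
    then show ?thesis
      using field_differentiable_at_within field_differentiable_def by blast
  qed
  then show ?thesis by (simp add: holomorphic_on_def)
qed

lemma harmonic_completion_of_primitive:
  assumes u: "harmonic_on u S" and S: "connected S"
    and \<Psi>: "\<And>z. z \<in> S \<Longrightarrow> (\<Psi> has_field_derivative complex_grad u z) (at z)"
  shows "\<exists>c. \<forall>z\<in>S. u z = Re (\<Psi> z + of_real c)"
proof (cases "S = {}")
  case False
  then obtain a where a: "a \<in> S" by blast
  let ?v = "\<lambda>z. u z - Re (\<Psi> z)"
  have "(?v has_derivative (\<lambda>h. 0)) (at z)" if "z \<in> S" for z
    using has_derivative_diff[OF harmonic_has_derivative[OF u that] has_derivative_Re_holomorphic[OF \<Psi>[OF
      that]]] by simp
  then have "?v z = ?v a" if "z \<in> S" for z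
    using has_derivative_zero_unique_connected[OF harmonic_on_imp_open[OF u] S] a that by blast
  then show ?thesis by (intro exI[of _ "?v a"]) (auto simp: algebra_simps)
qed auto

text \<open>Local completions are unique only up to constants, but their derivatives agree and form
  one holomorphic function; on a convex set it has a primitive, whose real part is u up to a
  constant.\<close>

lemma harmonic_on_convex_Re:
  assumes u: "harmonic_on u S" and S: "convex S"
  obtains \<Phi> where "\<Phi> holomorphic_on S" "\<And>z. z \<in> S \<Longrightarrow> u z = Re (\<Phi> z)"
proof -
  have op: "open S" using u by (rule harmonic_on_imp_open)
  obtain \<Psi> where \<Psi>: "\<And>z. z \<in> S \<Longrightarrow> (\<Psi> has_field_derivative complex_grad u z) (at z within S)"
    by (rule holomorphic_convex_primitive'[OF S op complex_grad_holomorphic[OF u]]) (rule that)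
  then have \<Psi>': "\<And>z. z \<in> S \<Longrightarrow> (\<Psi> has_field_derivative complex_grad u z) (at z)"
    using at_within_open[OF _ op] by metis
  then obtain c where "\<forall>z\<in>S. u z = Re (\<Psi> z + of_real c)"
    using harmonic_completion_of_primitive[OF u convex_connected[OF S]] by blast
  moreover have "(\<lambda>z. \<Psi> z + of_real c) holomorphic_on S"
    using \<Psi> by (intro holomorphic_intros) (auto simp: holomorphic_on_def field_differentiable_def)
  ultimately show thesis using that by blast
qed

text \<open>Only the real part is bounded, so Cauchy's inequality is applied to
  \<open>exp (g z)\<close>, whose norm lies between exp (-M) and exp M. The constant is crude, but
  it is the factor 1/s that gives decay later.\<close>

lemma deriv_bound_of_Re_bound:
  assumes g: "g holomorphic_on ball a s" "0 < s" and M: "\<And>z. z \<in> ball a s \<Longrightarrow> \<bar>Re (g z)\<bar> \<le> M"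
  shows "norm (deriv g a) \<le> exp (2 * M) / (s / 2)"
proof -
  have sub: "cball a (s/2) \<subseteq> ball a s" using g(2) by auto
  have hol: "(\<lambda>z. exp (g z)) holomorphic_on ball a s" using g by (intro holomorphic_intros)
  have "norm ((deriv ^^ 1) (\<lambda>z. exp (g z)) a) \<le> fact 1 * exp M / (s/2)^1"
  proof (rule Cauchy_inequality)
    show "(\<lambda>z. exp (g z)) holomorphic_on ball a (s/2)"
      using hol sub ball_subset_cball holomorphic_on_subset by blast
    show "continuous_on (cball a (s/2)) (\<lambda>z. exp (g z))"
      using hol sub holomorphic_on_imp_continuous_on continuous_on_subset by blast
    show "norm (exp (g x)) \<le> exp M" if "norm (a - x) = s/2" for x
      using M[of x] that g(2) by (auto simp: dist_norm)
  qed (use g in auto)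
  moreover have "(g has_field_derivative deriv g a) (at a)"
    using g by (auto intro: holomorphic_derivI)
  then have "((\<lambda>z. exp (g z)) has_field_derivative exp (g a) * deriv g a) (at a)"
    by (auto intro!: derivative_eq_intros)
  then have "deriv (\<lambda>z. exp (g z)) a = exp (g a) * deriv g a" by (rule DERIV_imp_deriv)
  ultimately have 1: "exp (Re (g a)) * norm (deriv g a) \<le> exp M / (s/2)"
    by (simp add: norm_mult)
  have "exp (- M) * norm (deriv g a) \<le> exp (Re (g a)) * norm (deriv g a)"
    using M[of a] g(2) by (intro mult_right_mono) auto
  with 1 have "exp (- M) * norm (deriv g a) \<le> exp M / (s/2)" by linarith
  then have "exp M * (exp (- M) * norm (deriv g a)) \<le> exp M * (exp M / (s/2))"
    by (intro mult_left_mono) auto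
  moreover have "exp M * (exp (- M) * norm (deriv g a)) = norm (deriv g a)"
    by (simp add: exp_minus)
  moreover have "exp M * (exp M / (s/2)) = exp (2 * M) / (s/2)"
    using exp_add[of M M] by simp
  ultimately show ?thesis by linarith
qed

text \<open>A bounded harmonic function is pulled back by \<open>exp\<close> to a half-plane, where the derivative
  estimate gives \<open>z * complex_grad u z \<longlonglongrightarrow> 0\<close>; hence the gradient has a removable singularity.\<close>

lemma harmonic_removable:
  assumes u: "harmonic_on u (ball 0 r - {0})" and r: "r > 0"
    and M: "\<And>z. z \<in> ball 0 r - {0} \<Longrightarrow> \<bar>u z\<bar> \<le> M"
  obtains v where "harmonic_on v (ball 0 r)" "\<And>z. z \<in> ball 0 r - {0} \<Longrightarrow> v z = u z"
proof -
  let ?P = "ball 0 r - {0::complex}"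
  define H where "H = {\<zeta>. Re \<zeta> < ln r}"
  have H: "open H" "convex H" unfolding H_def by (auto simp: open_halfspace_Re_lt convex_halfspace_Re_lt)
  have expH: "exp \<zeta> \<in> ?P" if "\<zeta> \<in> H" for \<zeta>
    using that r by (auto simp: H_def) (metis exp_less_cancel_iff exp_ln)
  have "harmonic_on (\<lambda>\<zeta>. u (exp \<zeta>)) H"
    using expH H by (intro harmonic_on_compose[OF u] holomorphic_intros) auto
  then obtain \<Psi> where \<Psi>: "\<Psi> holomorphic_on H" "\<And>\<zeta>. \<zeta> \<in> H \<Longrightarrow> u (exp \<zeta>) = Re (\<Psi> \<zeta>)"
    using harmonic_on_convex_Re[OF _ H(2)] by metis
  define \<phi> where "\<phi> = complex_grad u"
  have \<phi>: "\<phi> holomorphic_on ?P" unfolding \<phi>_def by (rule complex_grad_holomorphic[OF u])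
  have d\<Psi>: "deriv \<Psi> \<zeta> = \<phi> (exp \<zeta>) * exp \<zeta>" if \<zeta>: "\<zeta> \<in> H" for \<zeta>
  proof -
    have "(u has_derivative (\<lambda>h. Re (\<phi> (exp \<zeta>) * h))) (at (exp \<zeta>))"
      unfolding \<phi>_def by (rule harmonic_has_derivative[OF u expH[OF \<zeta>]])
    moreover have "(exp has_derivative (\<lambda>h. exp \<zeta> * h)) (at \<zeta>)"
      using DERIV_exp[of \<zeta>] by (rule has_field_derivative_imp_has_derivative)
    ultimately have "((\<lambda>x. u (exp x)) has_derivative (\<lambda>h. Re (\<phi> (exp \<zeta>) * (exp \<zeta> * h)))) (at \<zeta>)"
      using has_derivative_compose by blast
    then have 1: "((\<lambda>x. Re (\<Psi> x)) has_derivative (\<lambda>h. Re (\<phi> (exp \<zeta>) * exp \<zeta> * h))) (at \<zeta>)"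
      using has_derivative_transform_within_open[of "\<lambda>x. u (exp x)" _ \<zeta> UNIV H "\<lambda>x. Re (\<Psi> x)"] H(1) \<zeta> \<Psi>(2)
      by (simp add: mult.assoc)
    have "(\<Psi> has_field_derivative deriv \<Psi> \<zeta>) (at \<zeta>)"
      using \<Psi>(1) H(1) \<zeta> holomorphic_derivI by blast
    from has_derivative_Re_holomorphic[OF this] 1 show ?thesis
      using complex_grad_eqI by metis
  qed
  have bound: "norm (z * \<phi> z) \<le> exp (2 * M) / ((ln r - ln (norm z)) / 2)" if z: "z \<in> ?P" for z
  proof -
    define \<zeta> where "\<zeta> = Ln z"
    have e: "exp \<zeta> = z" "Re \<zeta> = ln (norm z)" using z by (auto simp: \<zeta>_def)
    have pos: "ln r - ln (norm z) > 0" using z r by simp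
    then have \<zeta>: "\<zeta> \<in> H" using e by (simp add: H_def)
    \<comment> \<open>The radius is the distance of \<open>Ln z\<close> from the edge of the
      half-plane. It tends to infinity as z tends to 0, which makes the derivative estimate
      decay.\<close>
    have sub: "ball \<zeta> (ln r - ln (norm z)) \<subseteq> H"
    proof
      fix x assume "x \<in> ball \<zeta> (ln r - ln (norm z))"
      then have "norm (x - \<zeta>) < ln r - ln (norm z)" by (simp add: dist_norm norm_minus_commute)
      moreover have "Re x - Re \<zeta> \<le> norm (x - \<zeta>)" using complex_Re_le_cmod[of "x - \<zeta>"] by simp
      ultimately show "x \<in> H" using e by (simp add: H_def)
    qed
    have "norm (deriv \<Psi> \<zeta>) \<le> exp (2 * M) / ((ln r - ln (norm z)) / 2)"
    proof (rule deriv_bound_of_Re_bound)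
      show "\<Psi> holomorphic_on ball \<zeta> (ln r - ln (norm z))" using \<Psi>(1) sub holomorphic_on_subset by blast
      show "\<bar>Re (\<Psi> x)\<bar> \<le> M" if "x \<in> ball \<zeta> (ln r - ln (norm z))" for x
        using M[OF expH[of x]] \<Psi>(2)[of x] sub that by auto
    qed fact
    then show ?thesis using d\<Psi>[OF \<zeta>] e by (simp add: mult.commute)
  qed
  have "((\<lambda>z. (z - 0) * \<phi> z) \<longlongrightarrow> 0) (at 0)"
  proof (rule Lim_null_comparison)
    show "\<forall>\<^sub>F z in at 0. norm ((z - 0) * \<phi> z) \<le> exp (2 * M) / ((ln r - ln (norm z)) / 2)"
      using eventually_at_ball'[OF r, of 0 UNIV] by eventually_elim (use bound in auto)
    have 1: "((\<lambda>x. exp (2 * M) / ((ln r - ln x) / 2)) \<longlongrightarrow> 0) (at_right 0)"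
      proof (rule tendsto_divide_0[OF tendsto_const])
      have "filterlim (\<lambda>x::real. - ln x) at_top (at_right 0)" by real_asymp
      then have "filterlim (\<lambda>x. (1/2) * (ln r + (- ln x))) at_top (at_right 0)"
        by (intro filterlim_tendsto_pos_mult_at_top[OF tendsto_const] filterlim_tendsto_add_at_top[OF
          tendsto_const]) auto
      then show "filterlim (\<lambda>x. (ln r - ln x) / 2) at_infinity (at_right 0)"
        by (intro filterlim_at_top_imp_at_infinity) (simp add: field_simps)
    qed
    have "filterlim norm (at_right 0) (at (0::complex))"
      unfolding filterlim_at by (auto intro!: tendsto_eq_intros simp: eventually_at_filter)
    from filterlim_compose[OF 1 this]
    show "((\<lambda>z. exp (2 * M) / ((ln r - ln (norm z)) / 2)) \<longlongrightarrow> 0) (at (0::complex))" .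
  qed
  moreover have "0 \<in> interior (ball 0 r)" using r by (simp add: interior_open)
  ultimately obtain g where g: "g holomorphic_on ball 0 r" "\<And>z. z \<in> ?P \<Longrightarrow> g z = \<phi> z"
    using holomorphic_on_extend_lim[OF \<phi>] by (metis)
  \<comment> \<open>The gradient now extends over 0, so it has a primitive on the full disc and u
    has no conjugate period around the puncture.\<close>
  obtain G where G: "\<And>z. z \<in> ball 0 r \<Longrightarrow> (G has_field_derivative g z) (at z within ball 0 r)"
    by (rule holomorphic_convex_primitive'[OF convex_ball open_ball g(1)]) (rule that)
  have "(G has_field_derivative complex_grad u z) (at z)" if "z \<in> ?P" for z
    using G[of z] g(2)[OF that] that at_within_open[OF _ open_ball, of z 0 r] by (simp add: \<phi>_def)
  moreover have "connected ?P" by (rule connected_punctured_ball) simp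
  ultimately obtain c where c: "\<And>z. z \<in> ?P \<Longrightarrow> u z = Re (G z + of_real c)"
    using harmonic_completion_of_primitive[OF u] by blast
  have "(\<lambda>z. G z + of_real c) holomorphic_on ball 0 r"
    by (intro holomorphic_intros) (use G in \<open>unfold holomorphic_on_def field_differentiable_def, blast\<close>)
  then have "harmonic_on (\<lambda>z. Re (G z + of_real c)) (ball 0 r)"
    by (intro harmonic_on_Re) auto
  then show thesis using c that by metis
qed

section \<open>The counting function of a covering of a Greenian domain\<close>

text \<open>Near z0 the kernel is \<open>ln (norm (z0 - w))\<close> plus the real part of the series
  of \<open>Ln (1 + (z - z0) / (z0 - w))\<close>. Points of K keep a distance r from z0, so the
  series converges geometrically, uniformly in w, and termwise integration gives a power series in z
  - z0.\<close>

lemma log_potential: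
  fixes \<nu> :: "complex measure"
  assumes sets\<nu>: "sets \<nu> = sets borel" and fin: "finite_measure \<nu>"
    and K: "compact K" "emeasure \<nu> (space \<nu> - K) = 0" and D: "open D" "D \<inter> K = {}"
  shows "harmonic_on (\<lambda>z. LINT w|\<nu>. ln (norm (z - w))) D"
    and "\<And>z. z \<in> D \<Longrightarrow> integrable \<nu> (\<lambda>w. ln (norm (z - w)))"
proof -
  interpret finite_measure \<nu> by fact
  note [measurable_cong] = sets\<nu>
  have space\<nu>: "space \<nu> = UNIV" using sets_eq_imp_space_eq[OF sets\<nu>] by simp
  have AEK: "AE w in \<nu>. w \<in> K" by (rule AE_mem_of_null_complement[OF sets\<nu> K])
  show int: "integrable \<nu> (\<lambda>w. ln (norm (z - w)))" if "z \<in> D" for z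
  proof -
    have "continuous_on K (\<lambda>w. ln (norm (z - w)))"
      using that D by (intro continuous_intros) auto
    then have "bounded ((\<lambda>w. ln (norm (z - w))) ` K)"
      using K(1) compact_continuous_image compact_imp_bounded by blast
    then obtain B where "\<And>w. w \<in> K \<Longrightarrow> norm (ln (norm (z - w))) \<le> B"
      by (auto simp: bounded_iff)
    then show ?thesis
      using AEK by (intro integrable_const_bound[where B=B]) (auto elim!: eventually_mono)
  qed
  show "harmonic_on (\<lambda>z. LINT w|\<nu>. ln (norm (z - w))) D"
  proof (rule harmonic_onI)
    fix z0 assume z0: "z0 \<in> D"
    then obtain r where r: "r > 0" "ball z0 r \<subseteq> D" using D(1) open_contains_ball by blast
    have far: "r \<le> norm (z0 - w)" if "w \<in> K" for w
      using r(2) D(2) that by (auto simp: subset_iff disjoint_iff dist_norm not_less)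
    \<comment> \<open>The coefficients of Ln (1 + x). Division by zero makes the constant term 0, as
      it should be.\<close>
    define a where "a n = ((-1) ^ Suc n / of_nat n :: complex)" for n
    have a: "norm (a n) \<le> 1" for n
      by (cases n) (simp_all add: a_def norm_divide norm_power divide_simps del: of_nat_Suc power_Suc)
    define b where "b n = a n * (LINT w|\<nu>. 1 / (z0 - w) ^ n)" for n
    define H where "H z = (LINT w|\<nu>. Ln (1 + (z - z0) / (z0 - w)))" for z
    have main: "(\<lambda>n. b n * (z - z0) ^ n) sums H z \<and> integrable \<nu> (\<lambda>w. Ln (1 + (z - z0) / (z0 - w)))"
      if z: "z \<in> ball z0 r" for z
    proof -
      define q where "q = norm (z - z0) / r"
      have q: "0 \<le> q" "q < 1" using z r(1) by (auto simp: q_def dist_norm norm_minus_commute)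
      define h where "h n w = a n * ((z - z0) / (z0 - w)) ^ n" for n w
      have hb: "norm (h n w) \<le> q ^ n" if "w \<in> K" for n w
      proof -
        have "norm ((z - z0) / (z0 - w)) \<le> q"
          unfolding q_def norm_divide using far[OF that] r(1) by (intro divide_left_mono mult_pos_pos) auto
        then have "norm ((z - z0) / (z0 - w)) ^ n \<le> q ^ n" by (intro power_mono) auto
        then have "norm (a n) * norm ((z - z0) / (z0 - w)) ^ n \<le> 1 * q ^ n"
          using a by (intro mult_mono) auto
        then show ?thesis by (simp add: h_def norm_mult norm_power)
      qed
      have hm [measurable]: "h n \<in> borel_measurable \<nu>" for n unfolding h_def by measurable
      have hi: "integrable \<nu> (h n)" for n
        using AEK hb by (intro integrable_const_bound[where B="q^n"]) (auto elim!: eventually_mono)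
      have sm: "AE w in \<nu>. summable (\<lambda>n. norm (h n w))"
        using AEK
      proof eventually_elim
        case (elim w)
        show ?case
          by (rule summable_comparison_test'[of "\<lambda>n. q^n"])
            (use q hb[OF elim] in \<open>auto intro: summable_geometric\<close>)
      qed
      have si: "summable (\<lambda>n. LINT w|\<nu>. norm (h n w))"
      proof (rule summable_comparison_test'[of "\<lambda>n. q^n * measure \<nu> UNIV"])
        show "summable (\<lambda>n. q^n * measure \<nu> UNIV)" using q by (intro summable_mult2 summable_geometric) auto
        show "norm (LINT w|\<nu>. norm (h n w)) \<le> q ^ n * measure \<nu> UNIV" for n
        proof -
          have "(LINT w|\<nu>. norm (h n w)) \<le> (LINT w|\<nu>. q ^ n)"
            using AEK hb hi by (intro integral_mono_AE) (auto elim!: eventually_mono)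
          then show ?thesis by (simp add: space\<nu> integral_nonneg_AE mult.commute)
        qed
      qed
      have L: "AE w in \<nu>. (\<Sum>n. h n w) = Ln (1 + (z - z0) / (z0 - w))"
        using AEK
      proof eventually_elim
        case (elim w)
        have "norm ((z - z0) / (z0 - w)) \<le> q"
          unfolding q_def norm_divide using far[OF elim] r(1) by (intro divide_left_mono mult_pos_pos) auto
        then have "norm ((z - z0) / (z0 - w)) < 1" using q by linarith
        from Ln_series[OF this] show ?case
          unfolding h_def a_def by (simp add: sums_iff)
      qed
      have Lm: "(\<lambda>w. Ln (1 + (z - z0) / (z0 - w))) \<in> borel_measurable \<nu>" by measurable
      have i: "integrable \<nu> (\<lambda>w. \<Sum>n. h n w)" by (rule integrable_suminf[OF hi sm si])
      have "integrable \<nu> (\<lambda>w. Ln (1 + (z - z0) / (z0 - w)))"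
        using i L Lm by (subst integrable_cong_AE[of _ _ "\<lambda>w. \<Sum>n. h n w"]) (auto elim!: eventually_mono)
      moreover have "(\<lambda>n. LINT w|\<nu>. h n w) sums (LINT w|\<nu>. (\<Sum>n. h n w))"
        by (rule sums_integral[OF hi sm si])
      moreover have "(LINT w|\<nu>. (\<Sum>n. h n w)) = H z"
        unfolding H_def using i L Lm by (intro integral_cong_AE) auto
      moreover have "(LINT w|\<nu>. h n w) = b n * (z - z0) ^ n" for n
      proof -
        have "h n w = a n * (z - z0) ^ n * (1 / (z0 - w) ^ n)" for w
          by (simp add: h_def power_divide)
        then show ?thesis by (simp add: b_def del: times_divide_eq_right)
      qed
      ultimately show ?thesis by simp
    qed
    have "H holomorphic_on ball z0 r"
      by (rule power_series_holomorphic[of z0 r b]) (use main in blast)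
    moreover define c where "c = (LINT w|\<nu>. ln (norm (z0 - w)))"
    ultimately have "(\<lambda>z. of_real c + H z) holomorphic_on ball z0 r"
      by (intro holomorphic_intros)
    moreover have "(LINT w|\<nu>. ln (norm (z - w))) = Re (of_real c + H z)" if z: "z \<in> ball z0 r" for z
    proof -
      have "AE w in \<nu>. ln (norm (z - w)) = ln (norm (z0 - w)) + Re (Ln (1 + (z - z0) / (z0 - w)))"
        using AEK
      proof eventually_elim
        case (elim w)
        have ne: "z0 - w \<noteq> 0" "z - w \<noteq> 0" using elim D r(2) z z0 by auto
        have "1 + (z - z0) / (z0 - w) = (z - w) / (z0 - w)" using ne by (simp add: field_simps)
        then show ?case using ne by (simp add: norm_divide ln_div)
      qed
      then have "(LINT w|\<nu>. ln (norm (z - w))) =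
        (LINT w|\<nu>. ln (norm (z0 - w)) + Re (Ln (1 + (z - z0) / (z0 - w))))"
        by (intro integral_cong_AE) auto
      also have "\<dots> = c + (LINT w|\<nu>. Re (Ln (1 + (z - z0) / (z0 - w))))"
        unfolding c_def using int[OF z0] main[OF z] by (intro Bochner_Integration.integral_add) auto
      also have "(LINT w|\<nu>. Re (Ln (1 + (z - z0) / (z0 - w)))) = Re (H z)"
        unfolding H_def using main[OF z] by simp
      finally show ?thesis by simp
    qed
    ultimately show "\<exists>r>0. ball z0 r \<subseteq> D \<and> (\<exists>f. f holomorphic_on ball z0 r \<and>
        (\<forall>z\<in>ball z0 r. (LINT w|\<nu>. ln (norm (z - w))) = Re (f z)))"
      using r by (intro exI[of _ r] conjI exI[of _ "\<lambda>z. of_real c + H z"]) auto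
  qed fact
qed

text \<open>The potential of a measure of mass m off D is harmonic on D and grows like m ln |z|;
  after \<open>finite_energy_restriction\<close> it is also bounded below on bounded parts of D.
  Dividing by m and adding a constant gives the majorant.\<close>

lemma bounded_below_harmonic_dominating_log:
  assumes D: "open D" and np: "\<not> polar (- D)"
  obtains u where "harmonic_on u D" "\<And>z. z \<in> D \<Longrightarrow> ln (max 1 (norm z)) \<le> u z"
proof -
  from np obtain \<mu> :: "complex measure" and K where \<mu>: "sets \<mu> = sets borel" "finite_measure \<mu>"
    "emeasure \<mu> (space \<mu>) \<noteq> 0" "compact K" "K \<subseteq> - D" "emeasure \<mu> (space \<mu> - K) = 0"
    "(\<integral>\<^sup>+ z. (\<integral>\<^sup>+ w. log_kernel_neg z w \<partial>\<mu>) \<partial>\<mu>) \<noteq> \<infinity>"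
    unfolding polar_def by auto
  obtain \<nu> K' where \<nu>: "sets \<nu> = sets borel" "finite_measure \<nu>" "emeasure \<nu> (space \<nu>) \<noteq> 0"
    "compact K'" "K' \<subseteq> K" "emeasure \<nu> (space \<nu> - K') = 0"
    "\<And>h. 0 < h \<Longrightarrow> \<exists>e>0. \<forall>z. (\<integral>\<^sup>+ w. log_kernel e z w \<partial>\<nu>) \<le> ennreal h"
    by (rule finite_energy_restriction[OF \<mu>(1-4,6,7)]) (rule that)
  interpret finite_measure \<nu> by fact
  note [measurable_cong] = \<nu>(1)
  have space\<nu>: "space \<nu> = UNIV" using sets_eq_imp_space_eq[OF \<nu>(1)] by simp
  have disj: "D \<inter> K' = {}" using \<nu>(5) \<mu>(5) by auto
  define p where "p z = (LINT w|\<nu>. ln (norm (z - w)))" for z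
  note P = log_potential[OF \<nu>(1,2,4,6) D disj]
  have AEK: "AE w in \<nu>. w \<in> K'" by (rule AE_mem_of_null_complement[OF \<nu>(1,4,6)])
  define m where "m = measure \<nu> UNIV"
  have m: "m > 0" using \<nu>(3) by (simp add: m_def space\<nu> emeasure_eq_measure zero_less_measure_iff)
  obtain e where e: "e > 0" "\<And>z. (\<integral>\<^sup>+ w. log_kernel e z w \<partial>\<nu>) \<le> ennreal 1"
    using \<nu>(7)[of 1] by auto
  obtain B0 where B0: "\<And>w. w \<in> K' \<Longrightarrow> norm w \<le> B0"
    using \<nu>(4) by (meson compact_imp_bounded bounded_iff)
  define B where "B = max 1 B0"
  have B: "B \<ge> 1" "\<And>w. w \<in> K' \<Longrightarrow> norm w \<le> B" using B0 by (auto simp: B_def max.coboundedI2)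
  \<comment> \<open>The potential falls below \<open>m * ln e\<close> by at most the truncated
    potential, and e was chosen to bound that by 1.\<close>
  have lower: "m * ln e - 1 \<le> p z" if z: "z \<in> D" for z
  proof -
    have i: "integrable \<nu> (\<lambda>w. ln e - ln (norm (z - w)))" using P(2)[OF z] by auto
    have "(LINT w|\<nu>. ln e - ln (norm (z - w))) \<le> (LINT w|\<nu>. max 0 (ln e - ln (norm (z - w))))"
      using i by (intro integral_mono) auto
    also have "\<dots> = enn2real (\<integral>\<^sup>+ w. ennreal (max 0 (ln e - ln (norm (z - w)))) \<partial>\<nu>)"
      by (intro integral_eq_nn_integral) auto
    also have "\<dots> \<le> enn2real (ennreal 1)"
    proof (rule enn2real_mono)
      have "(\<integral>\<^sup>+ w. ennreal (max 0 (ln e - ln (norm (z - w)))) \<partial>\<nu>) \<le> (\<integral>\<^sup>+ w. log_kernel e z w \<partial>\<nu>)"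
        by (intro nn_integral_mono) (auto simp: log_kernel_def max_def intro!: ennreal_leI)
      then show "(\<integral>\<^sup>+ w. ennreal (max 0 (ln e - ln (norm (z - w)))) \<partial>\<nu>) \<le> ennreal 1"
        using e(2)[of z] by order
    qed simp
    finally have "(LINT w|\<nu>. ln e - ln (norm (z - w))) \<le> 1" by simp
    moreover have "(LINT w|\<nu>. ln e - ln (norm (z - w))) = m * ln e - p z"
      using P(2)[OF z] by (simp add: p_def m_def space\<nu> mult.commute)
    ultimately show ?thesis by simp
  qed
  have large: "m * (ln (norm z) - ln 2) \<le> p z" if z: "z \<in> D" "norm z \<ge> 2 * B" for z
  proof -
    have "(LINT w|\<nu>. ln (norm z) - ln 2) \<le> p z"
      unfolding p_def
    proof (rule integral_mono_AE)
      show "AE w in \<nu>. ln (norm z) - ln 2 \<le> ln (norm (z - w))"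
        using AEK
      proof eventually_elim
        case (elim w)
        have "norm z / 2 \<le> norm (z - w)"
          using norm_triangle_ineq2[of z w] B(2)[OF elim] z(2) by linarith
        moreover have "norm z > 0" using z(2) B(1) by linarith
        ultimately have "ln (norm z / 2) \<le> ln (norm (z - w))" 
          by (subst ln_le_cancel_iff) auto
        then show ?case using \<open>norm z > 0\<close> by (simp add: ln_div)
      qed
    qed (use P(2)[OF z(1)] in auto)
    then show ?thesis by (simp add: m_def space\<nu>)
  qed
  \<comment> \<open>The first two terms absorb the loss in \<open>lower\<close>; the last covers
    log^+ on the disc of radius 2 B and also the loss \<open>m * ln 2\<close> in
    \<open>large\<close>.\<close>
  define C where "C = 1 + m * \<bar>ln e\<bar> + m * ln (2 * B)"
  have lnB: "ln (2 * B) \<ge> ln 2" "ln 2 > (0::real)" using B(1) by auto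
  \<comment> \<open>Written in the two-function form of \<open>harmonic_on_linear\<close>.\<close>
  define u where "u z = (1/m) * p z + 0 * p z + C / m" for z
  show thesis
  proof (rule that[of u])
    show "harmonic_on u D" unfolding u_def p_def by (intro harmonic_on_linear P(1))
    fix z assume z: "z \<in> D"
    have "m * ln (max 1 (norm z)) \<le> p z + C"
    proof (cases "norm z \<ge> 2 * B")
      case True
      then have "max 1 (norm z) = norm z" using B(1) by auto
      moreover have "m * ln 2 \<le> C"
        using m lnB by (simp add: C_def add_increasing mult_left_mono)
      ultimately show ?thesis using large[OF z True] by (simp add: algebra_simps)
    next
      case False
      then have "ln (max 1 (norm z)) \<le> ln (2 * B)" using B(1) by (subst ln_le_cancel_iff) auto
      then have "m * ln (max 1 (norm z)) \<le> m * ln (2 * B)" using m by (intro mult_left_mono) auto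
      moreover have "- (m * \<bar>ln e\<bar>) \<le> m * ln e"
        using m by (simp add: abs_if)
      ultimately show ?thesis using lower[OF z] by (simp add: C_def)
    qed
    then show "ln (max 1 (norm z)) \<le> u z"
      using m by (simp add: u_def field_simps)
  qed
qed

text \<open>The case a = b is included through the value \<open>ln 0 = 0\<close>.\<close>

lemma ln_norm_diff_le: "ln (norm (a - b)) \<le> ln (max 1 (norm a)) + ln (max 1 (norm b)) + ln 2"
  for a b :: complex
proof (cases "a = b")
  case False
  have "norm (a - b) \<le> norm a + norm b" by (rule norm_triangle_ineq4)
  also have "\<dots> \<le> max 1 (norm a) * max 1 (norm b) + max 1 (norm a) * max 1 (norm b)"
  proof (rule add_mono)
    show "norm a \<le> max 1 (norm a) * max 1 (norm b)"
      using mult_mono[of "norm a" "max 1 (norm a)" 1 "max 1 (norm b)"] by simp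
    show "norm b \<le> max 1 (norm a) * max 1 (norm b)"
      using mult_mono[of 1 "max 1 (norm a)" "norm b" "max 1 (norm b)"] by simp
  qed
  finally have "ln (norm (a - b)) \<le> ln (max 1 (norm a) * max 1 (norm b) * 2)"
    using False by (subst ln_le_cancel_iff) (auto intro!: mult_pos_pos simp: less_max_iff_disj)
  also have "\<dots> = ln (max 1 (norm a)) + ln (max 1 (norm b)) + ln 2"
  proof -
    have "max 1 (norm a) > 0" "max 1 (norm b) > 0" by (auto simp: less_max_iff_disj)
    then show ?thesis by (simp add: ln_mult_pos)
  qed
  finally show ?thesis .
qed (auto intro!: add_nonneg_nonneg)

section \<open>Finiteness of the counting function and its pole at the origin\<close>

locale greenian_covering = disc_covering +
  assumes nonpolar: "\<not> polar (- D)"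
begin

text \<open>This puts f into the Nevanlinna class: a harmonic majorant of log^+ |z| on D is composed
  with f and completed on the disc. It is the source of the bounds on logarithmic means and counting
  functions that are uniform in the radius.\<close>

lemma nevanlinna_majorant:
  obtains \<Phi> where "\<Phi> holomorphic_on ball 0 1" "\<And>z. z \<in> ball 0 1 \<Longrightarrow> ln (max 1 (norm (f z))) \<le> Re (\<Phi> z)"
proof -
  obtain u where u: "harmonic_on u D" "\<And>z. z \<in> D \<Longrightarrow> ln (max 1 (norm z)) \<le> u z"
    using bounded_below_harmonic_dominating_log[OF openD nonpolar] by blast
  have "harmonic_on (\<lambda>z. u (f z)) (ball 0 1)"
    by (rule harmonic_on_compose[OF u(1) hol]) (use image_f in auto)
  then obtain \<Phi> where \<Phi>: "\<Phi> holomorphic_on ball 0 1" "\<And>z. z \<in> ball 0 1 \<Longrightarrow> u (f z) = Re (\<Phi> z)"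
    using harmonic_on_convex_Re[OF _ convex_ball] by metis
  show thesis
  proof (rule that[OF \<Phi>(1)])
    fix z :: complex assume z: "z \<in> ball 0 1"
    then show "ln (max 1 (norm (f z))) \<le> Re (\<Phi> z)" using u(2)[of "f z"] \<Phi>(2)[OF z] f_in_D by simp
  qed
qed

lemma mean_log_plus_bounded:
  obtains C where "\<And>r. 0 \<le> r \<Longrightarrow> r < 1 \<Longrightarrow> (LINT t|unif01. ln (max 1 (norm (f (circ r t))))) \<le> C"
    "\<And>r. 0 \<le> r \<Longrightarrow> r < 1 \<Longrightarrow> integrable unif01 (\<lambda>t. ln (max 1 (norm (f (circ r t)))))"
proof -
  obtain \<Phi> where \<Phi>: "\<Phi> holomorphic_on ball 0 1" "\<And>z. z \<in> ball 0 1 \<Longrightarrow> ln (max 1 (norm (f z))) \<le> Re (\<Phi> z)"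
    by (rule nevanlinna_majorant) (rule that)
  have i: "integrable unif01 (\<lambda>t. ln (max 1 (norm (f (circ r t)))))" if r: "0 \<le> r" "r < 1" for r
  proof -
    obtain B where B: "B > 0" "\<And>t. norm (f (circ r t)) \<le> B"
      by (rule bounded_holomorphic_circle[OF hol r]) (rule that)
    show ?thesis
    proof (rule bounded_unif01_integrable)
      show "continuous_on UNIV (\<lambda>t. ln (max 1 (norm (f (circ r t)))))"
        by (intro continuous_intros continuous_holomorphic_circle hol r)
          (metis less_max_iff_disj less_irrefl zero_less_one)
      show "norm (ln (max 1 (norm (f (circ r t))))) \<le> ln (max 1 B)" for t
        using B(2)[of t] by (auto intro!: ln_mono)
    qed
  qed
  show thesis
  proof (rule that[of "Re (\<Phi> 0)"])
    fix r :: real assume r: "0 \<le> r" "r < 1"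
    have "(LINT t|unif01. ln (max 1 (norm (f (circ r t))))) \<le> (LINT t|unif01. Re (\<Phi> (0 + circ r t)))"
      by (rule integral_mono[OF i[OF r] circle_mean_Re(2)[OF \<Phi>(1) r]])
        (use r in \<open>auto intro!: \<Phi>(2) simp: norm_mult\<close>)
    then show "(LINT t|unif01. ln (max 1 (norm (f (circ r t))))) \<le> Re (\<Phi> 0)"
      using circle_mean_Re(1)[OF \<Phi>(1) r] by simp
  qed (rule i)
qed

text \<open>The form of the bound serves two purposes: it is the constant C for |w| >= 1, and it is
  C - ln |w| near 0, which gives half of the logarithmic pole.\<close>

lemma cnt_bounded:
  obtains C where "\<And>r (w::complex). 0 < r \<Longrightarrow> r < 1 \<Longrightarrow> w \<noteq> 0 \<Longrightarrow> cnt r w \<le> C + ln (max 1 (norm w)) - ln (norm w)"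
proof -
  obtain C where C: "\<And>r. 0 \<le> r \<Longrightarrow> r < 1 \<Longrightarrow> (LINT t|unif01. ln (max 1 (norm (f (circ r t))))) \<le> C"
    "\<And>r. 0 \<le> r \<Longrightarrow> r < 1 \<Longrightarrow> integrable unif01 (\<lambda>t. ln (max 1 (norm (f (circ r t)))))"
    using mean_log_plus_bounded by blast
  show thesis
  proof (rule that[of "C + ln 2"])
    fix r :: real and w :: complex assume r: "0 < r" "r < 1" and w: "w \<noteq> 0"
    have "ln (norm w) + cnt r w = (LINT t|unif01. ln (norm (f (circ r t) - w)))"
      using jensen(2)[OF r w] by simp
    also have "\<dots> \<le> (LINT t|unif01. ln (max 1 (norm (f (circ r t)))) + (ln (max 1 (norm w)) + ln 2))"
      using C(2)[of r] r jensen(1)[OF r w] ln_norm_diff_le[of _ w]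
      by (intro integral_mono) (auto simp: add.assoc)
    also have "\<dots> \<le> C + (ln (max 1 (norm w)) + ln 2)"
      using C[of r] r by simp
    finally show "cnt r w \<le> C + ln 2 + ln (max 1 (norm w)) - ln (norm w)" by simp
  qed
qed

text \<open>The Nevanlinna counting function of \<open>f\<close>; the zeros of \<open>f - w\<close> are simple because \<open>f\<close> is a
  covering. It turns out to be the Green function of \<open>D\<close> with pole at \<open>0\<close>. (At the pole the
  value is irrelevant: there the sum has the junk summand \<open>- ln 0 = 0\<close>.)\<close>

definition green :: "complex \<Rightarrow> real" where
  "green w = (\<Sum>\<^sub>\<infinity>z\<in>{z \<in> ball 0 1. f z = w}. - ln (norm z))"

lemma ln_norm_disc: "z \<in> ball 0 1 \<Longrightarrow> 0 \<le> - ln (norm (z::complex))"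
  by (cases "z = 0") auto

text \<open>For r close to 1 the finite set F lies in the closed disc of radius r, so its share of
  \<open>cnt r w\<close> is at most B; then r tends to 1.\<close>

lemma finite_sum_le_of_cnt_le:
  assumes w: "w \<noteq> 0" and B: "\<And>r. 0 < r \<Longrightarrow> r < 1 \<Longrightarrow> cnt r w \<le> B"
    and F: "finite F" "F \<subseteq> {z \<in> ball 0 1. f z = w}"
  shows "(\<Sum>z\<in>F. - ln (norm z)) \<le> B"
proof -
  have nz: "z \<noteq> 0" if "z \<in> F" for z using that F(2) w f0 by auto
  have "((\<lambda>r. \<Sum>z\<in>F. ln (r / norm z)) \<longlongrightarrow> (\<Sum>z\<in>F. ln (1 / norm z))) (at_left 1)"
    using nz by (intro tendsto_intros) auto
  moreover have "\<forall>\<^sub>F r in at_left 1. (\<Sum>z\<in>F. ln (r / norm z)) \<le> B"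
  proof -
    \<comment> \<open>The entry 1/2 keeps the maximum defined for empty F and the radii
      positive.\<close>
    define s where "s = Max (insert (1/2) (norm ` F))"
    have fin: "finite (insert (1/2) (norm ` F))" using F by simp
    have s: "s < 1" "1/2 \<le> s" "\<And>z. z \<in> F \<Longrightarrow> norm z \<le> s"
      unfolding s_def using F Max_ge[OF fin, of "1/2"] Max_ge[OF fin] by (auto simp: Max_less_iff[OF fin])
    have "\<forall>\<^sub>F r in at_left 1. r \<in> {s<..<1}"
      using s(1) by (rule eventually_at_left_real)
    then show ?thesis
    proof eventually_elim
      case (elim r)
      then have r: "0 < r" "r < 1" using s by auto
      have "(\<Sum>z\<in>F. ln (r / norm z)) \<le> cnt r w"
        unfolding cnt_def
      proof (rule sum_mono2)
        show "F \<subseteq> {z \<in> cball 0 r. f z = w}" using F(2) s(3) elim by force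
        show "finite {z \<in> cball 0 r. f z = w}" by (rule finite_preimage[OF r(2)])
        fix b assume "b \<in> {z \<in> cball 0 r. f z = w} - F"
        then show "0 \<le> ln (r / norm b)"
          using r by (cases "b = 0") (auto intro!: ln_ge_zero simp: divide_simps)
      qed
      also have "\<dots> \<le> B" by (rule B[OF r])
      finally show ?case .
    qed
  qed
  ultimately have "(\<Sum>z\<in>F. ln (1 / norm z)) \<le> B"
    by (rule tendsto_upperbound) simp
  moreover have "(\<Sum>z\<in>F. ln (1 / norm z)) = (\<Sum>z\<in>F. - ln (norm z))"
    using nz by (intro sum.cong) (auto simp: ln_div)
  ultimately show ?thesis by simp
qed

lemma green_summable:
  assumes w: "w \<noteq> 0"
  shows "(\<lambda>z. - ln (norm z)) summable_on {z \<in> ball 0 1. f z = w}"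
proof -
  obtain C where C: "\<And>r w. 0 < r \<Longrightarrow> r < 1 \<Longrightarrow> w \<noteq> 0 \<Longrightarrow> cnt r w \<le> C + ln (max 1 (norm w)) - ln (norm w)"
    using cnt_bounded by blast
  show ?thesis
  proof (rule nonneg_bdd_above_summable_on)
    show "bdd_above (sum (\<lambda>z. - ln (norm z)) ` {F. F \<subseteq> {z \<in> ball 0 1. f z = w} \<and> finite F})"
      using finite_sum_le_of_cnt_le[OF w] C[OF _ _ w]
      by (intro bdd_aboveI2[where M="C + ln (max 1 (norm w)) - ln (norm w)"]) auto
  qed (use ln_norm_disc in auto)
qed

lemma green_le_of_cnt_le:
  assumes "w \<noteq> 0" "\<And>r. 0 < r \<Longrightarrow> r < 1 \<Longrightarrow> cnt r w \<le> B"
  shows "green w \<le> B"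
  unfolding green_def using finite_sum_le_of_cnt_le[OF assms]
  by (intro infsum_le_finite_sums green_summable assms) auto

lemma green_nonneg: "0 \<le> green w"
  unfolding green_def by (intro infsum_nonneg ln_norm_disc) auto

lemma green_outside: "w \<notin> D \<Longrightarrow> green w = 0"
proof -
  assume "w \<notin> D"
  then have "{z \<in> ball 0 1. f z = w} = {}" using f_in_D by force
  then show ?thesis unfolding green_def by (metis infsum_empty)
qed

lemma cnt_le_green:
  assumes "0 < r" "r < 1" "w \<noteq> 0"
  shows "cnt r w \<le> green w"
proof -
  have "cnt r w \<le> (\<Sum>z\<in>{z \<in> cball 0 r. f z = w}. - ln (norm z))"
    unfolding cnt_def
  proof (rule sum_mono)
    fix z assume "z \<in> {z \<in> cball 0 r. f z = w}"
    then have "z \<noteq> 0" using assms f0 by auto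
    then show "ln (r / norm z) \<le> - ln (norm z)"
      using assms by (simp add: ln_div)
  qed
  also have "\<dots> \<le> green w"
    unfolding green_def using assms ln_norm_disc
    by (intro finite_sum_le_infsum green_summable finite_preimage) auto
  finally show ?thesis .
qed

lemma cnt_tendsto_green:
  assumes w: "w \<noteq> 0" and r: "\<And>n. 0 < r n" "\<And>n. r n < 1" "r \<longlonglongrightarrow> 1"
  shows "(\<lambda>n. cnt (r n) w) \<longlonglongrightarrow> green w"
proof (rule order_tendstoI)
  fix a assume a: "a < green w"
  have "\<exists>s. 0 < s \<and> s < 1 \<and> a < cnt s w"
    using green_le_of_cnt_le[OF w, of a] a by (metis not_le)
  then obtain s where s: "0 < s" "s < 1" "a < cnt s w" by blast
  have "\<forall>\<^sub>F n in sequentially. s < r n" using r(3) s(2) by (rule order_tendstoD)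
  then show "\<forall>\<^sub>F n in sequentially. a < cnt (r n) w"
  proof eventually_elim
    case (elim n)
    have "cnt s w \<le> cnt (r n) w" using elim s r w by (intro cnt_mono) auto
    with s show ?case by simp
  qed
next
  fix a assume "green w < a"
  then show "\<forall>\<^sub>F n in sequentially. cnt (r n) w < a"
    using le_less_trans[OF cnt_le_green[OF r(1,2) w]] by (simp add: always_eventually)
qed

lemma green_upper_bound:
  obtains C where "\<And>w::complex. w \<noteq> 0 \<Longrightarrow> green w \<le> C + ln (max 1 (norm w)) - ln (norm w)"
proof -
  obtain C where C: "\<And>r w. 0 < r \<Longrightarrow> r < 1 \<Longrightarrow> w \<noteq> 0 \<Longrightarrow> cnt r w \<le> C + ln (max 1 (norm w)) - ln (norm w)"
    using cnt_bounded by blast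
  show thesis by (rule that[of C], rule green_le_of_cnt_le) (use C in auto)
qed

lemma green_bounded_off_0:
  assumes "0 < r"
  shows "bounded (green ` (- ball 0 r))"
proof -
  obtain C where C: "\<And>w. w \<noteq> 0 \<Longrightarrow> green w \<le> C + ln (max 1 (norm w)) - ln (norm w)"
    using green_upper_bound by blast
  have "norm (green w) \<le> \<bar>C\<bar> + \<bar>ln r\<bar>" if "w \<in> - ball 0 r" for w
  proof -
    have w: "norm w \<ge> r" "w \<noteq> 0" using that assms by auto
    have "ln (max 1 (norm w)) - ln (norm w) \<le> \<bar>ln r\<bar>"
    proof (cases "norm w \<le> 1")
      case True
      moreover have "ln r \<le> ln (norm w)" using w assms by simp
      moreover have "ln (max 1 (norm w)) = 0" using True by (simp add: max_absorb1)
      ultimately show ?thesis by linarith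
    qed (simp add: max_def)
    then show ?thesis using C[OF w(2)] green_nonneg[of w] by simp
  qed
  then show ?thesis unfolding bounded_iff by blast
qed

lemma green_measurable [measurable]: "green \<in> borel_measurable borel"
proof (rule borel_measurable_LIMSEQ_real)
  define r where "r n = 1 - 1 / (real n + 2)" for n :: nat
  have r: "0 < r n" "r n < 1" for n by (auto simp: r_def field_simps)
  have r1: "r \<longlonglongrightarrow> 1" unfolding r_def by real_asymp
  show "(\<lambda>w. if w = 0 then green 0 else cnt (r n) w) \<in> borel_measurable borel" for n
    using cnt_measurable[OF r[of n]] by measurable
  show "(\<lambda>n. if w = 0 then green 0 else cnt (r n) w) \<longlonglongrightarrow> green w" for w
    using cnt_tendsto_green[OF _ r r1, of w] by (cases "w = 0") auto
qed

text \<open>The upper bound is \<open>green_upper_bound\<close>. For the lower one a single summand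
  suffices: the local inverse g of f at 0 satisfies |g w| < A |w|, so -ln |g w| is at least -ln |w|
  - ln A.\<close>

lemma green_near_0:
  obtains r where "r > 0" "bounded ((\<lambda>w. green w + ln (norm w)) ` (ball 0 r - {0}))"
proof -
  obtain C where C: "\<And>w. w \<noteq> 0 \<Longrightarrow> green w \<le> C + ln (max 1 (norm w)) - ln (norm w)"
    using green_upper_bound by blast
  have "(0::complex) \<in> ball 0 1" "deriv f 0 \<noteq> 0" using deriv_nonzero[of 0] by auto
  then obtain s where s: "s > 0" "ball (0::complex) s \<subseteq> ball 0 1" "inj_on f (ball 0 s)"
    by (rule has_complex_derivative_locally_injective[OF hol _ open_ball]) (rule that)
  have hs: "f holomorphic_on ball 0 s" using hol s(2) holomorphic_on_subset by blast
  obtain g where g: "g holomorphic_on f ` ball 0 s" "\<And>z. z \<in> ball 0 s \<Longrightarrow> g (f z) = z"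
    using holomorphic_has_inverse[OF hs open_ball s(3)] by metis
  have op: "open (f ` ball 0 s)" by (rule open_mapping_thm3[OF hs open_ball s(3)])
  have 0: "0 \<in> f ` ball 0 s" using f0 s(1) by (metis centre_in_ball image_eqI)
  have g0: "g 0 = 0" using g(2)[of 0] f0 s(1) by simp
  have "(g has_field_derivative deriv g 0) (at 0)"
    using holomorphic_derivI[OF g(1) op 0] .
  then have lim: "((\<lambda>w. (g w - g 0) / (w - 0)) \<longlongrightarrow> deriv g 0) (at 0)"
    by (simp add: has_field_derivative_iff)
  define A where "A = norm (deriv g 0) + 1"
  have A: "A \<ge> 1" by (simp add: A_def)
  have "\<forall>\<^sub>F w in at 0. norm ((g w - g 0) / (w - 0)) < A"
    by (rule order_tendstoD(2)[OF tendsto_norm[OF lim]]) (simp add: A_def)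
  moreover have "\<forall>\<^sub>F w in at 0. w \<in> f ` ball 0 s" 
    using eventually_at_topological op 0 by blast
  ultimately have "\<forall>\<^sub>F w in at 0. norm ((g w - g 0) / (w - 0)) < A \<and> w \<in> f ` ball 0 s"
    by (rule eventually_conj)
  then obtain d where d: "d > 0"
    "\<And>w. w \<noteq> 0 \<Longrightarrow> dist w 0 < d \<Longrightarrow> norm ((g w - g 0) / (w - 0)) < A \<and> w \<in> f ` ball 0 s"
    unfolding eventually_at by auto
  have "norm (green w + ln (norm w)) \<le> \<bar>C\<bar> + ln A" if w: "w \<in> ball 0 (min d 1) - {0}" for w
  proof -
    have w0: "w \<noteq> 0" "norm w < 1" "norm w < d" using w by auto
    from d(2)[of w] w0 have gA: "norm (g w) < A * norm w" and "w \<in> f ` ball 0 s"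
      by (auto simp: g0 norm_divide field_simps)
    then obtain z where z: "z \<in> ball 0 s" "f z = w" by auto
    then have gz: "g w = z" using g(2) by auto
    have z0: "z \<noteq> 0" using z(2) f0 w0 by auto
    have "(\<Sum>y\<in>{z}. - ln (norm y)) \<le> green w"
      unfolding green_def using w0 z s(2) ln_norm_disc
      by (intro finite_sum_le_infsum green_summable) auto
    moreover have "ln (norm z) \<le> ln (A * norm w)" using gA gz z0 A w0 by (subst ln_le_cancel_iff) auto
    ultimately have "green w \<ge> - ln A - ln (norm w)" using A w0 by (simp add: ln_mult)
    moreover have "green w + ln (norm w) \<le> C" using C[OF w0(1)] w0(2) by (simp add: max_def)
    moreover have "ln A \<ge> 0" using A by simp
    ultimately show ?thesis unfolding real_norm_def by linarith
  qed
  then have "bounded ((\<lambda>w. green w + ln (norm w)) ` (ball 0 (min d 1) - {0}))"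
    unfolding bounded_iff by blast
  with d(1) show thesis
    by (intro that[of "min d 1"]) auto
qed

end

section \<open>Harmonicity and boundary behaviour of the counting function\<close>

text \<open>A Harnack inequality for the holomorphic completion itself. The Cayley transform (g - c)
  / (g + c) maps into the unit disc and sends the centre to 0, so by the Schwarz lemma it is at most
  1/2 on the half disc; 3 is (1 + 1/2) / (1 - 1/2).\<close>

lemma norm_le_of_positive_real_part:
  assumes g: "g holomorphic_on ball a r" "0 < r" and pos: "\<And>z. z \<in> ball a r \<Longrightarrow> 0 < Re (g z)"
    and im: "Im (g a) = 0" and y: "norm (y - a) \<le> r / 2"
  shows "norm (g y) \<le> 3 * Re (g a)"
proof -
  define c where "c = Re (g a)"
  have ga: "g a = of_real c" using im by (simp add: c_def complex_eq_iff)
  have c: "c > 0" using pos[of a] g(2) by (simp add: c_def)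
  define F where "F z = (g (a + of_real r * z) - of_real c) / (g (a + of_real r * z) + of_real c)" for z
  have in_ball: "a + of_real r * z \<in> ball a r" if "norm z < 1" for z
    using that g(2) by (simp add: dist_norm norm_mult)
  have nz: "g (a + of_real r * z) + of_real c \<noteq> 0" if "norm z < 1" for z
    using pos[OF in_ball[OF that]] c by (auto simp: complex_eq_iff)
  have "(\<lambda>z. g (a + of_real r * z)) holomorphic_on ball 0 1"
  proof -
    have "(g \<circ> (\<lambda>z. a + of_real r * z)) holomorphic_on ball 0 1"
      by (rule holomorphic_on_compose_gen[OF _ g(1)]) (use in_ball in \<open>auto intro!: holomorphic_intros\<close>)
    then show ?thesis by (simp add: o_def)
  qed
  then have F: "F holomorphic_on ball 0 1"
    unfolding F_def using nz by (intro holomorphic_intros) auto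
  have F0: "F 0 = 0" by (simp add: F_def ga)
  have F1: "norm (F z) < 1" if "norm z < 1" for z
  proof -
    define h where "h = g (a + of_real r * z)"
    have h: "Re h > 0" using pos[OF in_ball[OF that]] by (simp add: h_def)
    have "(norm (h - of_real c))\<^sup>2 < (norm (h + of_real c))\<^sup>2"
      unfolding cmod_power2 using h c by (simp add: power2_eq_square algebra_simps)
    then have "norm (h - of_real c) < norm (h + of_real c)"
      by (rule power2_less_imp_less) simp
    then show ?thesis using nz[OF that] by (simp add: F_def h_def norm_divide)
  qed
  define z where "z = (y - a) / r"
  have z: "norm z \<le> 1/2" using y g(2) by (simp add: z_def norm_divide divide_simps)
  have yz: "y = a + of_real r * z" using g(2) by (simp add: z_def)
  have Fz: "norm (F z) \<le> 1/2"
    using Schwarz_Lemma(1)[OF F F0 F1, of z] z by auto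
  have "g y * (1 - F z) = of_real c * (1 + F z)"
    using nz[of z] z by (simp add: F_def yz field_simps)
  then have "norm (g y) * norm (1 - F z) = c * norm (1 + F z)"
    using c by (metis abs_of_pos norm_mult norm_of_real)
  moreover have "norm (1 - F z) \<ge> 1/2"
    using norm_triangle_ineq2[of 1 "F z"] Fz by simp
  moreover have "norm (1 + F z) \<le> 3/2"
    using norm_triangle_ineq[of 1 "F z"] Fz by simp
  ultimately have "norm (g y) * (1/2) \<le> c * (3/2)"
    by (metis (no_types, opaque_lifting) c less_eq_real_def mult_left_mono norm_ge_zero order_trans)
  then show ?thesis by (simp add: c_def)
qed

text \<open>A fixed sequence of radii, at least 1/2 and increasing to 1, so that Fatou and dominated
  convergence apply to limits in the radius.\<close>

definition rad :: "nat \<Rightarrow> real" where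
  "rad n = 1 - 1 / (real n + 2)"

lemma rad: "0 < rad n" "rad n < 1" "0 \<le> rad n"
  by (auto simp: rad_def field_simps)

lemma rad_mono: "rad n \<le> rad (Suc n)"
  by (auto simp: rad_def field_simps)

lemma rad_tendsto: "rad \<longlonglongrightarrow> 1"
  unfolding rad_def by real_asymp

lemma ln_max_lipschitz:
  fixes a b e :: real
  assumes "e > 0"
  shows "ln (max a e) \<le> ln (max b e) + \<bar>a - b\<bar> / e"
proof -
  have p: "max a e > 0" "max b e > 0" using assms by auto
  have "ln (max a e) - ln (max b e) = ln (max a e / max b e)" using p by (simp add: ln_div)
  also have "\<dots> \<le> max a e / max b e - 1" using p by (intro ln_le_minus_one) auto
  also have "\<dots> = (max a e - max b e) / max b e" using p by (simp add: field_simps)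
  also have "\<dots> \<le> \<bar>a - b\<bar> / max b e" using p by (intro divide_right_mono) auto
  also have "\<dots> \<le> \<bar>a - b\<bar> / e" using assms by (intro divide_left_mono) auto
  finally show ?thesis by simp
qed

context greenian_covering
begin

text \<open>Over an evenly covered neighbourhood the solutions of f z = y are the values at y of one
  inverse branch q per sheet. Each summand -ln |q| is the real part of a holomorphic function, made
  real at w by an imaginary constant.\<close>

lemma green_harmonic: "harmonic_on green (D - {0})"
proof (rule harmonic_onI)
  show "open (D - {0})" using openD by auto
  fix w assume w: "w \<in> D - {0}"
  then obtain T \<V> where T: "w \<in> T" "openin (top_of_set D) T" "\<Union>\<V> = ball 0 1 \<inter> f -` T"
      "\<And>W. W \<in> \<V> \<Longrightarrow> openin (top_of_set (ball 0 1)) W" "pairwise disjnt \<V>"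
      "\<And>W. W \<in> \<V> \<Longrightarrow> \<exists>q. homeomorphism W T f q"
    using cov unfolding covering_space_def by (metis DiffD1)
  have opT: "open T" "T \<subseteq> D" using T(2) openD by (auto simp: openin_open)
  then have "open (T - {0})" "w \<in> T - {0}" using T(1) w by auto
  then obtain r where r: "r > 0" "ball w r \<subseteq> T - {0}" using open_contains_ball by blast
  have "\<exists>q. q holomorphic_on T \<and> (\<forall>y\<in>T. q y \<in> W \<and> f (q y) = y)" if W: "W \<in> \<V>" for W
  proof -
    obtain q where q: "homeomorphism W T f q" using T(6)[OF W] by blast
    have "open W" "W \<subseteq> ball 0 1" using T(4)[OF W] by (auto simp: openin_open)
    then have hW: "f holomorphic_on W" using hol holomorphic_on_subset by blast
    have "inj_on f W" using q by (metis homeomorphism_def inj_on_inverseI)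
    from holomorphic_has_inverse[OF hW \<open>open W\<close> this]
    obtain g where g: "g holomorphic_on f ` W" "\<And>z. z \<in> W \<Longrightarrow> g (f z) = z" by metis
    have "f ` W = T" using q by (simp add: homeomorphism_def)
    then show ?thesis using g by (intro exI[of _ g]) auto
  qed
  then obtain q where q: "\<And>W. W \<in> \<V> \<Longrightarrow> q W holomorphic_on T"
    "\<And>W y. W \<in> \<V> \<Longrightarrow> y \<in> T \<Longrightarrow> q W y \<in> W" "\<And>W y. W \<in> \<V> \<Longrightarrow> y \<in> T \<Longrightarrow> f (q W y) = y"
    by metis
  have disc: "W \<subseteq> ball 0 1" if "W \<in> \<V>" for W using T(4)[OF that] by (auto simp: openin_open)
  have qn: "norm (q W y) < 1" if "W \<in> \<V>" "y \<in> T" for W y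
    using q(2)[OF that] disc[OF that(1)] by auto
  have qnz: "q W y \<noteq> 0" if "W \<in> \<V>" "y \<in> ball w r" for W y
    using q(3)[of W y] that r(2) f0 by auto
  have bij: "bij_betw (\<lambda>W. q W y) \<V> {z \<in> ball 0 1. f z = y}" if y: "y \<in> T" for y
    unfolding bij_betw_def
  proof
    show "inj_on (\<lambda>W. q W y) \<V>"
    proof (rule inj_onI)
      fix W W' assume "W \<in> \<V>" "W' \<in> \<V>" "q W y = q W' y"
      then show "W = W'" using q(2)[of W y] q(2)[of W' y] y T(5) unfolding pairwise_def disjnt_def by auto
    qed
    show "(\<lambda>W. q W y) ` \<V> = {z \<in> ball 0 1. f z = y}"
    proof (intro equalityI subsetI)
      fix z assume z: "z \<in> {z \<in> ball 0 1. f z = y}"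
      then have "z \<in> \<Union>\<V>" using T(3) y by auto
      then obtain W where W: "W \<in> \<V>" "z \<in> W" by blast
      obtain p where "homeomorphism W T f p" using T(6)[OF W(1)] by blast
      then have "inj_on f W" by (metis homeomorphism_def inj_on_inverseI)
      then have "q W y = z" using q(2,3)[OF W(1) y] W(2) z by (auto dest: inj_onD)
      then show "z \<in> (\<lambda>W. q W y) ` \<V>" using W(1) by blast
    qed (use qn q(3) y in auto)
  qed
  have "\<exists>k. k holomorphic_on ball w r \<and> Im (k w) = 0 \<and> (\<forall>y\<in>ball w r. Re (k y) = - ln (norm (q W y)))"
    if W: "W \<in> \<V>" for W
  proof -
    have "q W holomorphic_on ball w r" using q(1)[OF W] r(2) by (auto intro: holomorphic_on_subset)
    then obtain h where h: "h holomorphic_on ball w r" "\<And>y. y \<in> ball w r \<Longrightarrow> exp (h y) = q W y"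
      using holomorphic_logarithm_exists[of "ball w r" "q W" w] qnz[OF W] r(1) by auto
    have "Re (- (h y - \<i> * Im (h w))) = - ln (norm (q W y))" if "y \<in> ball w r" for y
    proof -
      have "norm (q W y) = exp (Re (h y))" using h(2)[OF that] by (metis norm_exp_eq_Re)
      then show ?thesis by simp
    qed
    moreover have "(\<lambda>y. - (h y - \<i> * Im (h w))) holomorphic_on ball w r"
      using h(1) by (intro holomorphic_intros)
    ultimately show ?thesis
      by (intro exI[of _ "\<lambda>y. - (h y - \<i> * Im (h w))"]) auto
  qed
  then obtain k where k: "\<And>W. W \<in> \<V> \<Longrightarrow> k W holomorphic_on ball w r" "\<And>W. W \<in> \<V> \<Longrightarrow> Im (k W w) = 0"
    "\<And>W y. W \<in> \<V> \<Longrightarrow> y \<in> ball w r \<Longrightarrow> Re (k W y) = - ln (norm (q W y))"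
    by metis
  have kpos: "Re (k W y) > 0" if "W \<in> \<V>" "y \<in> ball w r" for W y
    using k(3)[OF that] qn[OF that(1), of y] qnz[OF that] that r(2) by auto
  have sumg: "green y = (\<Sum>\<^sub>\<infinity>W\<in>\<V>. Re (k W y)) \<and> (\<lambda>W. Re (k W y)) summable_on \<V>" if y: "y \<in> ball w r" for y
  proof -
    have "y \<in> T" "y \<noteq> 0" using y r(2) by blast+
    have eq: "(\<Sum>\<^sub>\<infinity>W\<in>\<V>. - ln (norm (q W y))) = (\<Sum>\<^sub>\<infinity>W\<in>\<V>. Re (k W y))"
      "(\<lambda>W. - ln (norm (q W y))) summable_on \<V> \<longleftrightarrow> (\<lambda>W. Re (k W y)) summable_on \<V>"
      using k(3)[OF _ y] by (auto intro!: infsum_cong summable_on_cong)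
    show ?thesis
      using infsum_reindex_bij_betw[OF bij[OF \<open>y \<in> T\<close>], of "\<lambda>z. - ln (norm z)"]
        summable_on_reindex_bij_betw[OF bij[OF \<open>y \<in> T\<close>], of "\<lambda>z. - ln (norm z)"] green_summable[OF \<open>y \<noteq> 0\<close>]
      unfolding green_def eq by simp
  qed
  \<comment> \<open>Harnack's inequality turns summability at the single point w into a majorant
    that is uniform on the half disc, which is what the Weierstrass test requires.\<close>
  have bound: "norm (k W y) \<le> 3 * Re (k W w)" if "W \<in> \<V>" "y \<in> cball w (r/2)" for W y
    using that r(1) by (intro norm_le_of_positive_real_part[OF k(1) _ kpos k(2)])
      (auto simp: dist_norm norm_minus_commute)
  have sM: "(\<lambda>W. 3 * Re (k W w)) summable_on \<V>"
    using sumg[of w] r(1) by (intro summable_on_cmult_right) auto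
  let ?K = "\<lambda>y. \<Sum>\<^sub>\<infinity>W\<in>\<V>. k W y"
  have ul: "uniform_limit (cball w (r/2)) (\<lambda>X y. \<Sum>W\<in>X. k W y) ?K (finite_subsets_at_top \<V>)"
    by (rule Weierstrass_m_test_general[OF bound sM])
  have sub: "cball w (r/2) \<subseteq> ball w r" "ball w (r/2) \<subseteq> ball w r" using r(1) by auto
  have ev: "\<forall>\<^sub>F X in finite_subsets_at_top \<V>. continuous_on (cball w (r/2)) (\<lambda>y. \<Sum>W\<in>X. k W y) \<and>
    (\<lambda>y. \<Sum>W\<in>X. k W y) holomorphic_on ball w (r/2)"
  proof (rule eventually_finite_subsets_at_top_weakI, intro conjI)
    fix X assume "finite X" "X \<subseteq> \<V>"
    then have h: "(\<lambda>y. \<Sum>W\<in>X. k W y) holomorphic_on ball w r"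
      using k(1) by (intro holomorphic_intros) auto
    then show "(\<lambda>y. \<Sum>W\<in>X. k W y) holomorphic_on ball w (r/2)" using sub(2) by (rule holomorphic_on_subset)
    show "continuous_on (cball w (r/2)) (\<lambda>y. \<Sum>W\<in>X. k W y)"
      using h sub(1) by (meson holomorphic_on_imp_continuous_on holomorphic_on_subset)
  qed
  have "?K holomorphic_on ball w (r/2)"
    by (rule holomorphic_uniform_limit[OF ev ul]) auto
  moreover have "green y = Re (?K y)" if y: "y \<in> ball w (r/2)" for y
  proof -
    have "(\<lambda>W. norm (k W y)) summable_on \<V>"
    proof (rule summable_on_comparison_test[OF sM])
      show "norm (k W y) \<le> 3 * Re (k W w)" if "W \<in> \<V>" for W
        by (rule bound[OF that]) (use y in auto)
    qed auto
    then have "(\<lambda>W. k W y) summable_on \<V>" by (rule abs_summable_summable)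
    then have "((\<lambda>W. k W y) has_sum ?K y) \<V>" by (rule has_sum_infsum)
    from has_sum_bounded_linear[OF bounded_linear_Re this]
    have "((\<lambda>W. Re (k W y)) has_sum Re (?K y)) \<V>" by (simp add: o_def)
    then have "(\<Sum>\<^sub>\<infinity>W\<in>\<V>. Re (k W y)) = Re (?K y)" by (rule infsumI)
    moreover have "y \<in> ball w r" using y sub(2) by blast
    ultimately show ?thesis using sumg by simp
  qed
  ultimately show "\<exists>r>0. ball w r \<subseteq> D - {0} \<and> (\<exists>g. g holomorphic_on ball w r \<and> (\<forall>y\<in>ball w r. green y =
    Re (g y)))"
    using r sub(2) opT(2) by (intro exI[of _ "r/2"] conjI exI[of _ ?K]) auto
qed

text \<open>Cartan's formula bounds the truncated mean by the mean of \<open>green\<close> over the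
  circle of radius e around w, which harmonicity evaluates as \<open>green w\<close>. The right side
  tends to 0 as r tends to 1; this will keep boundary values out of \<open>ball w e\<close>.\<close>

lemma mean_near_interior:
  assumes w: "w \<in> D" "w \<noteq> 0"
  obtains e where "e > 0" "ball w e \<subseteq> D" "\<And>r. 0 < r \<Longrightarrow> r < 1 \<Longrightarrow>
    (LINT t|unif01. ln (max (norm (f (circ r t) - w)) e) - ln (norm (f (circ r t) - w))) \<le> green w - cnt r w"
proof -
  obtain s g where s: "s > 0" "ball w s \<subseteq> D - {0}" "g holomorphic_on ball w s"
    "\<And>y. y \<in> ball w s \<Longrightarrow> green y = Re (g y)"
    using harmonic_onE[OF green_harmonic, of w] w by blast
  define e where "e = min s (norm w) / 2"
  have e: "0 < e" "e < s" "e < norm w" using s(1) w by (auto simp: e_def min_def)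
  show thesis
  proof (rule that[OF e(1)])
    show "ball w e \<subseteq> D" using s(2) e by (auto simp: subset_iff)
    fix r :: real assume r: "0 < r" "r < 1"
    have in_b: "w + circ e t \<in> ball w s" for t using e by (simp add: dist_norm norm_mult)
    have "(LINT t|unif01. cnt r (w + circ e t)) \<le> (LINT t|unif01. Re (g (w + circ e t)))"
    proof (rule integral_mono[OF cartan(2)[OF r e(1)]])
      show "integrable unif01 (\<lambda>t. Re (g (w + circ e t)))"
        using circle_mean_Re(2)[OF s(3), of e] e by simp
      show "cnt r (w + circ e t) \<le> Re (g (w + circ e t))" for t
      proof -
        have "w + circ e t \<noteq> 0" using s(2) in_b[of t] by blast
        with cnt_le_green[OF r this] s(4)[OF in_b[of t]] show ?thesis by simp
      qed
    qed
    also have "\<dots> = green w" using circle_mean_Re(1)[OF s(3), of e] e s(4)[of w] s(1) by simp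
    finally have "(LINT t|unif01. ln (max (norm (f (circ r t) - w)) e)) \<le> ln (norm w) + green w"
      using cartan(3)[OF r e(1), of w] e(3) by (simp add: max_def)
    then show "(LINT t|unif01. ln (max (norm (f (circ r t) - w)) e) - ln (norm (f (circ r t) - w))) \<le>
      green w - cnt r w"
      using cartan(1)[OF r e(1), of w] jensen[OF r w(2)] by simp
  qed
qed

text \<open>The mean of log^+ (e / |f - z|), a Nevanlinna proximity function at scale e. The
  difference form lets Cartan's and Jensen's formulas evaluate the two parts.\<close>

definition proximity :: "real \<Rightarrow> nat \<Rightarrow> complex \<Rightarrow> real" where
  "proximity e n z = (LINT t|unif01. ln (max (norm (f (circ (rad n) t) - z)) e) -
     ln (norm (f (circ (rad n) t) - z)))"

lemma proximity_eq:
  assumes "z \<notin> D" "e > 0"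
  shows "(LINT t|unif01. ln (max (norm (f (circ (rad n) t) - z)) e)) = ln (norm z) + proximity e n z"
proof -
  have "z \<noteq> 0" using assms zero_in_D by auto
  then show ?thesis
    unfolding proximity_def using jensen[OF rad(1,2)[of n], of z] cnt_outside[OF assms(1) rad(2)]
      cartan(1)[OF rad(1,2)[of n] assms(2)]
    by (subst Bochner_Integration.integral_diff) auto
qed

text \<open>As f never takes the value z, the truncated mean at z is ln |z| plus the proximity. The
  truncated logarithm is Lipschitz in the centre with constant 1/e, so Jensen's formula at w bounds
  the counting function there.\<close>

lemma green_le_proximity:
  assumes z: "z \<notin> D" and e: "e > 0" and w: "w \<noteq> 0" and L: "\<And>n. proximity e n z \<le> L"
  shows "green w \<le> ln (norm z) - ln (norm w) + L + norm (w - z) / e"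
proof (rule LIMSEQ_le_const2[OF cnt_tendsto_green[OF w rad(1,2) rad_tendsto]], intro exI allI impI)
  fix n
  note r = rad(1,2)[of n]
  have "ln (norm w) + cnt (rad n) w = (LINT t|unif01. ln (norm (f (circ (rad n) t) - w)))"
    using jensen(2)[OF r w] by simp
  also have "\<dots> \<le> (LINT t|unif01. ln (max (norm (f (circ (rad n) t) - z)) e) + norm (w - z) / e)"
  proof (rule integral_mono_AE[OF jensen(1)[OF r w]])
    show "integrable unif01 (\<lambda>t. ln (max (norm (f (circ (rad n) t) - z)) e) + norm (w - z) / e)"
      using cartan(1)[OF r e] by simp
    show "AE t in unif01. ln (norm (f (circ (rad n) t) - w)) \<le>
      ln (max (norm (f (circ (rad n) t) - z)) e) + norm (w - z) / e"
    proof -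
      have "AE t in unif01. f (circ (rad n) t) \<noteq> w" by (rule AE_f_circle_neq[OF r])
      then show ?thesis
      proof eventually_elim
        case (elim t)
        let ?x = "f (circ (rad n) t)"
        have "ln (norm (?x - w)) \<le> ln (max (norm (?x - w)) e)"
          using elim by (subst ln_le_cancel_iff) (auto simp: less_max_iff_disj)
        also have "\<dots> \<le> ln (max (norm (?x - z)) e) + \<bar>norm (?x - w) - norm (?x - z)\<bar> / e"
          by (rule ln_max_lipschitz[OF e])
        also have "\<bar>norm (?x - w) - norm (?x - z)\<bar> \<le> norm (w - z)"
          using norm_triangle_ineq3[of "?x - w" "?x - z"] by (simp add: norm_minus_commute)
        finally show ?case using e by (simp add: divide_right_mono)
      qed
    qed
  qed
  also have "\<dots> = ln (norm z) + proximity e n z + norm (w - z) / e"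
    using cartan(1)[OF r e] proximity_eq[OF z e] by simp
  also have "\<dots> \<le> ln (norm z) + L + norm (w - z) / e" using L[of n] by simp
  finally show "cnt (rad n) w \<le> ln (norm z) - ln (norm w) + L + norm (w - z) / e" by simp
qed

text \<open>A regularity criterion for boundary points: a scale e is fixed for which the proximity
  is at most h / 2, and then w tends to z in \<open>green_le_proximity\<close>.\<close>

lemma green_tendsto_boundary:
  assumes z: "z \<notin> D" and small: "\<And>h. h > 0 \<Longrightarrow> \<exists>e>0. \<forall>n. proximity e n z \<le> h"
  shows "(green \<longlongrightarrow> 0) (at z within D)"
proof (rule tendstoI)
  fix h :: real assume h: "h > 0"
  obtain e where e: "e > 0" "\<And>n. proximity e n z \<le> h / 2" using small[of "h/2"] h by auto
  have z0: "z \<noteq> 0" using z zero_in_D by auto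
  have "((\<lambda>w. ln (norm z) - ln (norm w) + h / 2 + norm (w - z) / e) \<longlongrightarrow> ln (norm z) - ln (norm z) + h / 2 +
    norm (z - z) / e) (at z within D)"
    using z0 e(1) by (intro tendsto_intros) auto
  then have "\<forall>\<^sub>F w in at z within D. ln (norm z) - ln (norm w) + h / 2 + norm (w - z) / e < h"
    by (rule order_tendstoD(2)) (use h in auto)
  moreover have "\<forall>\<^sub>F w in at z within D. w \<noteq> 0"
    using z0 eventually_neq_at_within[of 0 z D] t1_space_nhds[of z 0]
      by (auto simp: eventually_at_filter elim!: eventually_mono)
  ultimately show "\<forall>\<^sub>F w in at z within D. dist (green w) 0 < h"
  proof eventually_elim
    case (elim w)
    then show ?case using green_le_proximity[OF z e(1) _ e(2), of w] green_nonneg[of w] by simp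
  qed
qed

lemma proximity_measurable [measurable]: "proximity e n \<in> borel_measurable borel"
proof -
  have [measurable]: "(\<lambda>t. f (circ (rad n) t)) \<in> borel_measurable unif01"
    using rad by (intro measurable_f_circle) auto
  show ?thesis unfolding proximity_def by measurable
qed

lemma proximity_mono:
  assumes "z \<notin> D" "e > 0"
  shows "proximity e n z \<le> proximity e (Suc n) z"
  using cartan_mono[OF rad(1)[of n] rad_mono rad(2) assms(2), of z]
  unfolding proximity_eq[OF assms] by simp

lemma ennreal_proximity_le:
  assumes "z \<notin> D" "e > 0"
  shows "ennreal (proximity e n z) \<le> (\<integral>\<^sup>+ t. log_kernel e (f (circ (rad n) t)) z \<partial>unif01)"
proof -
  have z0: "z \<noteq> 0" using assms zero_in_D by auto
  let ?g = "\<lambda>t. ln (max (norm (f (circ (rad n) t) - z)) e) - ln (norm (f (circ (rad n) t) - z))"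
  have ne: "f (circ (rad n) t) \<noteq> z" for t
  proof -
    have "norm (circ (rad n) t) < 1" using rad[of n] by (simp add: norm_mult)
    from f_in_D[OF this] assms(1) show ?thesis by auto
  qed
  have "integrable unif01 ?g"
    using cartan(1)[OF rad(1,2) assms(2)] jensen(1)[OF rad(1,2) z0]
      by (rule Bochner_Integration.integrable_diff)
  moreover have "0 \<le> ?g t" for t
  proof -
    have "ln (norm (f (circ (rad n) t) - z)) \<le> ln (max (norm (f (circ (rad n) t) - z)) e)"
      using ne[of t] by (subst ln_le_cancel_iff) (auto simp: less_max_iff_disj)
    then show ?thesis by simp
  qed
  ultimately have "ennreal (proximity e n z) = (\<integral>\<^sup>+ t. ennreal (?g t) \<partial>unif01)"
    unfolding proximity_def by (subst nn_integral_eq_integral) auto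
  also have "\<dots> \<le> (\<integral>\<^sup>+ t. log_kernel e (f (circ (rad n) t)) z \<partial>unif01)"
    using ne by (intro nn_integral_mono) (auto simp: log_kernel_def max_def ennreal_leI)
  finally show ?thesis .
qed

text \<open>By Tonelli, uniformly small truncated potentials of a measure make the proximity
  functions small on average against it. These increase with the radius, so even their supremum is
  small on average, and almost every point meets the regularity criterion although the measure sits
  on irregular points.\<close>

lemma green_boundary_polar: "polar {\<zeta> \<in> frontier D. \<not> (green \<longlongrightarrow> 0) (at \<zeta> within D)}"
  unfolding polar_def
proof (intro allI impI, rule ccontr)
  fix \<mu> :: "complex measure"
  assume "sets \<mu> = sets borel \<and> finite_measure \<mu> \<and> emeasure \<mu> (space \<mu>) \<noteq> 0 \<and>
      (\<exists>K. compact K \<and> K \<subseteq> {\<zeta> \<in> frontier D. \<not> (green \<longlongrightarrow> 0) (at \<zeta> within D)} \<and> emeasure \<mu> (space \<mu> - K) = 0)"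
    and en: "(\<integral>\<^sup>+ z. (\<integral>\<^sup>+ w. log_kernel_neg z w \<partial>\<mu>) \<partial>\<mu>) \<noteq> \<infinity>"
  then obtain K where \<mu>: "sets \<mu> = sets borel" "finite_measure \<mu>" "emeasure \<mu> (space \<mu>) \<noteq> 0"
    "compact K" "K \<subseteq> {\<zeta> \<in> frontier D. \<not> (green \<longlongrightarrow> 0) (at \<zeta> within D)}" "emeasure \<mu> (space \<mu> - K) = 0"
    by blast
  obtain \<nu> K' where \<nu>: "sets \<nu> = sets borel" "finite_measure \<nu>" "emeasure \<nu> (space \<nu>) \<noteq> 0"
    "compact K'" "K' \<subseteq> K" "emeasure \<nu> (space \<nu> - K') = 0"
    "\<And>h. 0 < h \<Longrightarrow> \<exists>e>0. \<forall>z. (\<integral>\<^sup>+ w. log_kernel e z w \<partial>\<nu>) \<le> ennreal h"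
    by (rule finite_energy_restriction[OF \<mu>(1-4,6) en]) (rule that)
  interpret N: finite_measure \<nu> by fact
  interpret P: pair_sigma_finite \<nu> unif01 ..
  note [measurable_cong] = \<nu>(1)
  have AEK: "AE w in \<nu>. w \<in> K'" by (rule AE_mem_of_null_complement[OF \<nu>(1,4,6)])
  have out: "z \<notin> D" if "z \<in> K'" for z
    using that \<nu>(5) \<mu>(5) openD by (auto simp: frontier_def interior_open)
  have bound: "(\<integral>\<^sup>+ z. (SUP n. ennreal (proximity e n z)) \<partial>\<nu>) \<le> ennreal h"
    if e: "e > 0" "\<And>z. (\<integral>\<^sup>+ w. log_kernel e z w \<partial>\<nu>) \<le> ennreal h" for e h
  proof -
    have "(\<integral>\<^sup>+ z. (SUP n. ennreal (proximity e n z)) \<partial>\<nu>) = (SUP n. \<integral>\<^sup>+ z. ennreal (proximity e n z) \<partial>\<nu>)"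
    proof (rule nn_integral_monotone_convergence_SUP_AE)
      show "AE z in \<nu>. ennreal (proximity e n z) \<le> ennreal (proximity e (Suc n) z)" for n
        using AEK by eventually_elim (intro ennreal_leI proximity_mono out e)
    qed measurable
    also have "\<dots> \<le> ennreal h"
    proof (rule SUP_least)
      fix n
      have [measurable]: "(\<lambda>t. f (circ (rad n) t)) \<in> borel_measurable unif01"
        using rad by (intro measurable_f_circle) auto
      have "(\<integral>\<^sup>+ z. ennreal (proximity e n z) \<partial>\<nu>) \<le>
        (\<integral>\<^sup>+ z. \<integral>\<^sup>+ t. log_kernel e (f (circ (rad n) t)) z \<partial>unif01 \<partial>\<nu>)"
        using AEK by (intro nn_integral_mono_AE)
          (auto elim!: eventually_mono intro!: ennreal_proximity_le out e)
      also have "\<dots> = (\<integral>\<^sup>+ t. \<integral>\<^sup>+ z. log_kernel e (f (circ (rad n) t)) z \<partial>\<nu> \<partial>unif01)"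
        by (rule P.Fubini'[symmetric]) measurable
      also have "\<dots> \<le> (\<integral>\<^sup>+ t. ennreal h \<partial>unif01)"
        by (intro nn_integral_mono e(2))
      also have "\<dots> = ennreal h" using unif01.emeasure_space_1 by simp
      finally show "(\<integral>\<^sup>+ z. ennreal (proximity e n z) \<partial>\<nu>) \<le> ennreal h" .
    qed
    finally show ?thesis .
  qed
  have "\<exists>e>0. \<forall>z. (\<integral>\<^sup>+ w. log_kernel e z w \<partial>\<nu>) \<le> ennreal (1 / real (Suc j))" for j
    by (rule \<nu>(7)) simp
  then obtain e where e: "\<And>j. e j > 0" "\<And>j z. (\<integral>\<^sup>+ w. log_kernel (e j) z w \<partial>\<nu>) \<le> ennreal (1 / real (Suc j))"
    by metis
  \<comment> \<open>\<open>S z = 0\<close> yields the hypothesis of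
    \<open>green_tendsto_boundary\<close> at z. The integral of S is at most 1 / (j + 1) for every
    j.\<close>
  define S where "S z = (INF j. SUP n. ennreal (proximity (e j) n z))" for z
  have [measurable]: "S \<in> borel_measurable \<nu>" unfolding S_def by measurable
  have "(\<integral>\<^sup>+ z. S z \<partial>\<nu>) \<le> ennreal (1 / real (Suc j))" for j
  proof -
    have "(\<integral>\<^sup>+ z. S z \<partial>\<nu>) \<le> (\<integral>\<^sup>+ z. (SUP n. ennreal (proximity (e j) n z)) \<partial>\<nu>)"
      unfolding S_def by (intro nn_integral_mono INF_lower) auto
    also have "\<dots> \<le> ennreal (1 / real (Suc j))" by (rule bound[OF e])
    finally show ?thesis .
  qed
  moreover have "(\<lambda>j. ennreal (1 / real (Suc j))) \<longlonglongrightarrow> ennreal 0"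
    by (intro tendsto_ennrealI) real_asymp
  ultimately have "(\<integral>\<^sup>+ z. S z \<partial>\<nu>) \<le> 0"
    using LIMSEQ_le_const by fastforce
  then have "(\<integral>\<^sup>+ z. S z \<partial>\<nu>) = 0" by simp
  then have "AE z in \<nu>. S z = 0" by (subst (asm) nn_integral_0_iff_AE) auto
  then have "AE z in \<nu>. False"
    using AEK
  proof eventually_elim
    case (elim z)
    have zD: "z \<notin> D" by (rule out) fact
    have "\<exists>e>0. \<forall>n. proximity e n z \<le> h" if h: "h > 0" for h
    proof -
      have "S z < ennreal h" using elim h by simp
      then obtain j where j: "(SUP n. ennreal (proximity (e j) n z)) < ennreal h"
        unfolding S_def by (auto simp: INF_less_iff)
      have "proximity (e j) n z \<le> h" for n
      proof -
        have "ennreal (proximity (e j) n z) \<le> (SUP n. ennreal (proximity (e j) n z))" by (rule SUP_upper) simp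
        also have "\<dots> \<le> ennreal h" using j by simp
        finally show ?thesis using h by (simp add: ennreal_le_iff2)
      qed
      then show ?thesis using e(1) by blast
    qed
    from green_tendsto_boundary[OF zD this] elim \<nu>(5) \<mu>(5) show False by auto
  qed
  then have "emeasure \<nu> (space \<nu>) = 0"
    by (subst (asm) AE_iff_measurable[OF sets.top]) auto
  with \<nu>(3) show False by simp
qed

end

section \<open>Radial limits of bounded holomorphic functions\<close>

definition taylor_coeff :: "(complex \<Rightarrow> complex) \<Rightarrow> nat \<Rightarrow> complex" where
  "taylor_coeff g k = (deriv ^^ k) g 0 / fact k"

lemma taylor_coeff_sums:
  "g holomorphic_on ball 0 1 \<Longrightarrow> norm z < 1 \<Longrightarrow> (\<lambda>k. taylor_coeff g k * z ^ k) sums g z"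
  using holomorphic_power_series[of g 0 1 z] by (simp add: taylor_coeff_def)

lemma taylor_coeff_abs_summable:
  assumes "g holomorphic_on ball 0 1" "0 \<le> s" "s < 1"
  shows "summable (\<lambda>k. norm (taylor_coeff g k) * s ^ k)"
proof -
  obtain s' where s': "s < s'" "s' < 1" using assms(3) dense by blast
  have "summable (\<lambda>k. taylor_coeff g k * of_real s' ^ k)"
    using taylor_coeff_sums[OF assms(1), of "of_real s'"] s' assms(2) by (auto simp: sums_iff)
  from powser_insidea[OF this, of "of_real s"] s' assms(2) show ?thesis
    by (simp add: norm_mult norm_power)
qed

lemma circle_mean_taylor_coeff:
  assumes g: "g holomorphic_on ball 0 1" and r: "0 < r" "r < 1"
  shows "(LINT t|unif01. g (circ r t) * cnj (unit_cis t) ^ k) = taylor_coeff g k * of_real r ^ k"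
    and "integrable unif01 (\<lambda>t. g (circ r t) * cnj (unit_cis t) ^ k)"
proof -
  have "((\<lambda>u. g u / (u - 0) ^ Suc k) has_contour_integral (2 * pi * \<i>) / fact k *
    (deriv ^^ k) g 0) (circlepath 0 r)"
    using r g by (intro Cauchy_has_contour_integral_higher_derivative_circlepath
      holomorphic_continuous_cball[of _ _ 1])
      (auto elim!: holomorphic_on_subset)
  then have I: "((\<lambda>u. g u / u ^ Suc k) has_contour_integral 2 * of_real pi * \<i> *
    taylor_coeff g k) (circlepath 0 r)"
    by (simp add: taylor_coeff_def)
  have C: "continuous_on (sphere 0 r) (\<lambda>u. g u / u ^ Suc k)"
    using r by (intro continuous_intros holomorphic_continuous_sphere[OF g]) auto
  have eq: "g (circ r t) / circ r t ^ Suc k * circ r t =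
    g (circ r t) * cnj (unit_cis t) ^ k / of_real r ^ k" for t
  proof -
    define u where "u = unit_cis t"
    have u: "u \<noteq> 0" "cnj u = 1 / u"
      unfolding u_def by (auto simp: unit_cis_def cis_cnj[symmetric] cis_inverse inverse_eq_divide[symmetric])
    show ?thesis
      unfolding u_def[symmetric] u(2) using r u(1) by (simp add: field_simps power_mult_distrib)
  qed
  have M: "(LINT t|unif01. g (circ r t) * cnj (unit_cis t) ^ k / of_real r ^ k) = taylor_coeff g k"
    "integrable unif01 (\<lambda>t. g (circ r t) * cnj (unit_cis t) ^ k / of_real r ^ k)"
    using circle_mean_contour[OF r(1) C I] unfolding add_0 eq by blast+
  from M(1) r show "(LINT t|unif01. g (circ r t) * cnj (unit_cis t) ^ k) = taylor_coeff g k * of_real r ^ k"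
    by (simp add: field_simps)
  show "integrable unif01 (\<lambda>t. g (circ r t) * cnj (unit_cis t) ^ k)"
    using integrable_mult_left[OF M(2), of "of_real r ^ k"] r by simp
qed

text \<open>Two radii are allowed because the square of an increment along a radius has a cross term
  besides the two squares.\<close>

lemma parseval:
  assumes g: "g holomorphic_on ball 0 1" and r: "0 < r" "r < 1" and s: "0 < s" "s < 1"
  shows "(\<lambda>k. (norm (taylor_coeff g k))\<^sup>2 * (r * s) ^ k) sums
      Re (LINT t|unif01. g (circ r t) * cnj (g (circ s t)))"
proof -
  obtain B where B: "B > 0" "\<And>t. norm (g (circ r t)) \<le> B"
    by (rule bounded_holomorphic_circle[OF g, of r]) (use r in auto)
  define h where "h k t = cnj (taylor_coeff g k) * of_real s ^ k * (g (circ r t) *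
    cnj (unit_cis t) ^ k)" for k t
  have hi: "integrable unif01 (h k)" for k
    unfolding h_def by (intro integrable_mult_right circle_mean_taylor_coeff[OF g r])
  have hint: "(LINT t|unif01. h k t) = of_real ((norm (taylor_coeff g k))\<^sup>2 * (r * s) ^ k)" for k
  proof -
    have "(LINT t|unif01. h k t) = cnj (taylor_coeff g k) * of_real s ^ k * (taylor_coeff g k * of_real r ^ k)"
      unfolding h_def using circle_mean_taylor_coeff[OF g r, of k] by simp
    also have "\<dots> = (taylor_coeff g k * cnj (taylor_coeff g k)) * of_real ((r * s) ^ k)"
      by (simp add: power_mult_distrib mult_ac)
    also have "taylor_coeff g k * cnj (taylor_coeff g k) = of_real ((norm (taylor_coeff g k))\<^sup>2)"
      by (metis complex_norm_square)
    finally show ?thesis by simp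
  qed
  have hb: "norm (h k t) \<le> B * (norm (taylor_coeff g k) * s ^ k)" for k t
  proof -
    have "norm (h k t) = norm (taylor_coeff g k) * s ^ k * norm (g (circ r t))"
      using s by (simp add: h_def norm_mult norm_power)
    also have "\<dots> \<le> norm (taylor_coeff g k) * s ^ k * B"
      using B(2)[of t] s by (intro mult_left_mono) auto
    finally show ?thesis by (simp add: mult_ac)
  qed
  have sm: "summable (\<lambda>k. B * (norm (taylor_coeff g k) * s ^ k))"
    using taylor_coeff_abs_summable[OF g, of s] s by (intro summable_mult) auto
  have "(\<lambda>k. LINT t|unif01. h k t) sums (LINT t|unif01. (\<Sum>k. h k t))"
  proof (rule sums_integral[OF hi])
    show "AE t in unif01. summable (\<lambda>k. norm (h k t))"
      using hb by (intro always_eventually allI summable_comparison_test'[OF sm, of 0]) auto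
    show "summable (\<lambda>k. LINT t|unif01. norm (h k t))"
    proof (rule summable_comparison_test'[OF sm, of 0])
      show "norm (LINT t|unif01. norm (h k t)) \<le> B * (norm (taylor_coeff g k) * s ^ k)" for k
      proof -
        have "(LINT t|unif01. norm (h k t)) \<le> (LINT t|unif01. B * (norm (taylor_coeff g k) * s ^ k))"
          using hi hb by (intro integral_mono) auto
        then show ?thesis by (simp add: integral_nonneg_AE)
      qed
    qed
  qed
  moreover have "(\<Sum>k. h k t) = g (circ r t) * cnj (g (circ s t))" for t
  proof -
    have "(\<lambda>k. taylor_coeff g k * (circ s t) ^ k) sums g (circ s t)"
      using s by (intro taylor_coeff_sums[OF g]) (simp add: norm_mult)
    then have "(\<lambda>k. cnj (taylor_coeff g k * (circ s t) ^ k)) sums cnj (g (circ s t))"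
      by (rule bounded_linear.sums[OF bounded_linear_cnj])
    then have "(\<lambda>k. g (circ r t) * cnj (taylor_coeff g k * (circ s t) ^ k)) sums
        (g (circ r t) * cnj (g (circ s t)))"
      by (rule sums_mult)
    then show ?thesis by (simp add: h_def sums_iff power_mult_distrib mult_ac)
  qed
  ultimately have "(\<lambda>k. complex_of_real ((norm (taylor_coeff g k))\<^sup>2 * (r * s) ^ k)) sums
      (LINT t|unif01. g (circ r t) * cnj (g (circ s t)))"
    unfolding hint by simp
  from sums_Re[OF this] show ?thesis by simp
qed

text \<open>Its value at \<open>r * r\<close> is the mean of |g|^2 over the circle of radius r; the
  series makes comparison between radii a comparison of coefficients.\<close>

definition hardy_sum :: "(complex \<Rightarrow> complex) \<Rightarrow> real \<Rightarrow> real" where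
  "hardy_sum g x = (\<Sum>k. (norm (taylor_coeff g k))\<^sup>2 * x ^ k)"

lemma hardy_sum_mean:
  assumes g: "g holomorphic_on ball 0 1" and r: "0 < r" "r < 1"
  shows "(LINT t|unif01. (norm (g (circ r t)))\<^sup>2) = hardy_sum g (r * r)"
    "summable (\<lambda>k. (norm (taylor_coeff g k))\<^sup>2 * (r * r) ^ k)"
    "integrable unif01 (\<lambda>t. (norm (g (circ r t)))\<^sup>2)"
proof -
  obtain B where B: "B > 0" "\<And>t. norm (g (circ r t)) \<le> B"
    by (rule bounded_holomorphic_circle[OF g, of r]) (use r in auto)
  show i: "integrable unif01 (\<lambda>t. (norm (g (circ r t)))\<^sup>2)"
    using B r by (intro bounded_unif01_integrable[where B="B\<^sup>2"] continuous_intros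
      continuous_holomorphic_circle g)
      (auto intro: power_mono)
  have "(LINT t|unif01. g (circ r t) * cnj (g (circ r t))) =
     (LINT t|unif01. complex_of_real ((norm (g (circ r t)))\<^sup>2))"
    by (intro Bochner_Integration.integral_cong refl) (metis complex_norm_square)
  then have eq: "Re (LINT t|unif01. g (circ r t) * cnj (g (circ r t))) =
     (LINT t|unif01. (norm (g (circ r t)))\<^sup>2)" 
    by (simp only: integral_complex_of_real Re_complex_of_real)
  from parseval[OF g r r, unfolded eq]
  show "(LINT t|unif01. (norm (g (circ r t)))\<^sup>2) = hardy_sum g (r * r)"
    "summable (\<lambda>k. (norm (taylor_coeff g k))\<^sup>2 * (r * r) ^ k)"
    by (auto simp: hardy_sum_def sums_iff)
qed

text \<open>In the expanded square the cross term is the series at \<open>s * r\<close>, which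
  dominates the one at \<open>r * r\<close>. Increments are thus controlled by an increasing
  function of the radius.\<close>

lemma hardy_sum_difference:
  assumes g: "g holomorphic_on ball 0 1" and r: "0 < r" "r \<le> s" "s < 1"
  shows "(LINT t|unif01. (norm (g (circ s t) - g (circ r t)))\<^sup>2) \<le>
    hardy_sum g (s * s) - hardy_sum g (r * r)"
    and "integrable unif01 (\<lambda>t. (norm (g (circ s t) - g (circ r t)))\<^sup>2)"
proof -
  have rs: "0 < r" "r < 1" "0 < s" "s < 1" using r by auto
  obtain B1 where B1: "B1 > 0" "\<And>t. norm (g (circ r t)) \<le> B1"
    by (rule bounded_holomorphic_circle[OF g, of r]) (use rs in auto)
  obtain B2 where B2: "B2 > 0" "\<And>t. norm (g (circ s t)) \<le> B2"
    by (rule bounded_holomorphic_circle[OF g, of s]) (use rs in auto)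
  note P = parseval[OF g rs(3,4) rs(1,2)]
  have ci: "integrable unif01 (\<lambda>t. g (circ s t) * cnj (g (circ r t)))"
  proof (rule bounded_unif01_integrable)
    show "continuous_on UNIV (\<lambda>t. g (circ s t) * cnj (g (circ r t)))"
      using rs by (intro continuous_intros continuous_holomorphic_circle g) auto
    show "norm (g (circ s t) * cnj (g (circ r t))) \<le> B2 * B1" for t
      unfolding norm_mult complex_mod_cnj using B1 B2(2)[of t] B2(1) by (intro mult_mono) auto
  qed
  have id: "(norm (x - y))\<^sup>2 = (norm x)\<^sup>2 + (norm y)\<^sup>2 - 2 * Re (x * cnj y)" for x y :: complex
    unfolding cmod_power2 by (simp add: power2_eq_square algebra_simps)
  note i = hardy_sum_mean(3)[OF g rs(1,2)] hardy_sum_mean(3)[OF g rs(3,4)]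
  show "integrable unif01 (\<lambda>t. (norm (g (circ s t) - g (circ r t)))\<^sup>2)"
    unfolding id
    by (intro Bochner_Integration.integrable_diff Bochner_Integration.integrable_add i
      integrable_mult_right integrable_Re ci)
  have "(LINT t|unif01. (norm (g (circ s t) - g (circ r t)))\<^sup>2) =
     hardy_sum g (s * s) + hardy_sum g (r * r) - 2 * Re (LINT t|unif01. g (circ s t) * cnj (g (circ r t)))"
    unfolding id using i integrable_Re[OF ci] integral_Re[OF ci] hardy_sum_mean(1)[OF g rs(1,2)]
      hardy_sum_mean(1)[OF g rs(3,4)]
    by (simp del: times_complex.sel)
  moreover have "hardy_sum g (r * r) \<le> Re (LINT t|unif01. g (circ s t) * cnj (g (circ r t)))"
    unfolding hardy_sum_def sums_unique[OF P]
  proof (rule suminf_le[OF _ hardy_sum_mean(2)[OF g rs(1,2)] sums_summable[OF P]])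
    show "(norm (taylor_coeff g k))\<^sup>2 * (r * r) ^ k \<le> (norm (taylor_coeff g k))\<^sup>2 * (s * r) ^ k" for k
      using r by (intro mult_left_mono power_mono mult_right_mono) auto
  qed
  ultimately show "(LINT t|unif01. (norm (g (circ s t) - g (circ r t)))\<^sup>2) \<le>
    hardy_sum g (s * s) - hardy_sum g (r * r)" by simp
qed

lemma hardy_sum_bounded:
  assumes g: "g holomorphic_on ball 0 1" and b: "\<And>z. z \<in> ball 0 1 \<Longrightarrow> norm (g z) \<le> 1" and r: "0 < r" "r < 1"
  shows "hardy_sum g (r * r) \<le> 1"
proof -
  have "(LINT t|unif01. (norm (g (circ r t)))\<^sup>2) \<le> (LINT t|unif01. 1)"
    using b r by (intro integral_mono hardy_sum_mean(3) g) (auto simp: norm_mult power_le_one)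
  then show ?thesis using hardy_sum_mean(1)[OF g r] by simp
qed

text \<open>Along radii with \<open>L - hardy_sum \<le> 4 ^ (-n)\<close> the increments are absolutely summable a.e.\<close>

lemma convergent_of_hardy_sum_rate:
  assumes g: "g holomorphic_on ball 0 1" and r: "\<And>n. 0 < r n" "\<And>n. r n \<le> r (Suc n)" "\<And>n. r n < 1"
    and rate: "\<And>n. hardy_sum g (r (Suc n) * r (Suc n)) - hardy_sum g (r n * r n) \<le> (1/4) ^ n"
  shows "AE t in unif01. convergent (\<lambda>n. g (circ (r n) t))"
proof -
  define d where "d n t = g (circ (r (Suc n)) t) - g (circ (r n) t)" for n t
  have dm [measurable]: "d n \<in> borel_measurable unif01" for n
    unfolding d_def using r by (intro borel_measurable_diff measurable_holomorphic_circle g)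
      (auto intro: less_imp_le)
  have L1: "(\<integral>\<^sup>+ t. ennreal (norm (d n t)) \<partial>unif01) \<le> ennreal ((1/2) ^ n)" for n
  proof -
    note D = hardy_sum_difference[OF g r(1)[of n] r(2)[of n] r(3)]
    \<comment> \<open>Young's inequality with weight 2^n plays the part of Cauchy-Schwarz; the
      weight balances the rate 4^(-n) and leaves 2^(-n).\<close>
    have le: "norm (d n t) \<le> (2 ^ n * (norm (d n t))\<^sup>2 + (1/2) ^ n) / 2" for t
    proof -
      have "0 \<le> (norm (d n t) * 2 ^ n - 1)\<^sup>2" by simp
      also have "\<dots> = 2 ^ n * (2 ^ n * (norm (d n t))\<^sup>2 + (1/2) ^ n - 2 * norm (d n t))"
        by (simp add: power2_eq_square algebra_simps power_divide)
      finally have "0 \<le> 2 ^ n * (norm (d n t))\<^sup>2 + (1/2) ^ n - 2 * norm (d n t)"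
        by (metis mult_pos_neg not_le zero_less_numeral zero_less_power)
      then show ?thesis by simp
    qed
    have "(\<integral>\<^sup>+ t. ennreal (norm (d n t)) \<partial>unif01) \<le>
      (\<integral>\<^sup>+ t. ennreal ((2 ^ n * (norm (d n t))\<^sup>2 + (1/2) ^ n) / 2) \<partial>unif01)"
      using le by (intro nn_integral_mono ennreal_leI)
    also have "\<dots> = ennreal (LINT t|unif01. (2 ^ n * (norm (d n t))\<^sup>2 + (1/2) ^ n) / 2)"
      using D(2) by (intro nn_integral_eq_integral) (auto simp: d_def)
    also have "(LINT t|unif01. (2 ^ n * (norm (d n t))\<^sup>2 + (1/2) ^ n) / 2) =
      (2 ^ n * (LINT t|unif01. (norm (d n t))\<^sup>2) + (1/2) ^ n) / 2"
      using D(2) by (simp add: d_def)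
    also have "\<dots> \<le> (2 ^ n * (1/4) ^ n + (1/2) ^ n) / 2"
      using D(1) rate[of n] by (intro divide_right_mono add_right_mono mult_left_mono) (auto simp: d_def)
    also have "(2 ^ n * (1/4) ^ n + (1/2) ^ n) / 2 = (1/2::real) ^ n"
      by (simp flip: power_mult_distrib)
    finally show ?thesis by (simp add: ennreal_leI)
  qed
  have "(\<integral>\<^sup>+ t. (\<Sum>n. ennreal (norm (d n t))) \<partial>unif01) = (\<Sum>n. \<integral>\<^sup>+ t. ennreal (norm (d n t)) \<partial>unif01)"
    by (rule nn_integral_suminf) measurable
  also have "\<dots> \<le> (\<Sum>n. ennreal ((1/2) ^ n))" by (intro suminf_le L1) auto
  also have "\<dots> < \<infinity>"
    by (subst suminf_ennreal2) (auto intro!: summable_geometric)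
  finally have fin: "(\<integral>\<^sup>+ t. (\<Sum>n. ennreal (norm (d n t))) \<partial>unif01) \<noteq> \<infinity>" by simp
  have m: "(\<lambda>t. \<Sum>n. ennreal (norm (d n t))) \<in> borel_measurable unif01" by measurable
  from nn_integral_noteq_infinite[OF m fin] show ?thesis
  proof eventually_elim
    case (elim t)
    then have "summable (\<lambda>n. norm (d n t))" by (intro summable_suminf_not_top) auto
    then have "summable (\<lambda>n. d n t)" by (rule summable_norm_cancel)
    then have "convergent (\<lambda>n. \<Sum>i<n. d i t)" by (simp add: summable_iff_convergent)
    then have "convergent (\<lambda>n. g (circ (r n) t) - g (circ (r 0) t))"
      unfolding d_def sum_lessThan_telescope[where f="\<lambda>n. g (circ (r n) t)"] .
    from convergent_add[OF this convergent_const[of "g (circ (r 0) t)"]]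
    show ?case by simp
  qed
qed

text \<open>Numerator and denominator of a quotient must converge along the same radii. The radii
  are therefore chosen for the sum of the two bounded increasing means, and a rate for the sum is a
  rate for each.\<close>

lemma radial_subsequence:
  assumes g1: "g1 holomorphic_on ball 0 1" "\<And>z. z \<in> ball 0 1 \<Longrightarrow> norm (g1 z) \<le> 1"
    and g2: "g2 holomorphic_on ball 0 1" "\<And>z. z \<in> ball 0 1 \<Longrightarrow> norm (g2 z) \<le> 1"
  obtains \<sigma> :: "nat \<Rightarrow> nat" where "strict_mono \<sigma>"
    "AE t in unif01. convergent (\<lambda>n. g1 (circ (rad (\<sigma> n)) t))"
    "AE t in unif01. convergent (\<lambda>n. g2 (circ (rad (\<sigma> n)) t))"
proof -
  define b1 where "b1 n = hardy_sum g1 (rad n * rad n)" for n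
  define b2 where "b2 n = hardy_sum g2 (rad n * rad n)" for n
  have mono: "incseq rad" using rad_mono by (simp add: incseq_SucI)
  have inc: "hardy_sum g (rad m * rad m) \<le> hardy_sum g (rad n * rad n)"
    if "g holomorphic_on ball 0 1" "m \<le> n" for g m n
  proof -
    have "0 \<le> (LINT t|unif01. (norm (g (circ (rad n) t) - g (circ (rad m) t)))\<^sup>2)"
      by (intro integral_nonneg_AE) auto
    also have "\<dots> \<le> hardy_sum g (rad n * rad n) - hardy_sum g (rad m * rad m)"
      using that incseqD[OF mono that(2)] rad by (intro hardy_sum_difference) auto
    finally show ?thesis by simp
  qed
  have conv: "convergent (\<lambda>n. b1 n + b2 n)"
  proof (rule Bseq_mono_convergent)
    have "0 \<le> hardy_sum g (rad n * rad n)" if "g holomorphic_on ball 0 1" for g n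
      using hardy_sum_mean(1)[OF that rad(1,2)] by (metis integral_nonneg_AE always_eventually zero_le_power2)
    then have "norm (b1 n + b2 n) \<le> 2" for n
      using hardy_sum_bounded[OF g1 rad(1,2), of n] hardy_sum_bounded[OF g2 rad(1,2), of n] g1(1) g2(1)
      by (auto simp: b1_def b2_def intro!: order_trans[OF abs_triangle_ineq])
    then show "Bseq (\<lambda>n. b1 n + b2 n)" by (rule BseqI')
    show "\<forall>m n. m \<le> n \<longrightarrow> b1 m + b2 m \<le> b1 n + b2 n"
      using inc[OF g1(1)] inc[OF g2(1)] by (auto simp: b1_def b2_def intro: add_mono)
  qed
  then obtain L where L: "(\<lambda>n. b1 n + b2 n) \<longlonglongrightarrow> L" by (auto simp: convergent_def)
  have incb: "incseq (\<lambda>n. b1 n + b2 n)"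
    using inc[OF g1(1)] inc[OF g2(1)] by (auto simp: b1_def b2_def incseq_def intro: add_mono)
  have leL: "b1 n + b2 n \<le> L" for n using incseq_le[OF incb L] .
  have "\<exists>\<sigma>. \<forall>n. (L - (b1 (\<sigma> n) + b2 (\<sigma> n)) < (1/4) ^ n) \<and> \<sigma> n < \<sigma> (Suc n)"
  proof (rule dependent_nat_choice)
    have ev: "\<forall>\<^sub>F m in sequentially. L - (b1 m + b2 m) < (1/4) ^ n" for n
    proof -
      have "(\<lambda>m. L - (b1 m + b2 m)) \<longlonglongrightarrow> L - L" by (intro tendsto_diff tendsto_const L)
      then show ?thesis by (rule order_tendstoD(2)) simp
    qed
    then show "\<exists>x. L - (b1 x + b2 x) < (1/4) ^ 0"
      using eventually_happens'[OF sequentially_bot] by blast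
    fix x n
    have "\<forall>\<^sub>F m in sequentially. L - (b1 m + b2 m) < (1/4) ^ Suc n \<and> x < m"
      by (intro eventually_conj ev eventually_gt_at_top)
    then show "\<exists>y. L - (b1 y + b2 y) < (1/4) ^ Suc n \<and> x < y"
      using eventually_happens'[OF sequentially_bot] by blast
  qed
  then obtain \<sigma> where \<sigma>: "\<And>n. L - (b1 (\<sigma> n) + b2 (\<sigma> n)) < (1/4) ^ n" "\<And>n. \<sigma> n < \<sigma> (Suc n)" by blast
  have sm: "strict_mono \<sigma>" using \<sigma>(2) by (simp add: strict_mono_Suc_iff)
  have r: "0 < rad (\<sigma> n)" "rad (\<sigma> n) \<le> rad (\<sigma> (Suc n))" "rad (\<sigma> n) < 1" for n
    using rad incseqD[OF mono] \<sigma>(2)[of n] by auto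
  have le: "\<sigma> n \<le> \<sigma> (Suc n)" for n using \<sigma>(2)[of n] by simp
  have "b1 (\<sigma> (Suc n)) - b1 (\<sigma> n) \<le> (1/4) ^ n" "b2 (\<sigma> (Suc n)) - b2 (\<sigma> n) \<le> (1/4) ^ n" for n
    using \<sigma>(1)[of n] leL[of "\<sigma> (Suc n)"] inc[OF g1(1) le[of n]] inc[OF g2(1) le[of n]]
      unfolding b1_def b2_def by linarith+
  then show thesis
    using convergent_of_hardy_sum_rate[where r="\<lambda>n. rad
      (\<sigma> n)", OF g1(1) r] convergent_of_hardy_sum_rate[where r="\<lambda>n. rad (\<sigma> n)", OF g2(1) r] that[OF sm]
    unfolding b1_def b2_def by blast
qed

text \<open>Once Im g(0) = 0, the mean of Re (g^2) is Re (g(0)^2) >= 0, so the mean of |g|^2 is at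
  most twice that of (Re g)^2. The latter tends to 0 by dominated convergence, which forces every
  Taylor coefficient to vanish.\<close>

lemma Re_zero_of_boundary_zero:
  assumes \<Phi>: "\<Phi> holomorphic_on ball 0 1" and M: "\<And>z. z \<in> ball 0 1 \<Longrightarrow> \<bar>Re (\<Phi> z)\<bar> \<le> M"
    and lim: "AE t in unif01. (\<lambda>n. Re (\<Phi> (circ (rad (\<sigma> n)) t))) \<longlonglongrightarrow> 0"
    and z: "z \<in> ball 0 1"
  shows "Re (\<Phi> z) = 0"
proof -
  define g where "g z = \<Phi> z - \<i> * Im (\<Phi> 0)" for z
  have g: "g holomorphic_on ball 0 1" unfolding g_def using \<Phi> by (intro holomorphic_intros)
  have Re_g: "Re (g z) = Re (\<Phi> z)" for z by (simp add: g_def)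
  have disc: "circ (rad n) t \<in> ball 0 1" for n t using rad[of n] by (simp add: norm_mult)
  have [measurable]: "(\<lambda>t. g (circ (rad n) t)) \<in> borel_measurable unif01" for n
    using rad by (intro measurable_holomorphic_circle g) auto
  have le: "hardy_sum g (rad n * rad n) \<le> 2 * (LINT t|unif01. (Re (g (circ (rad n) t)))\<^sup>2)" for n
  proof -
    have "(\<lambda>z. (g z)\<^sup>2) holomorphic_on ball 0 1" using g by (intro holomorphic_intros)
    from circle_mean_Re[OF this, of "rad n"] rad[of n]
    have 1: "(LINT t|unif01. Re ((g (circ (rad n) t))\<^sup>2)) = Re ((g 0)\<^sup>2)"
      "integrable unif01 (\<lambda>t. Re ((g (circ (rad n) t))\<^sup>2))" by auto
    have "Im (g 0) = 0" by (simp add: g_def)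
    then have "0 \<le> Re ((g 0)\<^sup>2)" by (simp add: power2_eq_square)
    moreover have "(norm x)\<^sup>2 = 2 * (Re x)\<^sup>2 - Re (x\<^sup>2)" for x
      unfolding cmod_power2 by (simp add: power2_eq_square)
    moreover have "integrable unif01 (\<lambda>t. (Re (g (circ (rad n) t)))\<^sup>2)"
    proof (rule unif01.integrable_const_bound[where B="M\<^sup>2"])
      have "(Re (g (circ (rad n) t)))\<^sup>2 \<le> M\<^sup>2" for t
        using M[OF disc] by (simp add: Re_g abs_le_square_iff[symmetric] order_trans[OF _ abs_ge_self])
      then show "AE t in unif01. norm ((Re (g (circ (rad n) t)))\<^sup>2) \<le> M\<^sup>2" by simp
    qed measurable
    ultimately have "(LINT t|unif01. (norm (g (circ (rad n) t)))\<^sup>2) \<le>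
      2 * (LINT t|unif01. (Re (g (circ (rad n) t)))\<^sup>2)"
      using 1 by simp
    then show ?thesis using hardy_sum_mean(1)[OF g rad(1,2)] by simp
  qed
  have "(\<lambda>n. LINT t|unif01. (Re (g (circ (rad (\<sigma> n)) t)))\<^sup>2) \<longlonglongrightarrow> (LINT t|unif01. 0)"
  proof (rule integral_dominated_convergence[where w="\<lambda>t. M\<^sup>2"])
    show "AE t in unif01. (\<lambda>n. (Re (g (circ (rad (\<sigma> n)) t)))\<^sup>2) \<longlonglongrightarrow> 0"
      using lim unfolding Re_g by eventually_elim (auto intro!: tendsto_eq_intros)
    have "(Re (g (circ (rad (\<sigma> n)) t)))\<^sup>2 \<le> M\<^sup>2" for t n
      using M[OF disc] by (simp add: Re_g abs_le_square_iff[symmetric] order_trans[OF _ abs_ge_self])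
    then show "AE t in unif01. norm ((Re (g (circ (rad (\<sigma> n)) t)))\<^sup>2) \<le> M\<^sup>2" for n by simp
  qed auto
  then have lim2: "(\<lambda>n. 2 * (LINT t|unif01. (Re (g (circ (rad (\<sigma> n)) t)))\<^sup>2)) \<longlonglongrightarrow> 0"
    by (auto intro!: tendsto_eq_intros)
  have "taylor_coeff g k = 0" for k
  proof -
    have "(norm (taylor_coeff g k))\<^sup>2 * (1/4) ^ k \<le> 2 * (LINT t|unif01. (Re (g (circ (rad (\<sigma> n)) t)))\<^sup>2)" for n
    proof -
      have "1/2 \<le> rad (\<sigma> n)" by (simp add: rad_def field_simps)
      then have "1/2 * (1/2) \<le> rad (\<sigma> n) * rad (\<sigma> n)" by (intro mult_mono) auto
      then have "(norm (taylor_coeff g k))\<^sup>2 * (1/4) ^ k \<le>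
        (norm (taylor_coeff g k))\<^sup>2 * (rad (\<sigma> n) * rad (\<sigma> n)) ^ k"
        by (intro mult_left_mono power_mono) auto
      also have "\<dots> \<le> hardy_sum g (rad (\<sigma> n) * rad (\<sigma> n))"
        unfolding hardy_sum_def
        using sum_le_suminf[OF hardy_sum_mean(2)[OF g rad(1,2)], of "{k}" "\<sigma> n"] rad by simp
      also note le
      finally show ?thesis .
    qed
    then have "(norm (taylor_coeff g k))\<^sup>2 * (1/4) ^ k \<le> 0"
      using LIMSEQ_le_const[OF lim2] by blast
    moreover have "0 < (norm (taylor_coeff g k))\<^sup>2 * (1/4) ^ k" if "taylor_coeff g k \<noteq> 0"
      using that by simp
    ultimately show ?thesis by (metis not_le)
  qed
  then have "g z = 0" using taylor_coeff_sums[OF g, of z] z by (simp add: sums_iff)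
  then show ?thesis using Re_g by (metis zero_complex.sel(1))
qed

section \<open>Boundary values and harmonic measure\<close>

context greenian_covering
begin

text \<open>Boundary values exist because \<open>f\<close> is a quotient of the bounded functions
  \<open>f * exp (- \<Phi>)\<close> and \<open>exp (- \<Phi>)\<close>, where \<open>Re \<Phi>\<close> majorizes \<open>log\<^sup>+ \<bar>f\<bar>\<close>.\<close>

lemma boundary_values:
  obtains \<sigma> :: "nat \<Rightarrow> nat" and F where "strict_mono \<sigma>" "F \<in> borel_measurable unif01"
    "AE t in unif01. (\<lambda>n. f (circ (rad (\<sigma> n)) t)) \<longlonglongrightarrow> F t"
proof -
  obtain \<Phi> where \<Phi>: "\<Phi> holomorphic_on ball 0 1" "\<And>z. z \<in> ball 0 1 \<Longrightarrow> ln (max 1 (norm (f z))) \<le> Re (\<Phi> z)"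
    by (rule nevanlinna_majorant) (rule that)
  define g2 where "g2 z = exp (- \<Phi> z)" for z
  define g1 where "g1 z = f z * g2 z" for z
  have g: "g1 holomorphic_on ball 0 1" "g2 holomorphic_on ball 0 1"
    unfolding g1_def g2_def using hol \<Phi>(1) by (auto intro!: holomorphic_intros)
  have Re_nonneg: "0 \<le> Re (\<Phi> z)" if "z \<in> ball 0 1" for z
    using \<Phi>(2)[OF that] ln_ge_zero[of "max 1 (norm (f z))"] by linarith
  have b2: "norm (g2 z) \<le> 1" if "z \<in> ball 0 1" for z
    using Re_nonneg[OF that] by (simp add: g2_def)
  have b1: "norm (g1 z) \<le> 1" if "z \<in> ball 0 1" for z
  proof -
    have p: "max 1 (norm (f z)) > 0" by (simp add: less_max_iff_disj)
    have "norm (f z) \<le> exp (ln (max 1 (norm (f z))))" using p by simp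
    also have "\<dots> \<le> exp (Re (\<Phi> z))" using \<Phi>(2)[OF that] by (subst exp_le_cancel_iff)
    finally have "norm (f z) * exp (- Re (\<Phi> z)) \<le> exp (Re (\<Phi> z)) * exp (- Re (\<Phi> z))"
      by (intro mult_right_mono) auto
    also have "exp (Re (\<Phi> z)) * exp (- Re (\<Phi> z)) = 1" by (simp add: exp_minus)
    finally show ?thesis by (simp add: g1_def g2_def norm_mult)
  qed
  obtain \<sigma> :: "nat \<Rightarrow> nat" where \<sigma>: "strict_mono \<sigma>"
    "AE t in unif01. convergent (\<lambda>n. g1 (circ (rad (\<sigma> n)) t))"
    "AE t in unif01. convergent (\<lambda>n. g2 (circ (rad (\<sigma> n)) t))"
    by (rule radial_subsequence[OF g(1) _ g(2)]) (erule b1, erule b2, rule that)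
  have disc: "circ (rad n) t \<in> ball 0 1" for n t using rad[of n] by (simp add: norm_mult)
  have mP [measurable]: "(\<lambda>t. \<Phi> (circ (rad n) t)) \<in> borel_measurable unif01" for n
    using rad by (intro measurable_holomorphic_circle \<Phi>(1)) auto
  have "(\<integral>\<^sup>+ t. liminf (\<lambda>n. ennreal (Re (\<Phi> (circ (rad (\<sigma> n)) t)))) \<partial>unif01) \<le>
      liminf (\<lambda>n. \<integral>\<^sup>+ t. ennreal (Re (\<Phi> (circ (rad (\<sigma> n)) t))) \<partial>unif01)"
    by (rule nn_integral_liminf) measurable
  also have "(\<lambda>n. \<integral>\<^sup>+ t. ennreal (Re (\<Phi> (circ (rad (\<sigma> n)) t))) \<partial>unif01) = (\<lambda>n. ennreal (Re (\<Phi> 0)))"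
  proof
    fix n
    note C = circle_mean_Re[OF \<Phi>(1) rad(3,2)[of "\<sigma> n"], unfolded add_0]
    show "(\<integral>\<^sup>+ t. ennreal (Re (\<Phi> (circ (rad (\<sigma> n)) t))) \<partial>unif01) = ennreal (Re (\<Phi> 0))"
      using C Re_nonneg[OF disc] by (subst nn_integral_eq_integral) auto
  qed
  also have "liminf (\<lambda>n::nat. ennreal (Re (\<Phi> 0))) = ennreal (Re (\<Phi> 0))" by (simp add: Liminf_const)
  finally have fin: "(\<integral>\<^sup>+ t. liminf (\<lambda>n. ennreal (Re (\<Phi> (circ (rad (\<sigma> n)) t)))) \<partial>unif01) \<noteq> \<infinity>"
    by (metis ennreal_less_top infinity_ennreal_def leD)
  have m: "(\<lambda>t. liminf (\<lambda>n. ennreal (Re (\<Phi> (circ (rad (\<sigma> n)) t))))) \<in> borel_measurable unif01"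
    by measurable
  have ae: "AE t in unif01. convergent (\<lambda>n. f (circ (rad (\<sigma> n)) t))"
    using nn_integral_noteq_infinite[OF m fin] \<sigma>(2,3)
  proof eventually_elim
    case (elim t)
    let ?z = "\<lambda>n. circ (rad (\<sigma> n)) t"
    obtain l1 l2 where l: "(\<lambda>n. g1 (?z n)) \<longlonglongrightarrow> l1" "(\<lambda>n. g2 (?z n)) \<longlonglongrightarrow> l2"
      using elim(2,3) by (auto simp: convergent_def)
    \<comment> \<open>The means of Re \<Phi> all equal \<open>Re (\<Phi> 0)\<close>, so by Fatou its
      lower limit is finite almost everywhere and the denominator cannot tend to 0.\<close>
    have "l2 \<noteq> 0"
    proof
      assume "l2 = 0"
      with l(2) have "(\<lambda>n. norm (g2 (?z n))) \<longlonglongrightarrow> 0" using tendsto_norm_zero by blast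
      then have "(\<lambda>n. exp (- Re (\<Phi> (?z n)))) \<longlonglongrightarrow> 0" by (simp add: g2_def)
      then have "filterlim (\<lambda>n. exp (- Re (\<Phi> (?z n)))) (at_right 0) sequentially"
        by (simp add: filterlim_at)
      then have "filterlim (\<lambda>n. ln (exp (- Re (\<Phi> (?z n))))) at_bot sequentially"
        by (rule filterlim_compose[OF ln_at_0])
      then have "filterlim (\<lambda>n. Re (\<Phi> (?z n))) at_top sequentially"
        by (simp add: filterlim_uminus_at_bot)
      then have "(\<lambda>n. ennreal (Re (\<Phi> (?z n)))) \<longlonglongrightarrow> \<infinity>"
        by (simp add: ennreal_tendsto_top_eq_at_top)
      then have "liminf (\<lambda>n. ennreal (Re (\<Phi> (?z n)))) = \<infinity>"
        by (rule lim_imp_Liminf[rotated]) simp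
      with elim(1) show False by simp
    qed
    then have "(\<lambda>n. g1 (?z n) / g2 (?z n)) \<longlonglongrightarrow> l1 / l2" by (intro tendsto_intros l)
    moreover have "g1 (?z n) / g2 (?z n) = f (?z n)" for n by (simp add: g1_def g2_def)
    ultimately show ?case by (auto simp: convergent_def)
  qed
  have [measurable]: "(\<lambda>t. f (circ (rad n) t)) \<in> borel_measurable unif01" for n
    using rad by (intro measurable_holomorphic_circle hol) auto
  show thesis
  proof (rule that[OF \<sigma>(1)])
    show "(\<lambda>t. lim (\<lambda>n. f (circ (rad (\<sigma> n)) t))) \<in> borel_measurable unif01"
      by measurable
    show "AE t in unif01. (\<lambda>n. f (circ (rad (\<sigma> n)) t)) \<longlonglongrightarrow> lim (\<lambda>n. f (circ (rad (\<sigma> n)) t))"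
      using ae by eventually_elim (simp add: convergent_LIMSEQ_iff)
  qed
qed

text \<open>The bound of \<open>mean_near_interior\<close> tends to 0, so by Fatou the lower limit
  of the truncated logarithms vanishes almost everywhere. A boundary value at distance less than c <
  e from w would keep it at least ln e - ln c.\<close>

lemma boundary_values_avoid_ball:
  fixes \<sigma> :: "nat \<Rightarrow> nat"
  assumes \<sigma>: "strict_mono \<sigma>" and F: "AE t in unif01. (\<lambda>n. f (circ (rad (\<sigma> n)) t)) \<longlonglongrightarrow> F t"
    and w: "w \<in> D" "w \<noteq> 0"
  obtains e where "e > 0" "ball w e \<subseteq> D" "AE t in unif01. F t \<notin> ball w e"
proof -
  obtain e where e: "e > 0" "ball w e \<subseteq> D" "\<And>r. 0 < r \<Longrightarrow> r < 1 \<Longrightarrow>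
    (LINT t|unif01. ln (max (norm (f (circ r t) - w)) e) - ln (norm (f (circ r t) - w))) \<le> green w - cnt r w"
    by (rule mean_near_interior[OF w]) (rule that)
  let ?g = "\<lambda>n t. ln (max (norm (f (circ (rad (\<sigma> n)) t) - w)) e) - ln (norm (f (circ (rad (\<sigma> n)) t) - w))"
  have [measurable]: "(\<lambda>t. f (circ (rad n) t)) \<in> borel_measurable unif01" for n
    using rad by (intro measurable_holomorphic_circle hol) auto
  have ne: "AE t in unif01. \<forall>n. f (circ (rad (\<sigma> n)) t) \<noteq> w"
    unfolding AE_all_countable using AE_f_circle_neq rad by blast
  have nn: "(\<integral>\<^sup>+ t. ennreal (?g n t) \<partial>unif01) \<le> ennreal (green w - cnt (rad (\<sigma> n)) w)" for n
  proof -
    have "integrable unif01 (?g n)"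
      using cartan(1)[OF rad(1,2) e(1)] jensen(1)[OF rad(1,2) w(2)]
        by (rule Bochner_Integration.integrable_diff)
    moreover have "AE t in unif01. 0 \<le> ?g n t"
      using ne
    proof eventually_elim
      case (elim t)
      have "ln (norm (f (circ (rad (\<sigma> n)) t) - w)) \<le> ln (max (norm (f (circ (rad (\<sigma> n)) t) - w)) e)"
        using elim by (subst ln_le_cancel_iff) (auto simp: less_max_iff_disj)
      then show ?case by simp
    qed
    ultimately have "(\<integral>\<^sup>+ t. ennreal (?g n t) \<partial>unif01) = ennreal (LINT t|unif01. ?g n t)"
      by (rule nn_integral_eq_integral)
    then show ?thesis using e(3)[OF rad(1,2)] by (simp add: ennreal_leI)
  qed
  have "(\<lambda>n. cnt (rad (\<sigma> n)) w) \<longlonglongrightarrow> green w"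
    using LIMSEQ_subseq_LIMSEQ[OF cnt_tendsto_green[OF w(2) rad(1,2) rad_tendsto] \<sigma>] by (simp add: o_def)
  then have "(\<lambda>n. green w - cnt (rad (\<sigma> n)) w) \<longlonglongrightarrow> green w - green w" by (intro tendsto_diff tendsto_const)
  then have "(\<lambda>n. ennreal (green w - cnt (rad (\<sigma> n)) w)) \<longlonglongrightarrow> ennreal 0"
    by (intro tendsto_ennrealI) simp
  then have l0: "liminf (\<lambda>n. ennreal (green w - cnt (rad (\<sigma> n)) w)) = 0"
    by (subst lim_imp_Liminf[of sequentially _ "ennreal 0"]) auto
  have "(\<integral>\<^sup>+ t. liminf (\<lambda>n. ennreal (?g n t)) \<partial>unif01) \<le> liminf (\<lambda>n. \<integral>\<^sup>+ t. ennreal (?g n t) \<partial>unif01)"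
    by (rule nn_integral_liminf) measurable
  also have "\<dots> \<le> liminf (\<lambda>n. ennreal (green w - cnt (rad (\<sigma> n)) w))"
    by (intro Liminf_mono always_eventually allI nn)
  finally have "(\<integral>\<^sup>+ t. liminf (\<lambda>n. ennreal (?g n t)) \<partial>unif01) = 0" using l0 by simp
  then have ae0: "AE t in unif01. liminf (\<lambda>n. ennreal (?g n t)) = 0"
    by (subst (asm) nn_integral_0_iff_AE) auto
  have "AE t in unif01. F t \<notin> ball w e"
    using ae0 ne F
  proof eventually_elim
    case (elim t)
    let ?x = "\<lambda>n. f (circ (rad (\<sigma> n)) t)"
    show ?case
    proof
      assume "F t \<in> ball w e"
      then have d: "norm (F t - w) < e" by (simp add: dist_norm norm_minus_commute)
      define c where "c = (norm (F t - w) + e) / 2"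
      have c: "norm (F t - w) < c" "c < e" using d by (auto simp: c_def)
      have c0: "0 < c" using c(1) by (meson norm_ge_zero le_less_trans)
      have "(\<lambda>n. norm (?x n - w)) \<longlonglongrightarrow> norm (F t - w)" by (intro tendsto_intros elim)
      then have "\<forall>\<^sub>F n in sequentially. norm (?x n - w) < c" using c(1) by (rule order_tendstoD(2))
      then have "\<forall>\<^sub>F n in sequentially. ennreal (ln e - ln c) \<le> ennreal (?g n t)"
      proof eventually_elim
        case (elim n)
        have "ln (norm (?x n - w)) \<le> ln c"
          using elim \<open>\<forall>n. ?x n \<noteq> w\<close> c0 by (subst ln_le_cancel_iff) auto
        moreover have "max (norm (?x n - w)) e = e" using elim c by simp
        ultimately show ?case by (intro ennreal_leI) simp
      qed
      then have "ennreal (ln e - ln c) \<le> liminf (\<lambda>n. ennreal (?g n t))"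
        by (rule Liminf_bounded)
      with elim(1) have "ln e - ln c \<le> 0" by (simp add: ennreal_eq_0_iff)
      moreover have "ln c < ln e" using c c0 e(1) by (subst ln_less_cancel_iff) auto
      ultimately show False by simp
    qed
  qed
  then show thesis using that e by blast
qed

text \<open>The point 0 escapes the previous argument, because f - w vanishes at the centre for w =
  0. Jensen's formula for f(z) / z bounds the means of log^- |f| instead, and Fatou excludes the
  limit 0.\<close>

lemma boundary_values_nonzero:
  fixes \<sigma> :: "nat \<Rightarrow> nat"
  assumes F: "AE t in unif01. (\<lambda>n. f (circ (rad (\<sigma> n)) t)) \<longlonglongrightarrow> F t"
  shows "AE t in unif01. F t \<noteq> 0"
proof -
  define G where "G z = (if z = 0 then deriv f 0 else (f z - f 0) / (z - 0))" for z
  have G: "G holomorphic_on ball 0 1" unfolding G_def by (rule pole_lemma_open[OF hol open_ball])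
  have Gf: "f z = z * G z" for z using f0 by (simp add: G_def)
  have G0: "G 0 \<noteq> 0" using deriv_nonzero[of 0] by (simp add: G_def)
  have simple: "deriv G z \<noteq> 0" if z: "z \<in> ball 0 1" "G z = 0" for z
  proof
    assume "deriv G z = 0"
    then have "(G has_field_derivative 0) (at z)" using holomorphic_derivI[OF G open_ball z(1)] by simp
    then have "((\<lambda>z. z * G z) has_field_derivative 0) (at z)"
      by (auto intro!: derivative_eq_intros simp: z)
    then have "(f has_field_derivative 0) (at z)" unfolding Gf[symmetric] .
    then show False using deriv_nonzero[of z] z(1) DERIV_imp_deriv by force
  qed
  obtain C where C: "\<And>r. 0 \<le> r \<Longrightarrow> r < 1 \<Longrightarrow> (LINT t|unif01. ln (max 1 (norm (f (circ r t))))) \<le> C"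
    "\<And>r. 0 \<le> r \<Longrightarrow> r < 1 \<Longrightarrow> integrable unif01 (\<lambda>t. ln (max 1 (norm (f (circ r t)))))"
    using mean_log_plus_bounded by blast
  let ?g = "\<lambda>n t. ln (max 1 (norm (f (circ (rad (\<sigma> n)) t)))) - ln (norm (f (circ (rad (\<sigma> n)) t)))"
  have [measurable]: "(\<lambda>t. f (circ (rad n) t)) \<in> borel_measurable unif01" for n
    using rad by (intro measurable_holomorphic_circle hol) auto
  have ne: "AE t in unif01. \<forall>n. f (circ (rad (\<sigma> n)) t) \<noteq> 0"
    unfolding AE_all_countable using AE_f_circle_neq rad by blast
  \<comment> \<open>C bounds the means of log^+ |f|, and \<open>ln (1/2)\<close> stands for
    \<open>ln r\<close>, every radius being at least 1/2.\<close>
  define B where "B = C - ln (1/2) - ln (norm (G 0))"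
  have nn: "(\<integral>\<^sup>+ t. ennreal (?g n t) \<partial>unif01) \<le> ennreal B" for n
  proof -
    define r where "r = rad (\<sigma> n)"
    have r: "0 < r" "r < 1" "0 \<le> r" "1/2 \<le> r" using rad by (auto simp: r_def) (simp add: rad_def field_simps)
    have sub: "cball 0 r \<subseteq> ball (0::complex) 1" using r by auto
    note J = jensen_simple_zeros[OF G r(1,2) G0 simple[OF subsetD[OF sub]]]
    have nonneg: "0 \<le> (\<Sum>z\<in>{z \<in> cball 0 r. G z = 0}. ln (r / norm z))"
    proof (rule sum_nonneg)
      fix z assume "z \<in> {z \<in> cball 0 r. G z = 0}"
      then show "0 \<le> ln (r / norm z)" using G0 by (auto intro!: ln_ge_zero simp: divide_simps)
    qed
    have ln_f: "AE t in unif01. ln (norm (f (circ r t))) = ln r + ln (norm (G (circ r t)))"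
      using AE_f_circle_neq[OF r(1,2), of 0]
    proof eventually_elim
      case (elim t)
      then have "G (circ r t) \<noteq> 0" using Gf[of "circ r t"] by auto
      then show ?case unfolding Gf[of "circ r t"] using r by (simp add: norm_mult ln_mult)
    qed
    have mG: "(\<lambda>t. G (circ r t)) \<in> borel_measurable unif01"
      using r by (intro measurable_holomorphic_circle G) auto
    have mf: "(\<lambda>t. f (circ r t)) \<in> borel_measurable unif01" unfolding r_def by measurable
    have i1: "integrable unif01 (\<lambda>t. ln r + ln (norm (G (circ r t))))" using J(2) by simp
    have i2: "integrable unif01 (\<lambda>t. ln (norm (f (circ r t))))"
      by (rule integrable_cong_AE_imp[OF i1]) (use mf ln_f in \<open>auto elim!: eventually_mono\<close>)
    have "(LINT t|unif01. ln (norm (f (circ r t)))) = (LINT t|unif01. ln r + ln (norm (G (circ r t))))"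
      by (rule integral_cong_AE) (use mf mG ln_f in auto)
    also have "\<dots> \<ge> ln (1/2) + ln (norm (G 0))"
    proof -
      have "ln (1/2) \<le> ln r" using r by (subst ln_le_cancel_iff) auto
      then show ?thesis using J(2,3) nonneg by simp
    qed
    finally have ge: "ln (1/2) + ln (norm (G 0)) \<le> (LINT t|unif01. ln (norm (f (circ r t))))" .
    have int: "integrable unif01 (?g n)"
      using C(2)[OF r(3,2)] i2 unfolding r_def by (rule Bochner_Integration.integrable_diff)
    have "AE t in unif01. 0 \<le> ?g n t"
      using ne
    proof eventually_elim
      case (elim t)
      have "ln (norm (f (circ (rad (\<sigma> n)) t))) \<le> ln (max 1 (norm (f (circ (rad (\<sigma> n)) t))))"
        using elim by (subst ln_le_cancel_iff) (auto simp: less_max_iff_disj)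
      then show ?case by simp
    qed
    with int have "(\<integral>\<^sup>+ t. ennreal (?g n t) \<partial>unif01) = ennreal (LINT t|unif01. ?g n t)"
      by (rule nn_integral_eq_integral)
    moreover have "(LINT t|unif01. ?g n t) \<le> B"
      using C[OF r(3,2)] i2 ge unfolding r_def B_def by simp
    ultimately show ?thesis by (simp add: ennreal_leI)
  qed
  have "(\<integral>\<^sup>+ t. liminf (\<lambda>n. ennreal (?g n t)) \<partial>unif01) \<le> liminf (\<lambda>n. \<integral>\<^sup>+ t. ennreal (?g n t) \<partial>unif01)"
    by (rule nn_integral_liminf) measurable
  also have "\<dots> \<le> liminf (\<lambda>n::nat. ennreal B)"
    by (intro Liminf_mono always_eventually allI nn)
  also have "\<dots> = ennreal B" by (simp add: Liminf_const)
  finally have fin: "(\<integral>\<^sup>+ t. liminf (\<lambda>n. ennreal (?g n t)) \<partial>unif01) \<noteq> \<infinity>"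
    by (metis ennreal_less_top infinity_ennreal_def leD)
  have m: "(\<lambda>t. liminf (\<lambda>n. ennreal (?g n t))) \<in> borel_measurable unif01" by measurable
  show ?thesis
    using nn_integral_noteq_infinite[OF m fin] ne F
  proof eventually_elim
    case (elim t)
    let ?x = "\<lambda>n. f (circ (rad (\<sigma> n)) t)"
    show ?case
    proof
      assume "F t = 0"
      with elim(3) have "(\<lambda>n. norm (?x n)) \<longlonglongrightarrow> 0" using tendsto_norm_zero by simp
      then have "filterlim (\<lambda>n. norm (?x n)) (at_right 0) sequentially"
        using elim(2) by (simp add: filterlim_at)
      then have "filterlim (\<lambda>n. ln (norm (?x n))) at_bot sequentially"
        by (rule filterlim_compose[OF ln_at_0])
      then have t: "filterlim (\<lambda>n. - ln (norm (?x n))) at_top sequentially"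
        by (simp add: filterlim_uminus_at_bot)
      have "filterlim (\<lambda>n. ?g n t) at_top sequentially"
        by (rule filterlim_at_top_mono[OF t]) (auto intro!: always_eventually)
      then have "(\<lambda>n. ennreal (?g n t)) \<longlonglongrightarrow> \<infinity>"
        by (simp add: ennreal_tendsto_top_eq_at_top)
      then have "liminf (\<lambda>n. ennreal (?g n t)) = \<infinity>"
        by (rule lim_imp_Liminf[rotated]) simp
      with elim(1) show False by simp
    qed
  qed
qed

text \<open>Each avoided ball brings its own null set, so D - {0} is first covered by countably many
  of these balls, by Lindelof.\<close>

lemma boundary_values_frontier:
  fixes \<sigma> :: "nat \<Rightarrow> nat"
  assumes \<sigma>: "strict_mono \<sigma>" and F: "AE t in unif01. (\<lambda>n. f (circ (rad (\<sigma> n)) t)) \<longlonglongrightarrow> F t"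
  shows "AE t in unif01. F t \<in> frontier D"
proof -
  have "\<exists>e. e > 0 \<and> ball w e \<subseteq> D \<and> (AE t in unif01. F t \<notin> ball w e)" if "w \<in> D - {0}" for w
    using boundary_values_avoid_ball[OF \<sigma> F, of w] that by blast
  then obtain e where e: "\<And>w. w \<in> D - {0} \<Longrightarrow> e w > 0" "\<And>w. w \<in> D - {0} \<Longrightarrow> (AE t in unif01. F t \<notin> ball w (e w))"
    by metis
  obtain \<B> where \<B>: "\<B> \<subseteq> (\<lambda>w. ball w (e w)) ` (D - {0})" "countable \<B>" "\<Union>\<B> = \<Union>((\<lambda>w. ball w (e w)) ` (D - {0}))"
    using Lindelof[of "(\<lambda>w. ball w (e w)) ` (D - {0})"] by auto
  have "AE t in unif01. \<forall>X\<in>\<B>. F t \<notin> X"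
  proof (subst AE_ball_countable[OF \<B>(2)], intro ballI)
    fix X assume "X \<in> \<B>"
    then obtain w where "w \<in> D - {0}" "X = ball w (e w)" using \<B>(1) by blast
    then show "AE t in unif01. F t \<notin> X" using e(2) by simp
  qed
  moreover have "AE t in unif01. F t \<noteq> 0" by (rule boundary_values_nonzero[OF F])
  ultimately show ?thesis using F
  proof eventually_elim
    case (elim t)
    have "F t \<in> closure D"
    proof -
      have "f (circ (rad (\<sigma> n)) t) \<in> D" for n
        using rad by (intro f_in_D) (simp add: norm_mult)
      with elim(3) show ?thesis unfolding closure_sequential
        by (intro exI[of _ "\<lambda>n. f (circ (rad (\<sigma> n)) t)"]) auto
    qed
    moreover have "F t \<notin> D"
    proof
      assume "F t \<in> D"
      with elim(2) have "F t \<in> D - {0}" by simp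
      then have "F t \<in> ball (F t) (e (F t))" using e(1) by simp
      then have "F t \<in> \<Union>((\<lambda>w. ball w (e w)) ` (D - {0}))" using \<open>F t \<in> D - {0}\<close> by blast
      then have "F t \<in> \<Union>\<B>" using \<B>(3) by simp
      with elim(1) show False by blast
    qed
    ultimately show ?case using openD by (simp add: frontier_def interior_open)
  qed
qed

text \<open>Lower semicontinuity of the kernel, also on the diagonal, where both sides are infinite.
  It lets Fatou pass from values of f to boundary values.\<close>

lemma log_kernel_liminf:
  assumes "x \<longlonglongrightarrow> a" "\<And>n. x n \<noteq> z"
  shows "log_kernel 1 z a \<le> liminf (\<lambda>n. log_kernel 1 z (x n))"
proof (cases "z = a")
  case True
  have "(\<lambda>n. norm (z - x n)) \<longlonglongrightarrow> norm (z - a)" by (intro tendsto_intros assms)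
  then have "filterlim (\<lambda>n. norm (z - x n)) (at_right 0) sequentially"
    using assms(2) True by (simp add: filterlim_at) (metis (mono_tags) always_eventually eq_iff_diff_eq_0)
  then have "filterlim (\<lambda>n. ln (norm (z - x n))) at_bot sequentially"
    by (rule filterlim_compose[OF ln_at_0])
  then have "filterlim (\<lambda>n. - ln (norm (z - x n))) at_top sequentially"
    by (simp add: filterlim_uminus_at_bot)
  then have "(\<lambda>n. ennreal (- ln (norm (z - x n)))) \<longlonglongrightarrow> \<infinity>"
    by (simp add: ennreal_tendsto_top_eq_at_top)
  moreover have "log_kernel 1 z (x n) = ennreal (- ln (norm (z - x n)))" for n
    using assms(2)[of n] by (auto simp: log_kernel_def)
  ultimately have "(\<lambda>n. log_kernel 1 z (x n)) \<longlonglongrightarrow> \<infinity>" by simp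
  then have "liminf (\<lambda>n. log_kernel 1 z (x n)) = \<infinity>" by (rule lim_imp_Liminf[rotated]) simp
  then show ?thesis by simp
next
  case False
  then have "(\<lambda>n. ennreal (ln 1 - ln (norm (z - x n)))) \<longlonglongrightarrow> ennreal (ln 1 - ln (norm (z - a)))"
    by (intro tendsto_ennrealI tendsto_intros assms(1)) auto
  moreover have "log_kernel 1 z (x n) = ennreal (ln 1 - ln (norm (z - x n)))" for n
    using assms(2)[of n] by (auto simp: log_kernel_def)
  ultimately have "(\<lambda>n. log_kernel 1 z (x n)) \<longlonglongrightarrow> log_kernel 1 z a" using False by (simp add: log_kernel_def)
  then have "liminf (\<lambda>n. log_kernel 1 z (x n)) = log_kernel 1 z a" by (rule lim_imp_Liminf[rotated]) simp
  then show ?thesis by simp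
qed

text \<open>Harmonic measure, i.e. the law of the boundary values, has finite energy on compact sets
  off \<open>D\<close>, since Jensen's formula bounds the proximity function.\<close>

lemma boundary_values_avoid_polar:
  fixes \<sigma> :: "nat \<Rightarrow> nat"
  assumes Fm: "F \<in> borel_measurable unif01"
    and F: "AE t in unif01. (\<lambda>n. f (circ (rad (\<sigma> n)) t)) \<longlonglongrightarrow> F t"
    and E: "E \<in> sets borel" "polar E" "E \<inter> D = {}"
  shows "AE t in unif01. F t \<notin> E"
proof (rule ccontr)
  assume not_ae: "\<not> (AE t in unif01. F t \<notin> E)"
  note [measurable] = Fm
  define \<omega> where "\<omega> = distr unif01 borel F"
  interpret W: prob_space \<omega> unfolding \<omega>_def by (rule unif01.prob_space_distr) measurable
  have sets\<omega>: "sets \<omega> = sets borel" and space\<omega>: "space \<omega> = UNIV" by (auto simp: \<omega>_def)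
  have "emeasure \<omega> E > 0"
  proof -
    have "AE t in unif01. F t \<notin> E" if "emeasure \<omega> E = 0"
    proof -
      have "E \<in> null_sets \<omega>" using that E(1) sets\<omega> by (auto simp: null_sets_def)
      then have "AE x in \<omega>. x \<notin> E" by (rule AE_not_in)
      then show ?thesis unfolding \<omega>_def using E(1) by (subst (asm) AE_distr_iff) auto
    qed
    with not_ae show ?thesis by (auto simp: zero_less_iff_neq_zero)
  qed
  moreover have "emeasure \<omega> E = (SUP K\<in>{K. K \<subseteq> E \<and> compact K}. emeasure \<omega> K)"
    using E(1) sets\<omega> by (intro inner_regular) auto
  ultimately obtain K where K: "compact K" "K \<subseteq> E" "emeasure \<omega> K > 0"
    by (auto simp: less_SUP_iff)
  obtain C where C: "\<And>r. 0 \<le> r \<Longrightarrow> r < 1 \<Longrightarrow> (LINT t|unif01. ln (max 1 (norm (f (circ r t))))) \<le> C"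
    "\<And>r. 0 \<le> r \<Longrightarrow> r < 1 \<Longrightarrow> integrable unif01 (\<lambda>t. ln (max 1 (norm (f (circ r t)))))"
    using mean_log_plus_bounded by blast
  have zK: "z \<notin> D" "z \<noteq> 0" if "z \<in> K" for z using that K(2) E(3) zero_in_D by auto
  \<comment> \<open>As 0 lies in D, the compact set K stays away from it and the Jensen bound is
    uniform on K.\<close>
  have "continuous_on K (\<lambda>z. C + ln (max 1 (norm z)) + ln 2 - ln (norm z))"
    using zK by (intro continuous_intros) (auto simp: max_def)
  then have "bounded ((\<lambda>z. C + ln (max 1 (norm z)) + ln 2 - ln (norm z)) ` K)"
    using K(1) compact_continuous_image compact_imp_bounded by blast
  then obtain B where B: "\<And>z. z \<in> K \<Longrightarrow> C + ln (max 1 (norm z)) + ln 2 - ln (norm z) \<le> B"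
    by (auto simp: bounded_iff abs_le_iff)
  have prox: "proximity 1 n z \<le> B" if z: "z \<in> K" for n z
  proof -
    have "ln (norm z) + proximity 1 n z = (LINT t|unif01. ln (max (norm (f (circ (rad n) t) - z)) 1))"
      using proximity_eq[of z 1 n] zK[OF z] by simp
    also have "\<dots> \<le> (LINT t|unif01. ln (max 1 (norm (f (circ (rad n) t)))) + (ln (max 1 (norm z)) + ln 2))"
    proof (rule integral_mono)
      show "integrable unif01 (\<lambda>t. ln (max (norm (f (circ (rad n) t) - z)) 1))"
        using cartan(1)[OF rad(1,2), of 1] by simp
      show "integrable unif01 (\<lambda>t. ln (max 1 (norm (f (circ (rad n) t)))) + (ln (max 1 (norm z)) + ln 2))"
        using C(2)[OF rad(3,2), of n] by simp
      show "ln (max (norm (x - z)) 1) \<le> ln (max 1 (norm x)) + (ln (max 1 (norm z)) + ln 2)" for x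
      proof (cases "norm (x - z) \<le> 1")
        case True
        then show ?thesis by (simp add: max_absorb2)
      next
        case False
        then show ?thesis using ln_norm_diff_le[of x z] by (simp add: max_absorb1)
      qed
    qed
    also have "\<dots> \<le> C + (ln (max 1 (norm z)) + ln 2)"
      using C[OF rad(3,2), of n] by simp
    finally show ?thesis using B[OF z] by simp
  qed
  have pot: "(\<integral>\<^sup>+ w. log_kernel 1 z w \<partial>\<omega>) \<le> ennreal B" if z: "z \<in> K" for z
  proof -
    have [measurable]: "(\<lambda>t. f (circ (rad n) t)) \<in> borel_measurable unif01" for n
      using rad by (intro measurable_holomorphic_circle hol) auto
    have ne: "f (circ (rad n) t) \<noteq> z" for n t
    proof -
      have "norm (circ (rad n) t) < 1" using rad[of n] by (simp add: norm_mult)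
      from f_in_D[OF this] zK(1)[OF z] show ?thesis by auto
    qed
    have "(\<integral>\<^sup>+ w. log_kernel 1 z w \<partial>\<omega>) = (\<integral>\<^sup>+ t. log_kernel 1 z (F t) \<partial>unif01)"
      unfolding \<omega>_def by (rule nn_integral_distr) measurable
    also have "\<dots> \<le> (\<integral>\<^sup>+ t. liminf (\<lambda>n. log_kernel 1 z (f (circ (rad (\<sigma> n)) t))) \<partial>unif01)"
      using F by (intro nn_integral_mono_AE) (auto elim!: eventually_mono intro!: log_kernel_liminf ne)
    also have "\<dots> \<le> liminf (\<lambda>n. \<integral>\<^sup>+ t. log_kernel 1 z (f (circ (rad (\<sigma> n)) t)) \<partial>unif01)"
      by (rule nn_integral_liminf) measurable
    also have "\<dots> \<le> liminf (\<lambda>n::nat. ennreal B)"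
    proof (intro Liminf_mono always_eventually allI)
      fix n
      let ?x = "\<lambda>t. f (circ (rad (\<sigma> n)) t)"
      have g0: "0 \<le> ln (max (norm (?x t - z)) 1) - ln (norm (?x t - z))" for t
      proof -
        have "ln (norm (?x t - z)) \<le> ln (max (norm (?x t - z)) 1)"
          using ne by (subst ln_le_cancel_iff) (auto simp: less_max_iff_disj)
        then show ?thesis by simp
      qed
      have "(\<integral>\<^sup>+ t. log_kernel 1 z (?x t) \<partial>unif01) \<le>
        (\<integral>\<^sup>+ t. ennreal (ln (max (norm (?x t - z)) 1) - ln (norm (?x t - z))) \<partial>unif01)"
      proof (rule nn_integral_mono)
        fix t
        have "log_kernel 1 z (?x t) = ennreal (- ln (norm (?x t - z)))"
          using ne[of "\<sigma> n" t] by (auto simp: log_kernel_def norm_minus_commute)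
        also have "\<dots> \<le> ennreal (ln (max (norm (?x t - z)) 1) - ln (norm (?x t - z)))"
          by (intro ennreal_leI) simp
        finally show "log_kernel 1 z (?x t) \<le> ennreal (ln (max (norm (?x t - z)) 1) - ln (norm (?x t - z)))" .
      qed
      also have "\<dots> = ennreal (proximity 1 (\<sigma> n) z)"
        unfolding proximity_def
      proof (rule nn_integral_eq_integral)
        show "integrable unif01 (\<lambda>t. ln (max (norm (?x t - z)) 1) - ln (norm (?x t - z)))"
          using cartan(1)[OF rad(1,2), of 1] jensen(1)[OF rad(1,2) zK(2)[OF z]]
            by (intro Bochner_Integration.integrable_diff) auto
      qed (use g0 in auto)
      also have "\<dots> \<le> ennreal B" by (intro ennreal_leI prox z)
      finally show "(\<integral>\<^sup>+ t. log_kernel 1 z (?x t) \<partial>unif01) \<le> ennreal B" .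
    qed
    also have "\<dots> = ennreal B" by (simp add: Liminf_const)
    finally show ?thesis .
  qed
  \<comment> \<open>The part of the law on K has positive mass and compact support in a polar set,
    so its energy must be infinite; the bounded potential makes it finite.\<close>
  define \<mu> where "\<mu> = density \<omega> (indicator K)"
  note \<mu> = restricted_measure[OF sets\<omega> W.finite_measure_axioms K(1), folded \<mu>_def]
  have "(\<integral>\<^sup>+ z. (\<integral>\<^sup>+ w. log_kernel_neg z w \<partial>\<mu>) \<partial>\<mu>) = \<infinity>"
    using E(2) K \<mu>(1-4) unfolding polar_def by (metis less_irrefl)
  moreover have "(\<integral>\<^sup>+ z. (\<integral>\<^sup>+ w. log_kernel_neg z w \<partial>\<mu>) \<partial>\<mu>) \<le> ennreal B"
  proof -
    note [measurable_cong] = sets\<omega>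
    have inner: "(\<integral>\<^sup>+ w. log_kernel_neg z w \<partial>\<mu>) \<le> ennreal B" if "z \<in> K" for z
    proof -
      have "(\<integral>\<^sup>+ w. log_kernel 1 z w \<partial>\<mu>) = (\<integral>\<^sup>+ w. indicator K w * log_kernel 1 z w \<partial>\<omega>)"
        by (rule \<mu>(5)) measurable
      also have "\<dots> \<le> (\<integral>\<^sup>+ w. log_kernel 1 z w \<partial>\<omega>)"
        by (intro nn_integral_mono) (auto simp: indicator_def)
      also have "\<dots> \<le> ennreal B" by (rule pot[OF that])
      finally show ?thesis by (simp add: log_kernel_1)
    qed
    have "AE z in \<mu>. z \<in> K" by (rule AE_mem_of_null_complement[OF \<mu>(1) K(1) \<mu>(4)])
    then have "(\<integral>\<^sup>+ z. (\<integral>\<^sup>+ w. log_kernel_neg z w \<partial>\<mu>) \<partial>\<mu>) \<le> (\<integral>\<^sup>+ z. ennreal B \<partial>\<mu>)"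
      using inner by (intro nn_integral_mono_AE) (auto elim!: eventually_mono)
    also have "\<dots> = ennreal B * emeasure \<omega> K" by (simp add: \<mu>(3))
    also have "\<dots> \<le> ennreal B * 1"
      using W.emeasure_le_1[of K] by (intro mult_left_mono) auto
    finally show ?thesis by simp
  qed
  ultimately show False by (simp add: top_unique)
qed

end

section \<open>Identification of the Green function\<close>

text \<open>For arbitrary g, convergence to 0 fails at a frontier point exactly when some set {|g|
  >= 1/(n+1)} accumulates there, and for each n this is a countable intersection of open
  conditions.\<close>

lemma exceptional_set_borel:
  fixes g :: "complex \<Rightarrow> real"
  assumes "open D"
  shows "{\<zeta> \<in> frontier D. \<not> (g \<longlongrightarrow> 0) (at \<zeta> within D)} \<in> sets borel"
proof -
  define U where "U n m = (\<Union>w\<in>{w \<in> D. \<bar>g w\<bar> \<ge> 1 / real (Suc n)}. ball w (1 / real (Suc m)))" for n m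
  have "\<zeta> \<notin> D" if "\<zeta> \<in> frontier D" for \<zeta>
    using that assms by (simp add: frontier_def interior_open)
  have eq: "{\<zeta> \<in> frontier D. \<not> (g \<longlongrightarrow> 0) (at \<zeta> within D)} = frontier D \<inter> (\<Union>n. \<Inter>m. U n m)"
  proof (intro equalityI subsetI)
    fix \<zeta> assume z: "\<zeta> \<in> {\<zeta> \<in> frontier D. \<not> (g \<longlongrightarrow> 0) (at \<zeta> within D)}"
    then obtain e where e: "e > 0" "\<And>d. d > 0 \<Longrightarrow> \<exists>x\<in>D. dist x \<zeta> < d \<and> \<bar>g x\<bar> \<ge> e"
      unfolding Lim_within by (force simp: not_less)
    obtain n where n: "1 / real (Suc n) < e" using nat_approx_posE[OF e(1)] by (auto simp: field_simps)
    have "\<zeta> \<in> U n m" for m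
    proof -
      obtain x where "x \<in> D" "dist x \<zeta> < 1 / real (Suc m)" "\<bar>g x\<bar> \<ge> e" using e(2)[of "1 / real (Suc m)"] by auto
      with n show ?thesis unfolding U_def by (intro UN_I[of x]) auto
    qed
    with z show "\<zeta> \<in> frontier D \<inter> (\<Union>n. \<Inter>m. U n m)" by blast
  next
    fix \<zeta> assume z: "\<zeta> \<in> frontier D \<inter> (\<Union>n. \<Inter>m. U n m)"
    then obtain n where n: "\<And>m. \<zeta> \<in> U n m" by blast
    have "\<not> (g \<longlongrightarrow> 0) (at \<zeta> within D)"
    proof
      assume "(g \<longlongrightarrow> 0) (at \<zeta> within D)"
      then obtain d where d: "d > 0" "\<And>x. x \<in> D \<Longrightarrow> 0 < dist x \<zeta> \<Longrightarrow> dist x \<zeta> < d \<Longrightarrow> \<bar>g x\<bar> < 1 / real (Suc n)"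
        unfolding Lim_within by (metis dist_0_norm dist_commute of_nat_0_less_iff real_norm_def
          zero_less_Suc zero_less_divide_1_iff)
      obtain m where m: "1 / real (Suc m) < d" using nat_approx_posE[OF d(1)] by (auto simp: field_simps)
      obtain w where w: "w \<in> D" "\<bar>g w\<bar> \<ge> 1 / real (Suc n)" "dist w \<zeta> < 1 / real (Suc m)"
        using n[of m] unfolding U_def by auto
      have "w \<noteq> \<zeta>" using w(1) z assms by (auto simp: frontier_def interior_open)
      then show False using d(2)[OF w(1)] w(2,3) m by auto
    qed
    with z show "\<zeta> \<in> {\<zeta> \<in> frontier D. \<not> (g \<longlongrightarrow> 0) (at \<zeta> within D)}" by blast
  qed
  have "U n m \<in> sets borel" for n m unfolding U_def by (intro borel_open open_UN) auto
  then show ?thesis unfolding eq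
    by (intro sets.Int sets.countable_UN sets.countable_INT') (auto intro: borel_closed)
qed

context greenian_covering
begin

text \<open>\<open>is_green0\<close> prescribes the value 0 at the pole, where
  \<open>green 0\<close> still sums over the solutions of f z = 0 other than the origin.\<close>

definition green_pole :: "complex \<Rightarrow> real" where
  "green_pole z = (if z = 0 then 0 else green z)"

lemma is_green0_green: "is_green0 D green_pole"
  unfolding is_green0_def
proof (intro conjI allI impI)
  show "harmonic_on green_pole (D - {0})"
    using green_harmonic by (rule harmonic_on_cong) (simp add: green_pole_def)
  show "bounded (green_pole ` (D - ball 0 r))" if "0 < r" for r
  proof -
    have "green_pole ` (D - ball 0 r) \<subseteq> green ` (- ball 0 r)"
      using that by (auto simp: green_pole_def)
    then show ?thesis using green_bounded_off_0[OF that] bounded_subset by blast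
  qed
  obtain r where r: "r > 0" "bounded ((\<lambda>w. green w + ln (norm w)) ` (ball 0 r - {0}))"
    by (rule green_near_0) (rule that)
  have "(\<lambda>z. green_pole z + ln (norm z)) ` (ball 0 r - {0}) = (\<lambda>w. green w + ln (norm w)) ` (ball 0 r - {0})"
    by (intro image_cong) (auto simp: green_pole_def)
  then show "\<exists>r>0. bounded ((\<lambda>z. green_pole z + ln (norm z)) ` (ball 0 r - {0}))"
    using r by metis
  have "(green_pole \<longlongrightarrow> 0) (at \<zeta> within D) \<longleftrightarrow> (green \<longlongrightarrow> 0) (at \<zeta> within D)" if "\<zeta> \<in> frontier D" for \<zeta>
  proof (rule filterlim_cong[OF refl refl])
    have "\<zeta> \<noteq> 0" using that openD zero_in_D by (auto simp: frontier_def interior_open)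
    then have "\<forall>\<^sub>F w in nhds \<zeta>. w \<noteq> 0" by (rule t1_space_nhds)
    then show "\<forall>\<^sub>F w in at \<zeta> within D. green_pole w = green w"
      unfolding eventually_at_filter by (rule eventually_mono) (simp add: green_pole_def)
  qed
  then have "{\<zeta> \<in> frontier D. \<not> (green_pole \<longlongrightarrow> 0) (at \<zeta> within D)} =
    {\<zeta> \<in> frontier D. \<not> (green \<longlongrightarrow> 0) (at \<zeta> within D)}"
    by blast
  then show "polar {\<zeta> \<in> frontier D. \<not> (green_pole \<longlongrightarrow> 0) (at \<zeta> within D)}"
    using green_boundary_polar by simp
  show "green_pole z = 0" if "z \<notin> D - {0}" for z
    using that green_outside by (auto simp: green_pole_def)
qed

text \<open>The hypothesis ranges over all sequences and boundary functions since these are chosen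
  inside the proof. Boundary values lie outside D, so f approaches them without attaining them and
  the limit within D applies to the composition of h with f.\<close>

lemma bounded_harmonic_zero:
  assumes h: "harmonic_on h D" and M: "\<And>z. z \<in> D \<Longrightarrow> \<bar>h z\<bar> \<le> M"
    and lim: "\<And>\<sigma> F. strict_mono \<sigma> \<Longrightarrow> F \<in> borel_measurable unif01 \<Longrightarrow>
      (AE t in unif01. (\<lambda>n. f (circ (rad (\<sigma> n)) t)) \<longlonglongrightarrow> F t) \<Longrightarrow>
      AE t in unif01. (h \<longlongrightarrow> 0) (at (F t) within D)"
    and z: "z \<in> D"
  shows "h z = 0"
proof -
  have "harmonic_on (\<lambda>z. h (f z)) (ball 0 1)"
    by (rule harmonic_on_compose[OF h hol]) (use image_f in auto)
  then obtain \<Phi> where \<Phi>: "\<Phi> holomorphic_on ball 0 1" "\<And>z. z \<in> ball 0 1 \<Longrightarrow> h (f z) = Re (\<Phi> z)"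
    using harmonic_on_convex_Re[OF _ convex_ball] by metis
  obtain \<sigma> :: "nat \<Rightarrow> nat" and F where F: "strict_mono \<sigma>" "F \<in> borel_measurable unif01"
    "AE t in unif01. (\<lambda>n. f (circ (rad (\<sigma> n)) t)) \<longlonglongrightarrow> F t"
    by (rule boundary_values) (rule that)
  have disc: "circ (rad n) t \<in> ball 0 1" for n t using rad[of n] by (simp add: norm_mult)
  have lim': "AE t in unif01. (\<lambda>n. Re (\<Phi> (circ (rad (\<sigma> n)) t))) \<longlonglongrightarrow> 0"
    using F(3) lim[OF F] boundary_values_frontier[OF F(1,3)]
  proof eventually_elim
    case (elim t)
    let ?x = "\<lambda>n. f (circ (rad (\<sigma> n)) t)"
    have xD: "?x n \<in> D" for n using disc[of "\<sigma> n" t] f_in_D by simp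
    have "F t \<notin> D" using elim(3) openD by (simp add: frontier_def interior_open)
    then have "?x n \<noteq> F t" for n using xD by metis
    then have "filterlim ?x (at (F t) within D) sequentially"
      using elim(1) xD by (auto simp: filterlim_at)
    from filterlim_compose[OF elim(2) this]
    show ?case using \<Phi>(2)[OF disc] by simp
  qed
  obtain y where y: "y \<in> ball 0 1" "f y = z" using image_f z by (metis imageE)
  have "Re (\<Phi> y) = 0"
  proof (rule Re_zero_of_boundary_zero[OF \<Phi>(1) _ lim' y(1)])
    show "\<bar>Re (\<Phi> z)\<bar> \<le> M" if "z \<in> ball 0 1" for z
      using M[of "f z"] \<Phi>(2)[OF that] f_in_D that by simp
  qed
  then show ?thesis using \<Phi>(2)[OF y(1)] y(2) by simp
qed

text \<open>The logarithmic poles cancel in the difference of two candidates, which is therefore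
  bounded and extends over 0. Almost every boundary value avoids each of the two polar exceptional
  sets, so the difference tends to 0 there.\<close>

lemma green0_unique:
  assumes g: "is_green0 D g"
  shows "g = green_pole"
proof -
  define h where "h z = 1 * g z + (-1) * green_pole z + 0" for z
  note g' = g[unfolded is_green0_def]
  note G' = is_green0_green[unfolded is_green0_def]
  have harm: "harmonic_on h (D - {0})"
    unfolding h_def using g' G' by (intro harmonic_on_linear) blast+
  have bd: "\<exists>B. \<forall>z\<in>S. \<bar>u z\<bar> \<le> B" if "bounded (u ` S)" for u :: "complex \<Rightarrow> real" and S
    using that unfolding bounded_iff by (metis imageI real_norm_def)
  obtain r1 where r1: "r1 > 0" "bounded ((\<lambda>z. g z + ln (norm z)) ` (ball 0 r1 - {0}))" using g' by blast
  from bd[OF r1(2)] obtain B1 where 1: "r1 > 0" "\<And>z. z \<in> ball 0 r1 - {0} \<Longrightarrow> \<bar>g z + ln (norm z)\<bar> \<le> B1"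
    using r1(1) by blast
  obtain r2 where r2: "r2 > 0" "bounded ((\<lambda>z. green_pole z + ln (norm z)) ` (ball 0 r2 - {0}))" using G'
    by blast
  from bd[OF r2(2)] obtain B2 where 2: "r2 > 0" "\<And>z. z \<in> ball 0 r2 - {0} \<Longrightarrow> \<bar>green_pole z + ln (norm z)\<bar> \<le> B2"
    using r2(1) by blast
  obtain r3 where 3: "r3 > 0" "ball 0 r3 \<subseteq> D" using openD zero_in_D open_contains_ball by blast
  define r where "r = min r1 (min r2 r3)"
  have r: "r > 0" "ball 0 r \<subseteq> D" using 1 2 3 by (auto simp: r_def)
  have "bounded (g ` (D - ball 0 r))" "bounded (green_pole ` (D - ball 0 r))" using g' G' r(1) by blast+
  from this[THEN bd] obtain B3 B4 where 4: "\<And>z. z \<in> D - ball 0 r \<Longrightarrow> \<bar>g z\<bar> \<le> B3"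
    "\<And>z. z \<in> D - ball 0 r \<Longrightarrow> \<bar>green_pole z\<bar> \<le> B4"
    by blast
  define M where "M = \<bar>B1\<bar> + \<bar>B2\<bar> + \<bar>B3\<bar> + \<bar>B4\<bar>"
  have M: "\<bar>h z\<bar> \<le> M" if z: "z \<in> D - {0}" for z
  proof (cases "z \<in> ball 0 r")
    case True
    then have "\<bar>g z + ln (norm z)\<bar> \<le> B1" "\<bar>green_pole z + ln (norm z)\<bar> \<le> B2"
      using 1(2)[of z] 2(2)[of z] z by (auto simp: r_def)
    then show ?thesis unfolding h_def M_def by linarith
  next
    case False
    then show ?thesis using 4[of z] z unfolding h_def M_def by force
  qed
  have hP: "harmonic_on h (ball 0 r - {0})"
    by (rule harmonic_on_subset[OF harm]) (use r in auto)
  obtain v where v: "harmonic_on v (ball 0 r)" "\<And>z. z \<in> ball 0 r - {0} \<Longrightarrow> v z = h z"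
  proof (rule harmonic_removable[OF hP r(1)])
    show "\<bar>h z\<bar> \<le> M" if "z \<in> ball 0 r - {0}" for z using M r(2) that by blast
  qed (rule that)
  define h' where "h' z = (if z = 0 then v 0 else h z)" for z
  have harm': "harmonic_on h' D"
  proof (rule harmonic_on_local[OF openD])
    fix z assume z: "z \<in> D"
    show "\<exists>T. z \<in> T \<and> T \<subseteq> D \<and> harmonic_on h' T"
    proof (cases "z = 0")
      case True
      have "harmonic_on h' (ball 0 r)" by (rule harmonic_on_cong[OF v(1)]) (use v(2) in \<open>auto simp: h'_def\<close>)
      then show ?thesis using True r by (intro exI[of _ "ball 0 r"]) auto
    next
      case False
      have "harmonic_on h' (D - {0})" by (rule harmonic_on_cong[OF harm]) (auto simp: h'_def)
      then show ?thesis using False z by (intro exI[of _ "D - {0}"]) auto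
    qed
  qed
  let ?E = "\<lambda>g::complex\<Rightarrow>real. {\<zeta> \<in> frontier D. \<not> (g \<longlongrightarrow> 0) (at \<zeta> within D)}"
  have disj: "?E g \<inter> D = {}" for g using openD by (auto simp: frontier_def interior_open)
  have h'0: "h' z = 0" if "z \<in> D" for z
  proof (rule bounded_harmonic_zero[OF harm' _ _ that])
    show "\<bar>h' z\<bar> \<le> max M \<bar>v 0\<bar>" if "z \<in> D" for z
      using M[of z] that by (auto simp: h'_def)
    fix \<sigma> :: "nat \<Rightarrow> nat" and F
    assume F: "strict_mono \<sigma>" "F \<in> borel_measurable unif01"
      "AE t in unif01. (\<lambda>n. f (circ (rad (\<sigma> n)) t)) \<longlonglongrightarrow> F t"
    have "polar (?E g)" "polar (?E green_pole)" using g' G' by blast+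
    then have "AE t in unif01. F t \<notin> ?E g" "AE t in unif01. F t \<notin> ?E green_pole"
      using boundary_values_avoid_polar[OF F(2,3) exceptional_set_borel[OF openD] _ disj] by auto
    then show "AE t in unif01. (h' \<longlongrightarrow> 0) (at (F t) within D)"
      using boundary_values_frontier[OF F(1,3)]
    proof eventually_elim
      case (elim t)
      then have "(g \<longlongrightarrow> 0) (at (F t) within D)" "(green_pole \<longlongrightarrow> 0) (at (F t) within D)" by auto
      then have l: "((\<lambda>z. g z - green_pole z) \<longlongrightarrow> 0 - 0) (at (F t) within D)" by (rule tendsto_diff)
      have "F t \<noteq> 0" using elim(3) openD zero_in_D by (auto simp: frontier_def interior_open)
      then have "\<forall>\<^sub>F w in nhds (F t). w \<noteq> 0" by (rule t1_space_nhds)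
      then have "\<forall>\<^sub>F w in at (F t) within D. g w - green_pole w = h' w"
        unfolding eventually_at_filter by (rule eventually_mono) (simp add: h'_def h_def)
      then show ?case using l by (simp add: tendsto_cong)
    qed
  qed
  have "g z = green_pole z" if "z \<in> D - {0}" for z
    using h'0[of z] that by (simp add: h'_def h_def)
  moreover have "g z = green_pole z" if "z \<notin> D - {0}" for z
    using that g' G' by metis
  ultimately show ?thesis by (intro ext) metis
qed

lemma green0_eq: "green0 D = green_pole"
  unfolding green0_def by (rule the_equality[where P="is_green0 D"]) (rule is_green0_green, rule green0_unique)

end

section \<open>Subordination\<close>

text \<open>The Poisson kernel of the disc of radius r at the boundary point r u; for |w| < r its
  mean over the unit circle is 1.\<close>

definition poisson :: "real \<Rightarrow> complex \<Rightarrow> complex \<Rightarrow> real" where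
  "poisson r w u = (r\<^sup>2 - (norm w)\<^sup>2) / (norm (of_real r * u - w))\<^sup>2"

lemma cauchy_circle_mean:
  assumes g: "g holomorphic_on ball 0 R" and r: "0 < r" "r < R" and w: "norm w < r"
  shows "(LINT t|unif01. g (circ r t) * (circ r t) / (circ r t - w)) = g w"
proof -
  have "((\<lambda>u. g u / (u - w)) has_contour_integral (2 * of_real pi * \<i> * g w)) (circlepath 0 r)"
    using w g r(2) by (intro Cauchy_integral_circlepath holomorphic_continuous_cball[of _ _ R])
      (auto elim!: holomorphic_on_subset)
  moreover have "continuous_on (sphere 0 r) (\<lambda>u. g u / (u - w))"
    using w g r(2) by (intro continuous_intros holomorphic_continuous_sphere[of _ _ R]) auto
  ultimately show ?thesis using circle_mean_contour(1)[OF r(1), of 0 "\<lambda>u. g u / (u - w)"] by simp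
qed

text \<open>The first form is the Cauchy kernel times a factor holomorphic in the boundary variable,
  which gives a representation formula. The second is the real part of a function holomorphic in w,
  so that the kernel can be averaged over w.\<close>

lemma poisson_kernel_eq:
  assumes u: "norm u = 1" and r: "0 < r" and w: "norm w < r"
  shows "of_real r * u / (of_real r * u - w) * (of_real (r\<^sup>2 - (norm w)\<^sup>2) / (of_real (r\<^sup>2) - cnj w *
    (of_real r * u))) = of_real (poisson r w u)"
    and "Re ((of_real r * u + w) / (of_real r * u - w)) = poisson r w u"
    and "of_real (r\<^sup>2) - cnj w * (of_real r * u) \<noteq> 0"
proof -
  have uu: "u * cnj u = 1" using u by (metis complex_norm_square of_real_1 one_power2)
  have u0: "u \<noteq> 0" using u by auto
  define v where "v = of_real r * u - w"
  have v0: "v \<noteq> 0" using u r w by (auto simp: v_def norm_mult dest: arg_cong[where f=norm])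
  have cv: "of_real r * u * cnj v = of_real (r\<^sup>2) - cnj w * (of_real r * u)"
    using uu by (simp add: v_def algebra_simps power2_eq_square)
  show "of_real (r\<^sup>2) - cnj w * (of_real r * u) \<noteq> 0"
    unfolding cv[symmetric] using u0 v0 r by simp
  have nv: "of_real ((norm v)\<^sup>2) = v * cnj v" by (rule complex_norm_square)
  have "of_real r * u / v * (of_real (r\<^sup>2 - (norm w)\<^sup>2) / (of_real r * u * cnj v)) =
    of_real (r\<^sup>2 - (norm w)\<^sup>2) / (v * cnj v)"
    using u0 v0 r by (simp add: field_simps)
  then show "of_real r * u / (of_real r * u - w) * (of_real (r\<^sup>2 - (norm w)\<^sup>2) / (of_real (r\<^sup>2) - cnj w *
    (of_real r * u))) = of_real (poisson r w u)"
    unfolding cv[symmetric] poisson_def v_def[symmetric] of_real_divide nv .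
  have "Re ((of_real r * u + w) * cnj v) = r\<^sup>2 * (norm u)\<^sup>2 - (norm w)\<^sup>2"
    unfolding v_def cmod_power2 by (simp add: algebra_simps power2_eq_square)
  moreover have "(of_real r * u + w) / v = (of_real r * u + w) * cnj v / of_real ((norm v)\<^sup>2)"
    unfolding nv using v0 by simp
  ultimately show "Re ((of_real r * u + w) / (of_real r * u - w)) = poisson r w u"
    unfolding poisson_def v_def[symmetric] using u by (simp only: Re_divide_of_real) simp
qed

lemma poisson_nonneg: "norm w < r \<Longrightarrow> 0 \<le> poisson r w u"
  unfolding poisson_def by (intro divide_nonneg_nonneg) (auto intro!: power_mono)

text \<open>Cauchy's formula is applied to g times (r^2 - |w|^2) / (r^2 - \<open>cnj w\<close> z), a
  factor that equals 1 at w and turns the Cauchy kernel on the circle into the Poisson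
  kernel.\<close>

lemma norm_le_poisson_mean:
  assumes g: "g holomorphic_on ball 0 R" and r: "0 < r" "r < R" and w: "norm w < r"
  shows "norm (g w) \<le> (LINT t|unif01. norm (g (circ r t)) * poisson r w (unit_cis t))"
proof -
  have den: "of_real (r\<^sup>2) - cnj w * z \<noteq> 0" if "z \<in> ball 0 (r\<^sup>2 / norm w)" "w \<noteq> 0" for z
  proof
    assume "of_real (r\<^sup>2) - cnj w * z = 0"
    then have "norm (cnj w * z) = norm (complex_of_real (r\<^sup>2))" by simp
    then have "norm w * norm z = r\<^sup>2" by (simp only: norm_mult complex_mod_cnj norm_of_real) simp
    with that show False by (simp add: field_simps)
  qed
  \<comment> \<open>The factor has its pole at distance r^2 / |w| from the origin, beyond r because
    |w| < r.\<close>
  define R' where "R' = (if w = 0 then R else min R (r\<^sup>2 / norm w))"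
  have R': "r < R'" "R' \<le> R"
    using r w by (auto simp: R'_def field_simps power2_eq_square mult_strict_left_mono)
  have den': "of_real (r\<^sup>2) - cnj w * z \<noteq> 0" if "z \<in> ball 0 R'" for z
    using den[of z] that r by (cases "w = 0") (auto simp: R'_def)
  define h where "h z = g z * (of_real (r\<^sup>2 - (norm w)\<^sup>2) / (of_real (r\<^sup>2) - cnj w * z))" for z
  have "g holomorphic_on ball 0 R'" using R' by (auto intro: holomorphic_on_subset[OF g])
  then have h: "h holomorphic_on ball 0 R'"
    unfolding h_def using den' by (intro holomorphic_intros) auto
  have "w \<in> ball 0 R'" using w R' by auto
  have "of_real (r\<^sup>2) - cnj w * w = complex_of_real (r\<^sup>2 - (norm w)\<^sup>2)"
    by (simp add: complex_norm_square[symmetric] mult.commute[of "cnj w"] del: of_real_power)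
  then have hw: "h w = g w" using den'[OF \<open>w \<in> ball 0 R'\<close>] by (simp add: h_def)
  have eq: "h (circ r t) * (circ r t) / (circ r t - w) =
      g (circ r t) * of_real (poisson r w (unit_cis t))" for t
    unfolding poisson_kernel_eq(1)[OF norm_unit_cis r(1) w, of t, symmetric] h_def
    by (simp only: divide_inverse mult_ac)
  note C = cauchy_circle_mean[OF h r(1) R'(1) w, unfolded eq hw]
  have "norm (g w) \<le> (LINT t|unif01. norm (g (circ r t) * of_real (poisson r w (unit_cis t))))"
    using integral_norm_bound[of unif01 "\<lambda>t. g (circ r t) * of_real (poisson r w (unit_cis t))"] C by simp
  also have "\<dots> = (LINT t|unif01. norm (g (circ r t)) * poisson r w (unit_cis t))"
    using poisson_nonneg[OF w] by (simp add: norm_mult)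
  finally show ?thesis .
qed

lemma poisson_center_bound:
  assumes "norm u = 1" "norm a < r"
  shows "poisson r a u \<le> (r + norm a) / (r - norm a)"
proof -
  have r: "r > 0" using assms(2) by (meson norm_ge_zero le_less_trans)
  have "r - norm a \<le> norm (of_real r * u - a)"
    using norm_triangle_ineq2[of "of_real r * u" a] assms r by (simp add: norm_mult)
  then have "(r - norm a)\<^sup>2 \<le> (norm (of_real r * u - a))\<^sup>2" using assms by (intro power_mono) auto
  then have "poisson r a u \<le> (r\<^sup>2 - (norm a)\<^sup>2) / (r - norm a)\<^sup>2"
    unfolding poisson_def using assms(2) by (intro frac_le) (auto intro: power_mono)
  also have "\<dots> = (r + norm a) / (r - norm a)"
    unfolding power2_eq_square square_diff_square_factored using assms(2) by simp
  finally show ?thesis .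
qed

text \<open>The difference of the squared norms is (r^2 - |a|^2) (r^2 - |z|^2): a Blaschke factor of
  the disc of radius r is at most 1 inside and has norm 1 on the circle.\<close>

lemma blaschke_norm:
  assumes "norm a < r" "norm z \<le> r"
  shows "r * norm (z - a) \<le> norm (of_real (r\<^sup>2) - cnj a * z)"
    "norm z = r \<Longrightarrow> r * norm (z - a) = norm (of_real (r\<^sup>2) - cnj a * z)"
    "of_real (r\<^sup>2) - cnj a * z \<noteq> 0"
proof -
  have r: "r > 0" using assms(1) by (meson norm_ge_zero le_less_trans)
  have id: "(norm (of_real (r\<^sup>2) - cnj a * z))\<^sup>2 - (r * norm (z - a))\<^sup>2 =
    (r\<^sup>2 - (norm a)\<^sup>2) * (r\<^sup>2 - (norm z)\<^sup>2)"
    unfolding power_mult_distrib cmod_power2 by (simp add: power2_eq_square algebra_simps)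
  moreover have "0 \<le> (r\<^sup>2 - (norm a)\<^sup>2) * (r\<^sup>2 - (norm z)\<^sup>2)"
    using assms r by (intro mult_nonneg_nonneg) (auto intro!: power_mono)
  ultimately have "(r * norm (z - a))\<^sup>2 \<le> (norm (of_real (r\<^sup>2) - cnj a * z))\<^sup>2" by simp
  then show "r * norm (z - a) \<le> norm (of_real (r\<^sup>2) - cnj a * z)"
    by (rule power2_le_imp_le) simp
  show "r * norm (z - a) = norm (of_real (r\<^sup>2) - cnj a * z)" if "norm z = r"
  proof (rule power2_eq_imp_eq)
    show "(r * norm (z - a))\<^sup>2 = (norm (of_real (r\<^sup>2) - cnj a * z))\<^sup>2" using id that by simp
  qed (use r in auto)
  show "of_real (r\<^sup>2) - cnj a * z \<noteq> 0"
  proof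
    assume "of_real (r\<^sup>2) - cnj a * z = 0"
    then have "norm (cnj a * z) = norm (complex_of_real (r\<^sup>2))" by simp
    then have "norm a * norm z = r * r"
      by (simp only: norm_mult complex_mod_cnj norm_of_real) (simp add: power2_eq_square)
    moreover have "norm a * norm z < r * r"
    proof (cases "norm z = 0")
      case False
      then have "norm a * norm z < r * norm z" using assms by (intro mult_strict_right_mono) auto
      also have "\<dots> \<le> r * r" using assms r by (intro mult_left_mono) auto
      finally show ?thesis .
    qed (use r in simp)
    ultimately show False by simp
  qed
qed

section \<open>Littlewood subordination for powers of |f|\<close>

context disc_covering
begin

text \<open>Dividing \<open>f\<close> by the Blaschke product of its zeros in the disc of radius \<open>r\<close> leaves a zero-free
  function, whose \<open>p\<close>-th power is holomorphic.\<close>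

lemma powr_le_poisson_mean:
  assumes r: "0 < r" "r < 1" and nz: "\<And>z. norm z = r \<Longrightarrow> f z \<noteq> 0" and w: "norm w < r" and p: "p > 0"
  shows "norm (f w) powr p \<le> (LINT t|unif01. norm (f (circ r t)) powr p * poisson r w (unit_cis t))"
proof -
  define Z where "Z = {z \<in> cball 0 r. f z = 0}"
  have sub: "cball 0 r \<subseteq> ball (0::complex) 1" using r by auto
  have fin: "finite Z"
    unfolding Z_def by (rule finite_preimage[OF r(2)])
  have Zr: "norm a < r" if "a \<in> Z" for a using that nz[of a] by (auto simp: Z_def less_le)
  have "\<exists>G. G holomorphic_on ball 0 1 \<and> (\<forall>z\<in>ball 0 1. f z = G z * (\<Prod>a\<in>Z. z - a))"
    by (rule simple_zero_factorization[OF fin open_ball hol]) (use sub in \<open>auto simp: Z_def\<close>)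
  then obtain G where G: "G holomorphic_on ball 0 1" "\<And>z. z \<in> ball 0 1 \<Longrightarrow> f z = G z * (\<Prod>a\<in>Z. z - a)" by blast
  have Gnz: "G z \<noteq> 0" if z: "z \<in> cball 0 r" for z
  proof (cases "z \<in> Z")
    case True
    show ?thesis
      by (rule simple_zero_cofactor_nonzero[OF fin open_ball G True])
        (use z sub deriv_nonzero[of z] in auto)
  next
    case False
    with z sub G(2)[of z] show ?thesis by (auto simp: Z_def)
  qed
  \<comment> \<open>Each factor z - a is replaced by its reflection in the circle, which has no zero
    in the closed disc, equal norm on the circle and at least the same norm inside.\<close>
  define K where "K z = G z * (\<Prod>a\<in>Z. (of_real (r\<^sup>2) - cnj a * z) / of_real r)" for z
  have K: "K holomorphic_on ball 0 1" unfolding K_def using r by (intro holomorphic_intros G(1)) auto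
  have Knz: "K z \<noteq> 0" if "z \<in> cball 0 r" for z
    unfolding K_def using Gnz[OF that] fin r blaschke_norm(3)[OF Zr, of _ z] that by auto
  have nK: "norm (K z) = norm (G z) * (\<Prod>a\<in>Z. norm (of_real (r\<^sup>2) - cnj a * z) / r)" for z
    unfolding K_def using r by (simp add: norm_mult norm_divide flip: prod_norm)
  have nf: "norm (f z) = norm (G z) * (\<Prod>a\<in>Z. norm (z - a))" if "z \<in> ball 0 1" for z
    unfolding G(2)[OF that] by (simp add: norm_mult flip: prod_norm)
  have le: "norm (f z) \<le> norm (K z)" if "norm z \<le> r" for z
  proof -
    have "(\<Prod>a\<in>Z. norm (z - a)) \<le> (\<Prod>a\<in>Z. norm (of_real (r\<^sup>2) - cnj a * z) / r)"
      using blaschke_norm(1)[OF Zr that] r by (intro prod_mono) (auto simp: field_simps)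
    then show ?thesis unfolding nK using nf[of z] that r by (auto intro: mult_left_mono)
  qed
  have eq: "norm (f z) = norm (K z)" if "norm z = r" for z
  proof -
    have "(\<Prod>a\<in>Z. norm (z - a)) = (\<Prod>a\<in>Z. norm (of_real (r\<^sup>2) - cnj a * z) / r)"
      using blaschke_norm(2)[OF Zr eq_refl[OF that] that] r by (intro prod.cong) (auto simp: field_simps)
    then show ?thesis unfolding nK using nf[of z] that r by auto
  qed
  obtain r' k where k: "r < r'" "r' < 1" "k holomorphic_on ball 0 r'" "\<And>z. z \<in> ball 0 r' \<Longrightarrow> exp (k z) = K z"
    by (rule zero_free_log[OF K _ r(2) Knz]) (use r that in auto)
  define H where "H z = exp (of_real p * k z)" for z
  have H: "H holomorphic_on ball 0 r'" unfolding H_def by (intro holomorphic_intros k(3))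
  have nH: "norm (H z) = norm (K z) powr p" if "z \<in> ball 0 r'" for z
  proof -
    have "norm (K z) = exp (Re (k z))" using k(4)[OF that] by (metis norm_exp_eq_Re)
    then show ?thesis by (simp add: H_def powr_def)
  qed
  have "norm (f w) powr p \<le> norm (K w) powr p" using le[of w] w p by (intro powr_mono2) auto
  also have "\<dots> = norm (H w)" using nH[of w] w k(1) by simp
  also have "\<dots> \<le> (LINT t|unif01. norm (H (circ r t)) * poisson r w (unit_cis t))"
    by (rule norm_le_poisson_mean[OF H r(1) k(1) w])
  also have "\<dots> = (LINT t|unif01. norm (f (circ r t)) powr p * poisson r w (unit_cis t))"
    using nH[of "circ r _"] eq[of "circ r _"] r k(1) by (simp add: norm_mult)
  finally show ?thesis .
qed

text \<open>At each point of the inner circle |f|^p composed with \<phi> is at most a Poisson mean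
  of |f|^p. Averaging over that circle replaces the kernel by its value at \<phi>(0), by the mean
  value property, and this value is bounded independently of the radii.\<close>

lemma subordination:
  assumes \<phi>: "\<phi> holomorphic_on ball 0 1" "\<phi> ` ball 0 1 \<subseteq> ball 0 1" and p: "p > 0"
    and B: "\<And>r. 0 < r \<Longrightarrow> r < 1 \<Longrightarrow> (LINT t|unif01. norm (f (circ r t)) powr p) \<le> B"
    and s: "0 < s" "s < 1"
  shows "(LINT t|unif01. norm (f (\<phi> (circ s t))) powr p) \<le> 4 / (1 - norm (\<phi> 0)) * B"
proof -
  define s' where "s' = (1 + s) / 2"
  have s': "s < s'" "s' < 1" "0 < s'" using s by (auto simp: s'_def)
  define a where "a = \<phi> 0"
  have a: "norm a < 1" using \<phi>(2) by (force simp: a_def)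
  have c\<phi>: "continuous_on (cball 0 s') \<phi>"
    using \<phi>(1) s'(2) by (rule holomorphic_continuous_cball)
  have "\<exists>x\<in>cball 0 s'. \<forall>y\<in>cball 0 s'. norm (\<phi> y) \<le> norm (\<phi> x)"
    using s' by (intro continuous_attains_sup continuous_intros c\<phi>) auto
  then obtain z0 where z0: "z0 \<in> cball 0 s'" "\<And>z. z \<in> cball 0 s' \<Longrightarrow> norm (\<phi> z) \<le> norm (\<phi> z0)"
    by blast
  \<comment> \<open>The second entry gives r - |a| >= (1 - |a|) / 2, which leads to the constant 4 /
    (1 - |a|).\<close>
  define \<rho> where "\<rho> = max (norm (\<phi> z0)) ((1 + norm a) / 2)"
  have "norm (\<phi> z0) < 1" using \<phi>(2) z0(1) s'(2) by force
  then have \<rho>: "\<rho> < 1" "0 < \<rho>" "(1 + norm a) / 2 \<le> \<rho>" "norm (\<phi> z0) \<le> \<rho>"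
    using a by (auto simp: \<rho>_def less_max_iff_disj add_pos_nonneg)
  \<comment> \<open>Only finitely many radii below \<rho>' carry a zero of f; r avoids them because
    the Poisson inequality requires a circle free of zeros.\<close>
  obtain r where r: "\<rho> < r" "r < 1" "\<And>z. norm z = r \<Longrightarrow> f z \<noteq> 0"
  proof -
    define \<rho>' where "\<rho>' = (\<rho> + 1) / 2"
    have \<rho>': "\<rho> < \<rho>'" "\<rho>' < 1" using \<rho> by (auto simp: \<rho>'_def)
    have "finite {z \<in> cball 0 \<rho>'. f z = 0}" by (rule finite_preimage[OF \<rho>'(2)])
    then have "finite (norm ` {z \<in> cball 0 \<rho>'. f z = 0})" by simp
    moreover have "infinite {\<rho><..<\<rho>'}" using \<rho>'(1) by simp
    ultimately obtain r where "r \<in> {\<rho><..<\<rho>'}" "r \<notin> norm ` {z \<in> cball 0 \<rho>'. f z = 0}"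
      by (meson finite_subset subsetI)
    then show thesis using \<rho>' by (intro that[of r]) auto
  qed
  have r0: "0 < r" using \<rho> r by simp
  have \<phi>r: "norm (\<phi> z) < r" if "z \<in> cball 0 s'" for z using z0(2)[OF that] \<rho>(4) r(1) by linarith
  have in_s': "circ s t \<in> cball 0 s'" for t using s s' by (simp add: norm_mult)
  let ?A = "\<lambda>t. norm (f (circ r t)) powr p"
  let ?P = "\<lambda>y t. poisson r (\<phi> (circ s y)) (unit_cis t)"
  interpret P: pair_sigma_finite unif01 unif01 ..
  interpret PP: prob_space "unif01 \<Otimes>\<^sub>M unif01"
    by (rule prob_space_pair) (rule prob_space_unif01)+
  have m1 [measurable]: "(\<lambda>t. f (circ r t)) \<in> borel_measurable unif01"
    using r0 r by (intro measurable_holomorphic_circle hol) auto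
  have m2 [measurable]: "(\<lambda>t. \<phi> (circ s t)) \<in> borel_measurable unif01"
    using s by (intro measurable_holomorphic_circle \<phi>) auto
  obtain B1 where B1: "B1 > 0" "\<And>t. norm (f (circ r t)) \<le> B1"
    by (rule bounded_holomorphic_circle[OF hol, of r]) (use r r0 in auto)
  define q where "q = norm (\<phi> z0)"
  have q: "q < r" "0 \<le> q" using \<rho>(4) r(1) by (auto simp: q_def)
  have Pb: "?P y t \<le> r\<^sup>2 / (r - q)\<^sup>2" "0 \<le> ?P y t" for y t
  proof -
    let ?w = "\<phi> (circ s y)"
    have w: "norm ?w \<le> q" using z0(2)[OF in_s'] by (simp add: q_def)
    have "r - q \<le> norm (circ r t - ?w)"
      using norm_triangle_ineq2[of "circ r t" ?w] w r0 by (simp add: norm_mult)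
    then have "(r - q)\<^sup>2 \<le> (norm (circ r t - ?w))\<^sup>2" using q by (intro power_mono) auto
    then show "?P y t \<le> r\<^sup>2 / (r - q)\<^sup>2"
      unfolding poisson_def using q by (intro frac_le) auto
    show "0 \<le> ?P y t" using w q by (intro poisson_nonneg) auto
  qed
  have Ab: "?A t \<le> B1 powr p" for t using B1(2)[of t] p by (intro powr_mono2) auto
  have [measurable]: "(\<lambda>(y, t). ?A t * ?P y t) \<in> borel_measurable (unif01 \<Otimes>\<^sub>M unif01)"
    unfolding poisson_def by measurable
  have int: "integrable (unif01 \<Otimes>\<^sub>M unif01) (\<lambda>(y, t). ?A t * ?P y t)"
  proof (rule PP.integrable_const_bound)
    show "AE x in unif01 \<Otimes>\<^sub>M unif01. norm (case x of (y, t) \<Rightarrow> ?A t * ?P y t) \<le> B1 powr p * (r\<^sup>2 / (r - q)\<^sup>2)"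
    proof (intro always_eventually allI)
      fix x :: "real \<times> real"
      obtain y t where x: "x = (y, t)" by (cases x)
      have "?A t * ?P y t \<le> B1 powr p * (r\<^sup>2 / (r - q)\<^sup>2)"
        by (rule mult_mono[OF Ab Pb(1) _ Pb(2)]) simp
      moreover have "0 \<le> ?A t * ?P y t" using Pb(2) by (intro mult_nonneg_nonneg) auto
      ultimately show "norm (case x of (y, t) \<Rightarrow> ?A t * ?P y t) \<le> B1 powr p * (r\<^sup>2 / (r - q)\<^sup>2)"
        unfolding x by (simp del: times_divide_eq_right)
    qed
  qed measurable
  have A_int: "integrable unif01 ?A"
  proof (rule unif01.integrable_const_bound)
    show "AE t in unif01. norm (?A t) \<le> B1 powr p" using Ab by (intro always_eventually allI) simp
  qed measurable
  have P0: "(LINT y|unif01. ?P y t) = poisson r a (unit_cis t)" for t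
  proof -
    let ?h = "\<lambda>z. (circ r t + \<phi> z) / (circ r t - \<phi> z)"
    have nez: "circ r t - \<phi> z \<noteq> 0" if "z \<in> ball 0 s'" for z
    proof
      assume "circ r t - \<phi> z = 0"
      then have "norm (circ r t) = norm (\<phi> z)" by simp
      with \<phi>r[of z] that r0 show False by (simp add: norm_mult)
    qed
    have "\<phi> holomorphic_on ball 0 s'" using s' by (auto intro: holomorphic_on_subset[OF \<phi>(1)])
    then have "?h holomorphic_on ball 0 s'" using nez by (intro holomorphic_intros) auto
    from circle_mean_Re(1)[OF this, of s] s s'
    have "(LINT y|unif01. Re (?h (circ s y))) = Re (?h 0)" by simp
    then show ?thesis
      using poisson_kernel_eq(2)[OF norm_unit_cis r0 \<phi>r[OF in_s']] poisson_kernel_eq(2)[OF norm_unit_cis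
        r0 \<phi>r[of 0]] s'
      by (simp add: a_def)
  qed
  have ar: "norm a < r" using \<phi>r[of 0] s' by (simp add: a_def)
  have "(LINT y|unif01. norm (f (\<phi> (circ s y))) powr p) \<le> (LINT y|unif01. LINT t|unif01. ?A t * ?P y t)"
  proof (rule integral_mono_AE')
    show "integrable unif01 (\<lambda>y. LINT t|unif01. ?A t * ?P y t)"
      using P.integrable_fst'[OF int] by simp
    show "AE y in unif01. norm (f (\<phi> (circ s y))) powr p \<le> (LINT t|unif01. ?A t * ?P y t)"
      using powr_le_poisson_mean[OF r0 r(2,3) \<phi>r[OF in_s'] p] by simp
    show "AE y in unif01. 0 \<le> (LINT t|unif01. ?A t * ?P y t)"
      using Pb(2) by (intro always_eventually allI integral_nonneg_AE mult_nonneg_nonneg) auto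
  qed
  also have "\<dots> = (LINT t|unif01. LINT y|unif01. ?A t * ?P y t)"
    using P.Fubini_integral[OF int] by simp
  also have "\<dots> = (LINT t|unif01. ?A t * poisson r a (unit_cis t))"
    using P0 by simp
  also have "\<dots> \<le> (LINT t|unif01. ?A t * (4 / (1 - norm a)))"
  proof (rule integral_mono_AE')
    show "integrable unif01 (\<lambda>t. ?A t * (4 / (1 - norm a)))" using A_int by simp
    show "AE t in unif01. ?A t * poisson r a (unit_cis t) \<le> ?A t * (4 / (1 - norm a))"
    proof (intro always_eventually allI mult_left_mono)
      fix t
      have "poisson r a (unit_cis t) \<le> (r + norm a) / (r - norm a)"
        by (rule poisson_center_bound[OF norm_unit_cis ar])
      also have "\<dots> \<le> 2 / ((1 - norm a) / 2)"
        using a r(1,2) \<rho>(3) ar by (intro frac_le) auto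
      finally show "poisson r a (unit_cis t) \<le> 4 / (1 - norm a)" by simp
    qed simp
    show "AE t in unif01. 0 \<le> ?A t * (4 / (1 - norm a))"
      using a by (intro always_eventually allI mult_nonneg_nonneg) auto
  qed
  also have "\<dots> = (LINT t|unif01. ?A t) * (4 / (1 - norm a))" by simp
  also have "\<dots> \<le> B * (4 / (1 - norm a))"
    using B[OF r0 r(2)] a by (intro mult_right_mono) auto
  finally show ?thesis by (simp add: a_def mult.commute)
qed

end

section \<open>Growth of Hardy means\<close>

lemma integrable_powr_circle:
  assumes g: "g holomorphic_on ball 0 1" and r: "0 \<le> r" "r < 1" and p: "p > 0"
  shows "integrable unif01 (\<lambda>t. norm (g (circ r t)) powr p)"
proof -
  obtain B where B: "B > 0" "\<And>t. norm (g (circ r t)) \<le> B"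
    by (rule bounded_holomorphic_circle[OF g r]) (rule that)
  have [measurable]: "(\<lambda>t. g (circ r t)) \<in> borel_measurable unif01"
    by (rule measurable_holomorphic_circle[OF g r])
  show ?thesis
  proof (rule unif01.integrable_const_bound)
    have "norm (g (circ r t)) powr p \<le> B powr p" for t
      using B(2)[of t] p by (intro powr_mono2) auto
    then show "AE t in unif01. norm (norm (g (circ r t)) powr p) \<le> B powr p"
      by (intro always_eventually allI) simp
  qed measurable
qed

lemma hardy_space_iff:
  assumes g: "g holomorphic_on ball 0 1" and p: "p > 0"
  shows "g \<in> hardy_space p \<longleftrightarrow> (\<exists>B. \<forall>r. 0 < r \<longrightarrow> r < 1 \<longrightarrow> (LINT t|unif01. norm (g (circ r t)) powr p) \<le> B)"
proof -
  have eq: "integral {0..2*pi} (\<lambda>\<theta>. norm (g (of_real r * cis \<theta>)) powr p) =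
    2 * pi * (LINT t|unif01. norm (g (circ r t)) powr p)"
    if "0 < r" "r < 1" for r
    using integral_2pi_eq[of "\<lambda>u. norm (g (of_real r *
      u)) powr p"] integrable_powr_circle[OF g _ that(2) p] that by simp
  have "g \<in> hardy_space p \<longleftrightarrow> (\<exists>B. \<forall>r. 0 < r \<longrightarrow> r < 1 \<longrightarrow> 2 * pi * (LINT t|unif01. norm (g (circ r t)) powr p) \<le> B)"
  proof -
    have "g \<in> hardy_space p \<longleftrightarrow> (\<exists>B. \<forall>r\<in>{0<..<1}. integral {0..2*pi} (\<lambda>\<theta>. norm (g (of_real r *
      cis \<theta>)) powr p) \<le> B)"
      using g by (simp add: hardy_space_def bdd_above_def)
    also have "\<dots> \<longleftrightarrow> (\<exists>B. \<forall>r\<in>{0<..<1}. 2 * pi * (LINT t|unif01. norm (g (circ r t)) powr p) \<le> B)"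
      using eq by simp
    finally show ?thesis by (simp add: Ball_def imp_conjL)
  qed
  also have "\<dots> \<longleftrightarrow> (\<exists>B. \<forall>r. 0 < r \<longrightarrow> r < 1 \<longrightarrow> (LINT t|unif01. norm (g (circ r t)) powr p) \<le> B)"
  proof
    assume "\<exists>B. \<forall>r. 0 < r \<longrightarrow> r < 1 \<longrightarrow> 2 * pi * (LINT t|unif01. norm (g (circ r t)) powr p) \<le> B"
    then obtain B where B: "\<And>r. 0 < r \<Longrightarrow> r < 1 \<Longrightarrow> 2 * pi * (LINT t|unif01. norm (g (circ r t)) powr p) \<le> B"
      by blast
    then show "\<exists>B. \<forall>r. 0 < r \<longrightarrow> r < 1 \<longrightarrow> (LINT t|unif01. norm (g (circ r t)) powr p) \<le> B"
      by (intro exI[of _ "B / (2 * pi)"]) (simp add: field_simps)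
  next
    assume "\<exists>B. \<forall>r. 0 < r \<longrightarrow> r < 1 \<longrightarrow> (LINT t|unif01. norm (g (circ r t)) powr p) \<le> B"
    then obtain B where B: "\<And>r. 0 < r \<Longrightarrow> r < 1 \<Longrightarrow> (LINT t|unif01. norm (g (circ r t)) powr p) \<le> B" by blast
    then show "\<exists>B. \<forall>r. 0 < r \<longrightarrow> r < 1 \<longrightarrow> 2 * pi * (LINT t|unif01. norm (g (circ r t)) powr p) \<le> B"
      by (intro exI[of _ "2 * pi * B"]) simp
  qed
  finally show ?thesis .
qed

text \<open>For x > R this is ln y <= y - 1 at y = (x / R)^p. It turns a bound on p-th means into
  decay R^(-p) of the truncated logarithmic means.\<close>

lemma ln_max_le_powr:
  fixes x R p :: real
  assumes "0 \<le> x" "0 < R" "0 < p"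
  shows "ln (max x R) - ln R \<le> (x / R) powr p / p"
proof (cases "x \<le> R")
  case False
  then have x: "x > R" "x > 0" using assms by linarith+
  have y: "0 < x / R" using x assms by simp
  have "p * ln (x / R) = ln ((x / R) powr p)" using y by (simp add: ln_powr)
  also have "\<dots> \<le> (x / R) powr p - 1" using x assms by (intro ln_le_minus_one) simp
  finally have "p * ln (x / R) \<le> (x / R) powr p" by simp
  then have "ln (x / R) \<le> (x / R) powr p / p" using assms by (simp add: field_simps)
  then show ?thesis using x assms by (simp add: max_def ln_div)
qed (use assms in \<open>auto simp: max_def\<close>)

text \<open>If \<open>x\<close> lies in \<open>[e\<^bsup>k+1\<^esup>, e\<^bsup>k+2\<^esup>)\<close>, the summand of index \<open>k\<close> alone dominates \<open>x powr p\<close>.\<close>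

lemma powr_le_dyadic_sum:
  fixes x p :: real
  assumes x: "0 \<le> x" "x \<le> exp (real N)" and p: "p > 0"
  shows "x powr p \<le> exp (p * (real k0 + 1)) + (\<Sum>k=k0..N. exp (p * (real k + 2)) *
    (ln (max x (exp (real k))) - real k))"
proof -
  have nonneg: "0 \<le> exp (p * (real k + 2)) * (ln (max x (exp (real k))) - real k)" for k
  proof -
    have "ln (exp (real k)) \<le> ln (max x (exp (real k)))"
      by (subst ln_le_cancel_iff) (auto simp: less_max_iff_disj)
    then show ?thesis by simp
  qed
  show ?thesis
  proof (cases "x \<le> exp (real k0 + 1)")
    case True
    have "x powr p \<le> exp (real k0 + 1) powr p" using True x p by (intro powr_mono2) auto
    also have "\<dots> = exp (p * (real k0 + 1))" by (simp add: powr_def)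
    finally show ?thesis using sum_nonneg[of "{k0..N}"
      "\<lambda>k. exp (p * (real k + 2)) * (ln (max x (exp (real k))) - real k)"] nonneg by simp
  next
    case False
    moreover have "0 < exp (real k0 + 1)" by simp
    ultimately have x0: "x > 0" by linarith
    have "ln (exp (real k0 + 1)) < ln x" using False x0 by (subst ln_less_cancel_iff) auto
    then have lx: "real k0 + 1 < ln x" by simp
    define k where "k = nat \<lfloor>ln x\<rfloor> - 1"
    have fl: "\<lfloor>ln x\<rfloor> \<ge> int k0 + 1" using lx by linarith
    have k: "k0 \<le> k" "real k + 1 \<le> ln x" "ln x < real k + 2" using fl unfolding k_def by linarith+
    have "ln x \<le> ln (exp (real N))" using x x0 by (subst ln_le_cancel_iff) auto
    then have "k \<le> N" using k(2) by simp
    have "x powr p \<le> exp (p * (real k + 2))"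
      using x0 k(3) p by (simp add: powr_def)
    also have "\<dots> * 1 \<le> exp (p * (real k + 2)) * (ln (max x (exp (real k))) - real k)"
    proof (intro mult_left_mono)
      have "ln x \<le> ln (max x (exp (real k)))" using x0 by (subst ln_le_cancel_iff) auto
      then show "1 \<le> ln (max x (exp (real k))) - real k" using k(2) by simp
    qed simp
    also have "\<dots> \<le> (\<Sum>k=k0..N. exp (p * (real k + 2)) * (ln (max x (exp (real k))) - real k))"
      using k(1) \<open>k \<le> N\<close> nonneg by (intro member_le_sum) auto
    finally show ?thesis by (simp add: add_increasing)
  qed
qed

section \<open>Hardy classes of the covering map and decay of the Green means\<close>

context greenian_covering
begin

lemma integrable_green_circle:
  assumes "R > 0"
  shows "integrable unif01 (\<lambda>t. green (circ R t))"
proof -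
  obtain B where B: "\<And>w. w \<in> - ball 0 R \<Longrightarrow> norm (green w) \<le> B"
    using green_bounded_off_0[OF assms] unfolding bounded_iff by blast
  show ?thesis
  proof (rule unif01.integrable_const_bound)
    show "AE t in unif01. norm (green (circ R t)) \<le> B"
      using B assms by (intro always_eventually allI) (simp add: norm_mult)
  qed measurable
qed

lemma psi_green_eq:
  assumes "R > 0"
  shows "psi_green D R = 2 * pi * (LINT t|unif01. green (circ R t))"
proof -
  have "psi_green D R = integral {0..2*pi} (\<lambda>\<theta>. green (of_real R * cis \<theta>))"
    unfolding psi_green_def green0_eq green_pole_def using assms
    by (intro integral_cong) (simp add: cis_neq_zero)
  also have "\<dots> = 2 * pi * (LINT t|unif01. green (circ R t))"
    by (rule integral_2pi_eq[of "\<lambda>u. green (of_real R * u)"]) (rule integrable_green_circle[OF assms])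
  finally show ?thesis .
qed

lemma mean_log_eq_cnt:
  assumes "0 < r" "r < 1" "R > 0"
  shows "(LINT t|unif01. ln (max (norm (f (circ r t))) R) - ln R) = (LINT t|unif01. cnt r (circ R t))"
    and "integrable unif01 (\<lambda>t. ln (max (norm (f (circ r t))) R) - ln R)"
  using cartan[OF assms, of 0] assms(3) by (simp_all add: max_def)

lemma mean_log_le_psi:
  assumes "0 < r" "r < 1" "R > 0"
  shows "2 * pi * (LINT t|unif01. ln (max (norm (f (circ r t))) R) - ln R) \<le> psi_green D R"
proof -
  have "(LINT t|unif01. cnt r (circ R t)) \<le> (LINT t|unif01. green (circ R t))"
    using cartan(2)[OF assms, of 0] assms
    by (intro integral_mono integrable_green_circle cnt_le_green) auto
  then show ?thesis unfolding psi_green_eq[OF assms(3)] mean_log_eq_cnt(1)[OF assms] by simp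
qed

text \<open>The counting functions are dominated by \<open>green\<close>, which is bounded on the
  circle, so a bound uniform in r passes to the limit.\<close>

lemma psi_le:
  assumes R: "R > 0" and B: "\<And>r. 0 < r \<Longrightarrow> r < 1 \<Longrightarrow> (LINT t|unif01. ln (max (norm (f (circ r t))) R) - ln R) \<le> B"
  shows "psi_green D R \<le> 2 * pi * B"
proof -
  have "(\<lambda>n. LINT t|unif01. cnt (rad n) (circ R t)) \<longlonglongrightarrow> (LINT t|unif01. green (circ R t))"
  proof (rule integral_dominated_convergence[where w="\<lambda>t. green (circ R t)"])
    show "AE t in unif01. (\<lambda>n. cnt (rad n) (circ R t)) \<longlonglongrightarrow> green (circ R t)"
      using R by (intro always_eventually allI cnt_tendsto_green rad rad_tendsto) simp
    show "AE t in unif01. norm (cnt (rad n) (circ R t)) \<le> green (circ R t)" for n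
      using R cnt_nonneg cnt_le_green[OF rad(1,2)] by (intro always_eventually allI) simp
    show "(\<lambda>t. cnt (rad n) (circ R t)) \<in> borel_measurable unif01" for n
      using cartan(2)[OF rad(1,2) R, of n 0] by (simp add: integrable_iff_bounded)
  qed (use integrable_green_circle[OF R] in auto)
  moreover have "(LINT t|unif01. cnt (rad n) (circ R t)) \<le> B" for n
    using B[OF rad(1,2)] mean_log_eq_cnt(1)[OF rad(1,2) R] by simp
  ultimately have "(LINT t|unif01. green (circ R t)) \<le> B"
    by (meson LIMSEQ_le_const2)
  then show ?thesis unfolding psi_green_eq[OF R] by simp
qed

lemma psi_nonneg: "R > 0 \<Longrightarrow> 0 \<le> psi_green D R"
  unfolding psi_green_eq by (intro mult_nonneg_nonneg integral_nonneg_AE) (auto intro!: green_nonneg)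

text \<open>The case p = 0 of the decay estimate, which makes the lower limit nonnegative and so
  matches the 0 in the definition of \<open>hardy_number\<close>.\<close>

lemma psi_bounded: "\<exists>C>0. \<forall>R\<ge>1. psi_green D R \<le> C"
proof -
  obtain C where C: "\<And>r. 0 \<le> r \<Longrightarrow> r < 1 \<Longrightarrow> (LINT t|unif01. ln (max 1 (norm (f (circ r t))))) \<le> C"
    "\<And>r. 0 \<le> r \<Longrightarrow> r < 1 \<Longrightarrow> integrable unif01 (\<lambda>t. ln (max 1 (norm (f (circ r t)))))"
    using mean_log_plus_bounded by blast
  have b: "psi_green D R \<le> 2 * pi * \<bar>C\<bar>" if R: "R \<ge> 1" for R
  proof (rule psi_le)
    fix r :: real assume r: "0 < r" "r < 1"
    have R0: "R > 0" using R by simp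
    have "(LINT t|unif01. ln (max (norm (f (circ r t))) R) - ln R) \<le>
      (LINT t|unif01. ln (max 1 (norm (f (circ r t)))))"
    proof (rule integral_mono[OF mean_log_eq_cnt(2)[OF r R0] C(2)])
      fix t
      let ?x = "norm (f (circ r t))"
      have "max ?x R \<le> max 1 ?x * R"
        using R mult_right_mono[of 1 "max 1 ?x" R] mult_left_mono[of 1 R "max 1 ?x"] by (auto simp: max_def)
      then have "ln (max ?x R) \<le> ln (max 1 ?x * R)" using R0
        by (subst ln_le_cancel_iff) (auto simp: less_max_iff_disj)
      also have "\<dots> = ln (max 1 ?x) + ln R" using R0 by (intro ln_mult_pos) (auto simp: less_max_iff_disj)
      finally show "ln (max ?x R) - ln R \<le> ln (max 1 ?x)" by simp
    qed (use r in auto)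
    also have "\<dots> \<le> \<bar>C\<bar>" using C(1)[of r] r by auto
    finally show "(LINT t|unif01. ln (max (norm (f (circ r t))) R) - ln R) \<le> \<bar>C\<bar>" .
  qed (use R in simp)
  show ?thesis
  proof (intro exI[of _ "2 * pi * \<bar>C\<bar> + 1"] conjI allI impI)
    show "psi_green D R \<le> 2 * pi * \<bar>C\<bar> + 1" if "1 \<le> R" for R using b[OF that] by simp
  qed (intro add_nonneg_pos mult_nonneg_nonneg, auto)
qed

lemma psi_decay:
  assumes "f \<in> hardy_space p" "p > 0"
  shows "\<exists>C>0. \<forall>R\<ge>1. psi_green D R \<le> C * R powr (- p)"
proof -
  obtain B where B: "\<And>r. 0 < r \<Longrightarrow> r < 1 \<Longrightarrow> (LINT t|unif01. norm (f (circ r t)) powr p) \<le> B"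
    using assms hardy_space_iff[OF hol assms(2)] by blast
  have b: "psi_green D R \<le> 2 * pi * (\<bar>B\<bar> / p * R powr (- p))" if R: "R \<ge> 1" for R
  proof (rule psi_le)
    fix r :: real assume r: "0 < r" "r < 1"
    have R0: "R > 0" using R by simp
    note i = integrable_powr_circle[OF hol _ r(2) assms(2)]
    have "(LINT t|unif01. ln (max (norm (f (circ r t))) R) - ln R) \<le>
      (LINT t|unif01. norm (f (circ r t)) powr p * (R powr (- p) / p))"
    proof (rule integral_mono[OF mean_log_eq_cnt(2)[OF r R0]])
      show "integrable unif01 (\<lambda>t. norm (f (circ r t)) powr p * (R powr (- p) / p))"
        using i r by simp
      fix t
      have "ln (max (norm (f (circ r t))) R) - ln R \<le> (norm (f (circ r t)) / R) powr p / p"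
        using R0 assms(2) by (intro ln_max_le_powr) auto
      also have "\<dots> = norm (f (circ r t)) powr p * (R powr (- p) / p)"
        using R0 by (simp add: powr_divide powr_minus field_simps)
      finally show "ln (max (norm (f (circ r t))) R) - ln R \<le> norm (f (circ r t)) powr p * (R powr (- p) / p)" .
    qed
    also have "\<dots> = (LINT t|unif01. norm (f (circ r t)) powr p) * (R powr (- p) / p)" by simp
    also have "\<dots> \<le> \<bar>B\<bar> * (R powr (- p) / p)"
      using B[OF r] assms(2) by (intro mult_right_mono) auto
    finally show "(LINT t|unif01. ln (max (norm (f (circ r t))) R) - ln R) \<le> \<bar>B\<bar> / p * R powr (- p)" by simp
  qed (use R in simp)
  show ?thesis
  proof (intro exI[of _ "2 * pi * \<bar>B\<bar> / p + 1"] conjI allI impI)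
    show "psi_green D R \<le> (2 * pi * \<bar>B\<bar> / p + 1) * R powr (- p)" if "1 \<le> R" for R
    proof -
      have "2 * pi * (\<bar>B\<bar> / p * R powr (- p)) = 2 * pi * \<bar>B\<bar> / p * R powr (- p)" by simp
      moreover have "0 \<le> R powr (- p)" by simp
      ultimately show ?thesis using b[OF that] unfolding distrib_right by linarith
    qed
  qed (use assms(2) in \<open>intro add_nonneg_pos divide_nonneg_pos mult_nonneg_nonneg, auto\<close>)
qed

text \<open>The layer at e^k contributes at most e^(p(k+2)) times a mean that is at most e^(-qk),
  which gives a geometric series with ratio e^(p-q). Layers below k0, where the decay is not yet
  available, go into the constant term.\<close>

lemma hardy_space_of_psi_decay:
  assumes p: "0 < p" "p < q" and dec: "\<And>R. R \<ge> R0 \<Longrightarrow> psi_green D R \<le> R powr (- q)"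
  shows "f \<in> hardy_space p"
proof -
  obtain k0 :: nat where k0: "R0 \<le> exp (real k0)"
  proof -
    obtain k :: nat where "R0 < real k" using reals_Archimedean2 by blast
    then show thesis using that[of k] exp_ge_add_one_self[of "real k"] by linarith
  qed
  define c where "c = exp (p - q)"
  have c: "0 \<le> c" "c < 1" using p by (auto simp: c_def)
  define B where "B = exp (p * (real k0 + 1)) + exp (2 * p) * (1 / (1 - c))"
  have "(LINT t|unif01. norm (f (circ r t)) powr p) \<le> B" if r: "0 < r" "r < 1" for r
  proof -
    obtain b where b: "b > 0" "\<And>t. norm (f (circ r t)) \<le> b"
      by (rule bounded_holomorphic_circle[OF hol, of r]) (use r that in auto)
    \<comment> \<open>N depends on r, since f is only known to be bounded on each circle separately;
      the geometric series makes the final bound independent of it.\<close>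
    obtain N :: nat where "b < real N" using reals_Archimedean2 by blast
    then have N: "b \<le> exp (real N)" using exp_ge_add_one_self[of "real N"] by linarith
    let ?s = "\<lambda>k t. exp (p * (real k + 2)) * (ln (max (norm (f (circ r t))) (exp (real k))) - real k)"
    have i: "integrable unif01 (?s k)" for k
      using mean_log_eq_cnt(2)[OF r, of "exp (real k)"] by simp
    have "(LINT t|unif01. norm (f (circ r t)) powr p) \<le>
      (LINT t|unif01. exp (p * (real k0 + 1)) + (\<Sum>k=k0..N. ?s k t))"
    proof (rule integral_mono[OF integrable_powr_circle[OF hol _ r(2) p(1)]])
      show "norm (f (circ r t)) powr p \<le> exp (p * (real k0 + 1)) + (\<Sum>k=k0..N. ?s k t)" for t
        using N b(2)[of t] p(1) by (intro powr_le_dyadic_sum) auto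
    qed (use i r in auto)
    also have "\<dots> = exp (p * (real k0 + 1)) + (\<Sum>k=k0..N. LINT t|unif01. ?s k t)"
      using i by simp
    also have "(\<Sum>k=k0..N. LINT t|unif01. ?s k t) \<le> (\<Sum>k=k0..N. exp (2 * p) * c ^ k)"
    proof (rule sum_mono)
      fix k assume "k \<in> {k0..N}"
      then have "R0 \<le> exp (real k)" using k0 by (simp add: order_trans[OF k0])
      from dec[OF this] have psi: "psi_green D (exp (real k)) \<le> exp (- q * real k)" by (simp add: powr_def)
      define m where "m = (LINT t|unif01. ln (max (norm (f (circ r t))) (exp (real k))) - ln (exp (real k)))"
      have "0 \<le> m" unfolding m_def mean_log_eq_cnt(1)[OF r exp_gt_zero]
        by (intro integral_nonneg_AE) (auto intro!: cnt_nonneg)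
      then have "m \<le> 2 * pi * m" using pi_gt3 mult_right_mono[of 1 "2 * pi" m] by simp
      then have m: "m \<le> exp (- q * real k)"
        using mean_log_le_psi[OF r, of "exp (real k)"] psi unfolding m_def by simp
      have "(LINT t|unif01. ?s k t) = exp (p * (real k + 2)) * m" by (simp add: m_def)
      also have "\<dots> \<le> exp (p * (real k + 2)) * exp (- q * real k)" using m by simp
      also have "\<dots> = exp (2 * p) * c ^ k"
        by (simp add: c_def exp_of_nat_mult[symmetric] mult_exp_exp algebra_simps)
      finally show "(LINT t|unif01. ?s k t) \<le> exp (2 * p) * c ^ k" .
    qed
    also have "\<dots> = exp (2 * p) * (\<Sum>k=k0..N. c ^ k)" by (simp add: sum_distrib_left)
    also have "(\<Sum>k=k0..N. c ^ k) \<le> (\<Sum>k. c ^ k)"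
      using c by (intro sum_le_suminf summable_geometric) auto
    also have "(\<Sum>k. c ^ k) = 1 / (1 - c)" using c by (intro suminf_geometric) auto
    finally show ?thesis by (simp add: B_def)
  qed
  then show ?thesis using hardy_space_iff[OF hol p(1)] by blast
qed

text \<open>The constant C costs \<open>ln C / ln R\<close>, which vanishes at infinity.\<close>

lemma growth_ge:
  assumes C: "C > 0" "\<And>R. R \<ge> 1 \<Longrightarrow> psi_green D R \<le> C * R powr (- p)"
  shows "ereal p \<le> Liminf at_top (green_growth D)"
proof -
  have "((\<lambda>R. p - ln C / ln R) \<longlongrightarrow> p) at_top" by real_asymp
  then have "((\<lambda>R. ereal (p - ln C / ln R)) \<longlongrightarrow> ereal p) at_top" by (rule tendsto_ereal)
  then have "ereal p = Liminf at_top (\<lambda>R. ereal (p - ln C / ln R))"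
    by (intro lim_imp_Liminf[symmetric]) auto
  also have "\<dots> \<le> Liminf at_top (green_growth D)"
  proof (rule Liminf_mono)
    show "\<forall>\<^sub>F R in at_top. ereal (p - ln C / ln R) \<le> green_growth D R"
      using eventually_gt_at_top[of 1]
    proof eventually_elim
      case (elim R)
      show ?case
      proof (cases "psi_green D R = 0")
        case False
        then have pos: "psi_green D R > 0" using psi_nonneg[of R] elim by simp
        have lR: "ln R > 0" using elim by simp
        have "ln (psi_green D R) \<le> ln (C * R powr (- p))" using C elim pos by (subst ln_le_cancel_iff) auto
        also have "\<dots> = ln C - p * ln R" using C elim by (simp add: ln_mult ln_powr)
        finally have "(p * ln R - ln C) / ln R \<le> - ln (psi_green D R) / ln R"
          using lR by (intro divide_right_mono) auto
        then show ?thesis using False lR by (simp add: green_growth_def diff_divide_distrib)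
      qed (simp add: green_growth_def)
    qed
  qed
  finally show ?thesis .
qed

lemma hardy_number_le_liminf: "hardy_number f \<le> Liminf at_top (green_growth D)"
  unfolding hardy_number_def
proof (rule Sup_least)
  fix x assume "x \<in> ereal ` ({0} \<union> {p. 0 < p \<and> f \<in> hardy_space p})"
  then consider "x = ereal 0" | p where "x = ereal p" "0 < p" "f \<in> hardy_space p" by auto
  then show "x \<le> Liminf at_top (green_growth D)"
  proof cases
    case 1
    obtain C where "C > 0" "\<And>R. R \<ge> 1 \<Longrightarrow> psi_green D R \<le> C" using psi_bounded by blast
    then have "ereal 0 \<le> Liminf at_top (green_growth D)" by (intro growth_ge[of C]) auto
    with 1 show ?thesis by simp
  next
    case 2
    then show ?thesis using psi_decay growth_ge by blast
  qed
qed

text \<open>A number q is inserted strictly below the lower limit, because decay of order q is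
  turned into membership in the Hardy class only for exponents smaller than q.\<close>

lemma liminf_le_hardy_number: "Liminf at_top (green_growth D) \<le> hardy_number f"
proof (rule dense_le)
  fix y assume "y < Liminf at_top (green_growth D)"
  then obtain q where q: "y < ereal q" "ereal q < Liminf at_top (green_growth D)"
    using ereal_dense2 by blast
  have S0: "0 \<le> hardy_number f"
    unfolding hardy_number_def by (rule Sup_upper) (auto simp: zero_ereal_def)
  show "y \<le> hardy_number f"
  proof (cases "y \<le> 0")
    case True
    then show ?thesis using S0 by order
  next
    case False
    then obtain p where yp: "y = ereal p" using q(1) by (cases y) auto
    then have p: "0 < p" "p < q" using False q(1) by (auto simp: zero_ereal_def)
    have "\<forall>\<^sub>F R in at_top. ereal q < green_growth D R"
      using q(2) less_LiminfD by blast
    then have "\<forall>\<^sub>F R in at_top. ereal q < green_growth D R \<and> R > 1"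
      using eventually_gt_at_top[of "1::real"] by (rule eventually_conj)
    then obtain R0 where R0: "\<And>R. R \<ge> R0 \<Longrightarrow> ereal q < green_growth D R \<and> R > 1"
      by (auto simp: eventually_at_top_linorder)
    have "psi_green D R \<le> R powr (- q)" if "R \<ge> R0" for R
    proof (cases "psi_green D R = 0")
      case False
      have R: "R > 1" "ereal q < green_growth D R" using R0[OF that] by auto
      have pos: "psi_green D R > 0" using False psi_nonneg[of R] R by simp
      have "q < - ln (psi_green D R) / ln R" using R(2) False by (simp add: green_growth_def)
      then have "q * ln R < - ln (psi_green D R)" using R(1) by (simp add: field_simps)
      then have "ln (psi_green D R) \<le> ln (R powr (- q))" using R(1) by (simp add: ln_powr)
      then show ?thesis using pos R(1) by (subst (asm) ln_le_cancel_iff) auto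
    qed simp
    then have "f \<in> hardy_space p" by (rule hardy_space_of_psi_decay[OF p])
    then show ?thesis
      unfolding yp hardy_number_def using p by (intro Sup_upper) auto
  qed
qed

text \<open>The disc is simply connected, so g lifts through f to a self-map \<phi> of the disc. The
  subordination constant depends on \<phi>(0) but not on the radius, so g belongs to every Hardy
  class that contains f.\<close>

lemma hardy_number_minimal:
  assumes g: "g holomorphic_on ball 0 1" "g ` ball 0 1 \<subseteq> D"
  shows "hardy_number f \<le> hardy_number g"
proof -
  obtain \<phi> where \<phi>: "\<phi> holomorphic_on ball 0 1" "\<phi> \<in> ball 0 1 \<rightarrow> ball 0 1" "\<And>y. y \<in> ball 0 1 \<Longrightarrow> f (\<phi> y) = g y"
  proof (rule covering_space_lift_holomorphic[OF cov open_ball hol g(1)])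
    show "g \<in> ball 0 1 \<rightarrow> D" using g(2) by auto
    show "simply_connected (ball (0::complex) 1)" by (simp add: convex_imp_simply_connected)
    show "locally path_connected (ball (0::complex) 1)" by (simp add: convex_imp_locally_path_connected)
  qed (rule that)
  have \<phi>': "\<phi> ` ball 0 1 \<subseteq> ball 0 1" using \<phi>(2) by auto
  have "g \<in> hardy_space p" if p: "p > 0" "f \<in> hardy_space p" for p
  proof -
    obtain B where B: "\<And>r. 0 < r \<Longrightarrow> r < 1 \<Longrightarrow> (LINT t|unif01. norm (f (circ r t)) powr p) \<le> B"
      using p hardy_space_iff[OF hol p(1)] by blast
    have "(LINT t|unif01. norm (g (circ r t)) powr p) \<le> 4 / (1 - norm (\<phi> 0)) * B" if r: "0 < r" "r < 1" for r
      using subordination[OF \<phi>(1) \<phi>' p(1) B r] \<phi>(3) r by (simp add: norm_mult)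
    then show ?thesis using hardy_space_iff[OF g(1) p(1)] by blast
  qed
  then show ?thesis
    unfolding hardy_number_def by (intro Sup_subset_mono image_mono) auto
qed

lemma hardy_number_dom_eq: "hardy_number_dom D = hardy_number f"
  unfolding hardy_number_dom_def
proof (rule antisym)
  show "Inf (hardy_number ` {f. f holomorphic_on ball 0 1 \<and> f ` ball 0 1 \<subseteq> D}) \<le> hardy_number f"
    using hol image_f by (intro Inf_lower) auto
  show "hardy_number f \<le> Inf (hardy_number ` {f. f holomorphic_on ball 0 1 \<and> f ` ball 0 1 \<subseteq> D})"
    using hardy_number_minimal by (intro Inf_greatest) auto
qed

end

theorem theorem1p1:
  fixes D :: "complex set" and fD :: "complex \<Rightarrow> complex"
  assumes "greenian D"
    and "0 \<in> D"
    and "fD holomorphic_on ball 0 1"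
    and "covering_space (ball 0 1) fD D"
    and "fD 0 = 0"
  shows "hardy_number_dom D = hardy_number fD \<and>
         hardy_number fD = Liminf at_top (green_growth D)"
proof -
  interpret greenian_covering fD D
    using assms by unfold_locales (auto simp: greenian_def)
  show ?thesis
    using hardy_number_dom_eq hardy_number_le_liminf liminf_le_hardy_number by (auto intro: antisym)
qed

end
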